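(* Under the same setting and hypotheses as in the context (Assumptions 1, 2, 3 with constants $c_1>0$, $\rho\in(0,1)$ satisfying $2c_1<\log(\rho^{-1})$), there exists a positive constant $C$ such that, with truncation radius $m=C\log n$, the estimator $\widehat{X^T\Sigma X}\in\mathbb R^{p\times p}$ defined entrywise by $$\widehat{X^T\Sigma X}_{rs}=\sum_{i=1}^n\sum_{j:\,d(i,j)\le m}x_{ir}x_{js}\hat\epsilon_i\hat\epsilon_j,\qquad 1\le r,s\le p,$$ where $\hat\epsilon_i=Y_i-x_{i\cdot}^T\hat\beta$ are the fitted residuals and $\hat\beta=(X^TX)^{-1}X^TY$, satisfies $$\widehat{X^T\Sigma X}^{-1/2}(X^TX)(\hat\beta-\beta)\rightsquigarrow N(0,I_p)\quad\text{as }n\to\infty.$$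
   Context: Setting: $p\ge1$ fixed; for each $n$, $X=[x_{1\cdot},\dots,x_{n\cdot}]^T=(x_{ij})\in\mathbb R^{n\times p}$ is non-random, $\beta\in\mathbb R^p$ is fixed, $\epsilon=(\epsilon_1,\dots,\epsilon_n)^T$ is random with $\mathbb E\epsilon=0$, $\Sigma=\mathbb E\epsilon\epsilon^T$, and $Y=X\beta+\epsilon$. The dependence on $n$ of all objects is suppressed. $d(\cdot,\cdot)$ is a distance on the index set $\{1,\dots,n\}$ (nonnegative, symmetric, $d(i,i)=0$, satisfying the triangle inequality), e.g. the shortest-path distance of a graph with symmetric binary adjacency matrix $A$. For index sets $U,V$, $d(U,V)=\min_{i\in U,j\in V}d(i,j)$ and $d(i,U)=d(\{i\},U)$. For $m\ge0$, $N_m(i)=|\{j:d(i,j)\le m\}|$. For $U\subset\{1,\dots,n\}$, $S_U=\sum_{i\in U}\epsilon_i$. All constants below are independent of $n$. Assumption 1: there is a constant $c$ such that (a) $|x_{ij}|\le c$ for all $i$ and $1\le j\le p$; (b) $\sup_i\|\epsilon_i\|_4\le c$; (c) $c^{-1}I\preceq X^T\Sigma X/n\preceq cI$. Assumption 2 (correlation decay): there are constants $\rho\in(0,1)$ and $c>0$ such that (a) $|\mathbb E(\epsilon_i\epsilon_j^\ell)|\le c\rho^{d(i,j)}$ for $\ell\in\{1,2\}$ and all $i,j$; (b) $|\mathrm{Cov}(\epsilon_i\epsilon_j,\epsilon_k\epsilon_l)|\le c\rho^{d(\{i,j\},\{k,l\})}$ for all $i,j,k,l$; (c) for every bounded function $h:\mathbb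 R\to\mathbb R$ with bounded derivative, every constant $t$, every index $i$ and every index set $U$, $|\mathrm{Cov}(\epsilon_i,h(tS_U))|\le c(1+|t||U|)\rho^{d(i,U)}$ (the constant $c$ here may depend on $\|h\|_\infty$ and $\|h'\|_\infty$). Assumption 3 (network growth): there are constants $c_1,c>0$ such that for all $n$ and all $m\ge0$, $$\max\Big\{\Big(\tfrac1n\sum_i N_m^3(i)\Big)^{1/2},\ \tfrac1n\sum_iN_m^2(i)\Big\}\le c\,e^{c_1m}.$$ $\rightsquigarrow$ denotes convergence in distribution. *)

theory Defs
  imports "HOL-Analysis.Analysis" "HOL-Probability.Probability"
begin

text \<open>Conventions. For each sample size n, the design is given by its rows
  x n i :: real^'p (i < n), errors by eps n :: 'w => nat => real on the probability
  space M n (coordinates i < n), and the distance by d n :: nat => nat => real on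
  the index set {..<n}.\<close>

definition covar :: "'w measure \<Rightarrow> ('w \<Rightarrow> real) \<Rightarrow> ('w \<Rightarrow> real) \<Rightarrow> real" where
  "covar M X Y = (\<integral>w. X w * Y w \<partial>M) - (\<integral>w. X w \<partial>M) * (\<integral>w. Y w \<partial>M)"

definition dset :: "(nat \<Rightarrow> nat \<Rightarrow> real) \<Rightarrow> nat set \<Rightarrow> nat set \<Rightarrow> real" where
  "dset d U V = Min ((\<lambda>(i,j). d i j) ` (U \<times> V))"

definition nbhd_size :: "nat \<Rightarrow> (nat \<Rightarrow> nat \<Rightarrow> real) \<Rightarrow> real \<Rightarrow> nat \<Rightarrow> nat" where
  "nbhd_size n d m i = card {j. j < n \<and> d i j \<le> m}"

definition is_distance :: "nat \<Rightarrow> (nat \<Rightarrow> nat \<Rightarrow> real) \<Rightarrow> bool" where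
  "is_distance n d \<longleftrightarrow>
     (\<forall>i<n. \<forall>j<n. d i j \<ge> 0 \<and> d i j = d j i) \<and> (\<forall>i<n. d i i = 0) \<and>
     (\<forall>i<n. \<forall>j<n. \<forall>k<n. d i k \<le> d i j + d j k)"

definition XtX :: "nat \<Rightarrow> (nat \<Rightarrow> real^'p) \<Rightarrow> real^'p^'p" where
  "XtX n x = (\<chi> r s. \<Sum>i<n. x i $ r * x i $ s)"

definition Sigma :: "'w measure \<Rightarrow> ('w \<Rightarrow> nat \<Rightarrow> real) \<Rightarrow> nat \<Rightarrow> nat \<Rightarrow> real" where
  "Sigma M eps i j = (\<integral>w. eps w i * eps w j \<partial>M)"

definition XtSigmaX :: "nat \<Rightarrow> (nat \<Rightarrow> real^'p) \<Rightarrow> 'w measure \<Rightarrow> ('w \<Rightarrow> nat \<Rightarrow> real) \<Rightarrow> real^'p^'p" where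
  "XtSigmaX n x M eps = (\<chi> r s. \<Sum>i<n. \<Sum>j<n. x i $ r * x j $ s * Sigma M eps i j)"

definition Yobs :: "(nat \<Rightarrow> real^'p) \<Rightarrow> real^'p \<Rightarrow> (nat \<Rightarrow> real) \<Rightarrow> nat \<Rightarrow> real" where
  "Yobs x beta e i = x i \<bullet> beta + e i"

definition betahat :: "nat \<Rightarrow> (nat \<Rightarrow> real^'p) \<Rightarrow> real^'p \<Rightarrow> (nat \<Rightarrow> real) \<Rightarrow> real^'p" where
  "betahat n x beta e = matrix_inv (XtX n x) *v (\<Sum>i<n. Yobs x beta e i *\<^sub>R x i)"

definition resid :: "nat \<Rightarrow> (nat \<Rightarrow> real^'p) \<Rightarrow> real^'p \<Rightarrow> (nat \<Rightarrow> real) \<Rightarrow> nat \<Rightarrow> real" where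
  "resid n x beta e i = Yobs x beta e i - x i \<bullet> betahat n x beta e"

definition Shat :: "nat \<Rightarrow> (nat \<Rightarrow> real^'p) \<Rightarrow> (nat \<Rightarrow> nat \<Rightarrow> real) \<Rightarrow> real \<Rightarrow> real^'p
                     \<Rightarrow> (nat \<Rightarrow> real) \<Rightarrow> real^'p^'p" where
  "Shat n x d m beta e = (\<chi> r s. \<Sum>i<n. \<Sum>j\<in>{j. j < n \<and> d i j \<le> m}.
      x i $ r * x j $ s * resid n x beta e i * resid n x beta e j)"

definition pos_def :: "real^'p^'p \<Rightarrow> bool" where
  "pos_def A \<longleftrightarrow> transpose A = A \<and> (\<forall>v. v \<noteq> 0 \<longrightarrow> v \<bullet> (A *v v) > 0)"

text \<open>A^{-1/2}: the symmetric positive definite square root of A^{-1}, for symmetric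
  positive definite A (zero matrix otherwise, by convention)\<close>
definition inv_sqrtm :: "real^'p^'p \<Rightarrow> real^'p^'p" where
  "inv_sqrtm A = (if pos_def A then (THE S. pos_def S \<and> S ** S = matrix_inv A) else mat 0)"

definition stat :: "nat \<Rightarrow> (nat \<Rightarrow> real^'p) \<Rightarrow> (nat \<Rightarrow> nat \<Rightarrow> real) \<Rightarrow> real \<Rightarrow> real^'p
                     \<Rightarrow> (nat \<Rightarrow> real) \<Rightarrow> real^'p" where
  "stat n x d m beta e = inv_sqrtm (Shat n x d m beta e) *v (XtX n x *v (betahat n x beta e - beta))"

definition std_normal_vec :: "(real^'p) measure" where
  "std_normal_vec = density lborel (\<lambda>z. ennreal (\<Prod>k\<in>UNIV. std_normal_density (z $ k)))"

definition conv_distr :: "(nat \<Rightarrow> 'w measure) \<Rightarrow> (nat \<Rightarrow> 'w \<Rightarrow> real^'p) \<Rightarrow> (real^'p) measure \<Rightarrow> bool" where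
  "conv_distr M T L \<longleftrightarrow>
     (\<forall>\<^sub>F n in sequentially. T n \<in> borel_measurable (M n)) \<and>
     (\<forall>f :: real^'p \<Rightarrow> real. continuous_on UNIV f \<and> bounded (range f) \<longrightarrow>
        (\<lambda>n. \<integral>w. f (T n w) \<partial>M n) \<longlonglongrightarrow> (\<integral>z. f z \<partial>L))"

definition assumption1 :: "nat \<Rightarrow> (nat \<Rightarrow> 'w measure) \<Rightarrow> (nat \<Rightarrow> nat \<Rightarrow> real^'p)
    \<Rightarrow> (nat \<Rightarrow> 'w \<Rightarrow> nat \<Rightarrow> real) \<Rightarrow> real \<Rightarrow> bool" where
  "assumption1 N0 M x eps c \<longleftrightarrow> c > 0 \<and> (\<forall>n\<ge>N0.
     prob_space (M n) \<and>
     (\<forall>i<n. (\<lambda>w. eps n w i) \<in> borel_measurable (M n)) \<and>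
     (\<forall>i<n. integrable (M n) (\<lambda>w. (eps n w i) ^ 4)) \<and>
     (\<forall>i<n. (\<integral>w. eps n w i \<partial>M n) = 0) \<and>
     (\<forall>i<n. \<forall>j. \<bar>x n i $ j\<bar> \<le> c) \<and>
     (\<forall>i<n. (\<integral>w. (eps n w i) ^ 4 \<partial>M n) \<le> c ^ 4) \<and>
     (\<forall>v. (1 / c) * (v \<bullet> v) \<le> v \<bullet> ((XtSigmaX n (x n) (M n) (eps n) /\<^sub>R real n) *v v) \<and>
          v \<bullet> ((XtSigmaX n (x n) (M n) (eps n) /\<^sub>R real n) *v v) \<le> c * (v \<bullet> v)))"

definition assumption2 :: "nat \<Rightarrow> (nat \<Rightarrow> 'w measure) \<Rightarrow> (nat \<Rightarrow> 'w \<Rightarrow> nat \<Rightarrow> real)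
    \<Rightarrow> (nat \<Rightarrow> nat \<Rightarrow> nat \<Rightarrow> real) \<Rightarrow> real \<Rightarrow> real \<Rightarrow> bool" where
  "assumption2 N0 M eps d \<rho> c \<longleftrightarrow> 0 < \<rho> \<and> \<rho> < 1 \<and> c > 0 \<and>
     (\<forall>n\<ge>N0. \<forall>i<n. \<forall>j<n. \<forall>l\<in>{1::nat, 2}.
        \<bar>\<integral>w. eps n w i * (eps n w j) ^ l \<partial>M n\<bar> \<le> c * \<rho> powr (d n i j)) \<and>
     (\<forall>n\<ge>N0. \<forall>i<n. \<forall>j<n. \<forall>k<n. \<forall>l<n.
        \<bar>covar (M n) (\<lambda>w. eps n w i * eps n w j) (\<lambda>w. eps n w k * eps n w l)\<bar>
          \<le> c * \<rho> powr (dset (d n) {i, j} {k, l})) \<and>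
     (\<forall>B1 B2. \<exists>c'>0. \<forall>n\<ge>N0. \<forall>h h' t i U.
        (\<forall>y. \<bar>h y\<bar> \<le> B1) \<and> (\<forall>y. (h has_real_derivative h' y) (at y)) \<and> (\<forall>y. \<bar>h' y\<bar> \<le> B2) \<and>
        i < n \<and> U \<subseteq> {..<n} \<and> U \<noteq> {} \<longrightarrow>
        \<bar>covar (M n) (\<lambda>w. eps n w i) (\<lambda>w. h (t * (\<Sum>j\<in>U. eps n w j)))\<bar>
          \<le> c' * (1 + \<bar>t\<bar> * real (card U)) * \<rho> powr (dset (d n) {i} U))"

definition assumption3 :: "nat \<Rightarrow> (nat \<Rightarrow> nat \<Rightarrow> nat \<Rightarrow> real) \<Rightarrow> real \<Rightarrow> real \<Rightarrow> bool" where
  "assumption3 N0 d c1 c \<longleftrightarrow> c1 > 0 \<and> c > 0 \<and>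
     (\<forall>n\<ge>N0. \<forall>m\<ge>0.
        max (sqrt ((1 / real n) * (\<Sum>i<n. real (nbhd_size n (d n) m i) ^ 3)))
            ((1 / real n) * (\<Sum>i<n. real (nbhd_size n (d n) m i) ^ 2))
          \<le> c * exp (c1 * m))"

end

(*
  The covariance condition only concerns the unweighted sums S_U, whereas the statistic is a signed weighted sum
  of the errors.
  (1) For every index set U, Stein's differential equation for the characteristic function of S_U / sqrt n holds up
  to an error that vanishes when the truncation radius is m = C log n with 1 / log (1 / rho) < C < 1 / (2 c1).
  (2) Averaging over random sets U that contain j with probability p_j gives the characteristic function of
  sum_j p_j eps_j, up to an explicit Gaussian factor; this handles weights in [0, 1].
  (3) Negative weights are reached by approximating exp (- i x) in L^2 of the normal law by a trigonometric polynomial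
  with nonnegative frequencies, so the known part of the joint characteristic function determines the rest.
  (4) The covariance estimator is consistent in L^1 on the scale n, the inverse square root is locally Lipschitz, and
  a multivariate Levy continuity theorem (via Gaussian smoothing) yields convergence in distribution.
*)
theory Submission
  imports Defs
begin

section \<open>Moments and counting sums\<close>

text \<open>The window for \<open>C\<close> balances two errors. The covariance bound grows with
  \<open>card U\<close>, so the far parts contribute \<open>n * \<rho> powr m\<close>, which
  vanishes when \<open>C * ln (1 / \<rho>) > 1\<close>. The neighbourhood counts contribute
  \<open>exp (c1 * m) / sqrt n\<close>, which vanishes when \<open>2 * c1 * C < 1\<close>. The rate
  hypothesis says exactly that both can hold. The random-set average does not concentrate: given the
  errors, the sum over \<open>U\<close> may keep a variance of order one. This is harmless because
  that variance is nearly deterministic, and the subset variances average to the weighted variance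
  plus the same number; so a common Gaussian factor, bounded away from zero, can be divided out.
  Such averages only reach weights of one sign, hence the joint law of the positive and negative
  parts is known only on a quadrant of frequencies. The quadrant suffices because the error of the
  trigonometric approximation is measured in L2, and that norm involves one coordinate alone, whose
  characteristic function is known at negative frequencies by conjugation.\<close>

definition decay_sum :: "nat \<Rightarrow> (nat \<Rightarrow> nat \<Rightarrow> real) \<Rightarrow> real \<Rightarrow> nat \<Rightarrow> real" where
  "decay_sum n d r i = (\<Sum>j<n. r powr d i j)"

text \<open>Closed form of the geometric series with terms
  \<open>r ^ q * (cc\<^sup>2 * exp (2 * c1 * (q + 1)))\<close>, which bounds the mean of
  \<open>decay_sum ^ 3\<close>. Its ratio is below 1 for \<open>r = \<rho>\<close> by the rate
  hypothesis, and still for some \<open>r\<close> slightly above \<open>\<rho>\<close>.\<close>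

definition decay_const :: "real \<Rightarrow> real \<Rightarrow> real \<Rightarrow> real" where
  "decay_const c1 cc r = cc\<^sup>2 * exp (2 * c1) / (1 - r * exp (2 * c1))"

lemma cube_sum:
  fixes f :: "'i \<Rightarrow> 'b::comm_semiring_1"
  shows "(\<Sum>j\<in>A. f j) ^ 3 = (\<Sum>j\<in>A. \<Sum>k\<in>A. \<Sum>l\<in>A. f j * f k * f l)"
  by (simp add: power3_eq_cube mult.assoc flip: sum_distrib_left sum_distrib_right)

text \<open>AM-GM for two numbers, used on the pairs and then on their squares. It reduces mixed
  products to the fourth moments of Assumption 1.\<close>

lemma abs_mult4_le:
  fixes x y z u :: real
  shows "\<bar>x * y * z * u\<bar> \<le> (x^4 + y^4 + z^4 + u^4) / 4"
proof -
  have *: "\<bar>p * q\<bar> \<le> (p^2 + q^2) / 2" for p q :: real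
    using sum_squares_bound[of "\<bar>p\<bar>" "\<bar>q\<bar>"] by (simp add: abs_mult)
  have "\<bar>x * y * z * u\<bar> = \<bar>(x * y) * (z * u)\<bar>" by (simp add: mult.assoc)
  also have "\<dots> \<le> ((x * y)^2 + (z * u)^2) / 2" by (rule *)
  also have "(x * y)^2 = \<bar>x^2 * y^2\<bar>" by (simp add: power_mult_distrib)
  also have "(z * u)^2 = \<bar>z^2 * u^2\<bar>" by (simp add: power_mult_distrib)
  also have "(\<bar>x^2 * y^2\<bar> + \<bar>z^2 * u^2\<bar>) / 2 \<le> (((x^2)^2 + (y^2)^2) / 2 + ((z^2)^2 + (u^2)^2) / 2) / 2"
    by (intro divide_right_mono add_mono *) auto
  finally have "\<bar>x * y * z * u\<bar> \<le> ((x^4 + y^4) / 2 + (z^4 + u^4) / 2) / 2" by (simp flip: power_mult)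
  then show ?thesis by argo
qed

lemma (in prob_space) mult4_integrable_bound:
  fixes x y z u :: "'a \<Rightarrow> real"
  assumes [measurable]: "x \<in> borel_measurable M" "y \<in> borel_measurable M"
      "z \<in> borel_measurable M" "u \<in> borel_measurable M"
    and i: "integrable M (\<lambda>w. x w ^ 4)" "integrable M (\<lambda>w. y w ^ 4)"
      "integrable M (\<lambda>w. z w ^ 4)" "integrable M (\<lambda>w. u w ^ 4)"
    and b: "(\<integral>w. x w ^ 4 \<partial>M) \<le> K" "(\<integral>w. y w ^ 4 \<partial>M) \<le> K"
      "(\<integral>w. z w ^ 4 \<partial>M) \<le> K" "(\<integral>w. u w ^ 4 \<partial>M) \<le> K"
  shows "integrable M (\<lambda>w. x w * y w * z w * u w)"
    and "(\<integral>w. \<bar>x w * y w * z w * u w\<bar> \<partial>M) \<le> K"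
proof -
  have I: "integrable M (\<lambda>w. (x w^4 + y w^4 + z w^4 + u w^4) / 4)"
    using i by auto
  show "integrable M (\<lambda>w. x w * y w * z w * u w)"
  proof (rule Bochner_Integration.integrable_bound[OF I])
    show "AE w in M. norm (x w * y w * z w * u w) \<le> norm ((x w^4 + y w^4 + z w^4 + u w^4) / 4)"
      unfolding real_norm_def by (intro AE_I2 order_trans[OF abs_mult4_le abs_ge_self])
  qed simp
  then have "(\<integral>w. \<bar>x w * y w * z w * u w\<bar> \<partial>M) \<le> (\<integral>w. (x w^4 + y w^4 + z w^4 + u w^4) / 4 \<partial>M)"
    by (intro integral_mono I abs_mult4_le integrable_abs)
  also have "\<dots> \<le> K" using i b by simp
  finally show "(\<integral>w. \<bar>x w * y w * z w * u w\<bar> \<partial>M) \<le> K" .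
qed

text \<open>The second moment of \<open>\<bar>f w\<bar> - m\<close> is nonnegative for every
  \<open>m\<close>; taking for \<open>m\<close> the mean of \<open>\<bar>f w\<bar>\<close> gives the
  bound.\<close>

lemma (in prob_space) integral_abs_le_sqrt:
  fixes f :: "'a \<Rightarrow> real"
  assumes [measurable]: "f \<in> borel_measurable M" and i: "integrable M (\<lambda>w. f w ^ 2)"
  shows "integrable M f" "(\<integral>w. \<bar>f w\<bar> \<partial>M) \<le> sqrt (\<integral>w. f w ^ 2 \<partial>M)"
proof -
  have le: "\<bar>t\<bar> \<le> \<bar>1 + t^2\<bar>" for t :: real
    using sum_squares_bound[of "\<bar>t\<bar>" 1] by simp
  show if1: "integrable M f"
  proof (rule Bochner_Integration.integrable_bound)
    show "integrable M (\<lambda>w. 1 + f w ^ 2)" using i by simp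
    show "AE w in M. norm (f w) \<le> norm (1 + f w ^ 2)"
      unfolding real_norm_def by (intro AE_I2 le)
  qed simp
  let ?m = "\<integral>w. \<bar>f w\<bar> \<partial>M"
  have if2: "integrable M (\<lambda>w. \<bar>f w\<bar>)" using if1 by simp
  have *: "0 \<le> (\<integral>w. f w ^ 2 \<partial>M) - 2 * m * ?m + m^2" for m
  proof -
    have "0 \<le> (\<integral>w. (\<bar>f w\<bar> - m)^2 \<partial>M)"
      by (rule Bochner_Integration.integral_nonneg) (rule zero_le_power2)
    also have "\<dots> = (\<integral>w. f w ^2 - 2 * m * \<bar>f w\<bar> + m^2 \<partial>M)"
      by (intro Bochner_Integration.integral_cong) (simp_all add: power2_diff)
    also have "\<dots> = (\<integral>w. f w ^2 \<partial>M) - 2 * m * ?m + m^2"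
      using i if2 by (simp add: prob_space)
    finally show ?thesis .
  qed
  have "?m^2 \<le> (\<integral>w. f w ^2 \<partial>M)" using *[of ?m] by (simp add: power2_eq_square)
  then show "?m \<le> sqrt (\<integral>w. f w ^ 2 \<partial>M)" by (rule real_le_rsqrt)
qed

text \<open>One sample size is frozen and all constants are parameters, so every estimate is
  explicit in \<open>n\<close> and limits can be taken later. \<open>cov_fun\<close> fixes the
  bounds on \<open>h\<close> and \<open>h'\<close> to 1 because only cosine and sine are inserted;
  \<open>growth3\<close> is the squared form of the square root in Assumption 3, hence the exponent
  \<open>2 * c1 * m\<close>; \<open>rate\<close> is \<open>2 * c1 < ln (1 / \<rho>)\<close> in
  exponential form.\<close>

locale network_errors = prob_space M for M :: "'w measure" +
  fixes n :: nat and e :: "'w \<Rightarrow> nat \<Rightarrow> real" and d :: "nat \<Rightarrow> nat \<Rightarrow> real"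
    and a cb \<rho> ch c1 cc :: real
  assumes n_pos: "n > 0" and a_pos: "a > 0" and cb_pos: "cb > 0" and ch_pos: "ch > 0"
    and rho: "0 < \<rho>" "\<rho> < 1" and c1_pos: "c1 > 0" and cc_pos: "cc > 0"
    and rate: "\<rho> * exp (2 * c1) < 1"
    and e_meas: "\<And>i. i < n \<Longrightarrow> (\<lambda>w. e w i) \<in> borel_measurable M"
    and e_int4: "\<And>i. i < n \<Longrightarrow> integrable M (\<lambda>w. e w i ^ 4)"
    and e_mean: "\<And>i. i < n \<Longrightarrow> (\<integral>w. e w i \<partial>M) = 0"
    and e_mom4: "\<And>i. i < n \<Longrightarrow> (\<integral>w. e w i ^ 4 \<partial>M) \<le> a ^ 4"
    and dist: "is_distance n d"
    and cov_pair: "\<And>i j. i < n \<Longrightarrow> j < n \<Longrightarrow> \<bar>\<integral>w. e w i * e w j \<partial>M\<bar> \<le> cb * \<rho> powr d i j"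
    and cov_quad: "\<And>i j k l. i < n \<Longrightarrow> j < n \<Longrightarrow> k < n \<Longrightarrow> l < n \<Longrightarrow>
        \<bar>covar M (\<lambda>w. e w i * e w j) (\<lambda>w. e w k * e w l)\<bar> \<le> cb * \<rho> powr dset d {i, j} {k, l}"
    and cov_fun: "\<And>h h' t i U. (\<And>y. \<bar>h y\<bar> \<le> 1) \<Longrightarrow> (\<And>y. (h has_real_derivative h' y) (at y)) \<Longrightarrow>
        (\<And>y. \<bar>h' y\<bar> \<le> 1) \<Longrightarrow> i < n \<Longrightarrow> U \<subseteq> {..<n} \<Longrightarrow> U \<noteq> {} \<Longrightarrow>
        \<bar>covar M (\<lambda>w. e w i) (\<lambda>w. h (t * (\<Sum>j\<in>U. e w j)))\<bar>
          \<le> ch * (1 + \<bar>t\<bar> * real (card U)) * \<rho> powr dset d {i} U"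
    and growth2: "\<And>m. m \<ge> 0 \<Longrightarrow> (\<Sum>i<n. real (nbhd_size n d m i) ^ 2) \<le> real n * (cc * exp (c1 * m))"
    and growth3: "\<And>m. m \<ge> 0 \<Longrightarrow> (\<Sum>i<n. real (nbhd_size n d m i) ^ 3) \<le> real n * (cc\<^sup>2 * exp (2 * c1 * m))"
begin

declare e_meas [measurable (raw)]

abbreviation "N m i \<equiv> real (nbhd_size n d m i)"
abbreviation "B m i \<equiv> {j. j < n \<and> d i j \<le> m}"
abbreviation "R \<equiv> decay_sum n d"
abbreviation "S \<equiv> Defs.Sigma M e"

lemma d_nonneg: "i < n \<Longrightarrow> j < n \<Longrightarrow> d i j \<ge> 0" and d_sym: "i < n \<Longrightarrow> j < n \<Longrightarrow> d i j = d j i"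
  and d_refl: "i < n \<Longrightarrow> d i i = 0"
  using dist unfolding is_distance_def by blast+

text \<open>Products of fewer than four errors are padded with the constant \<open>a\<close>, whose
  fourth power is the moment bound itself, so the four-factor estimate covers all cases.\<close>

lemma int1: "i < n \<Longrightarrow> integrable M (\<lambda>w. e w i)"
  and int2: "i < n \<Longrightarrow> j < n \<Longrightarrow> integrable M (\<lambda>w. e w i * e w j)"
  and mom2: "i < n \<Longrightarrow> j < n \<Longrightarrow> (\<integral>w. \<bar>e w i * e w j\<bar> \<partial>M) \<le> a^2"
  and int3: "i < n \<Longrightarrow> j < n \<Longrightarrow> k < n \<Longrightarrow> integrable M (\<lambda>w. e w i * e w j * e w k)"
  and mom3: "i < n \<Longrightarrow> j < n \<Longrightarrow> k < n \<Longrightarrow> (\<integral>w. \<bar>e w i * e w j * e w k\<bar> \<partial>M) \<le> a^3"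
  and int4: "i < n \<Longrightarrow> j < n \<Longrightarrow> k < n \<Longrightarrow> l < n \<Longrightarrow> integrable M (\<lambda>w. e w i * e w j * e w k * e w l)"
proof -
  note b = mult4_integrable_bound[where K = "a^4"]
  have A: "(\<integral>w. a ^ 4 \<partial>M) \<le> a ^ 4" by (simp add: prob_space)
  have q: "t * c \<le> a^4 \<Longrightarrow> a^4 = s * c \<Longrightarrow> c > 0 \<Longrightarrow> t \<le> s" for t s c :: real
    by (metis mult_le_cancel_right_pos)
  {
    assume i: "i < n"
    show "integrable M (\<lambda>w. e w i)"
      using b(1)[of "\<lambda>w. e w i" "\<lambda>_. a" "\<lambda>_. a" "\<lambda>_. a"] i A a_pos e_int4 e_mom4 e_meas
      by (simp add: mult.assoc)
  }
  {
    assume i: "i < n" "j < n"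
    show "integrable M (\<lambda>w. e w i * e w j)"
      using b(1)[of "\<lambda>w. e w i" "\<lambda>w. e w j" "\<lambda>_. a" "\<lambda>_. a"] i A a_pos e_int4 e_mom4 e_meas
      by (simp add: mult.assoc[of _ a a])
    have "(\<integral>w. \<bar>e w i * e w j * a * a\<bar> \<partial>M) \<le> a^4"
      using b(2)[of "\<lambda>w. e w i" "\<lambda>w. e w j" "\<lambda>_. a" "\<lambda>_. a"] i A a_pos e_int4 e_mom4 e_meas by simp
    then have "(\<integral>w. \<bar>e w i * e w j\<bar> \<partial>M) * a^2 \<le> a^4"
      using a_pos by (simp add: abs_mult power2_eq_square mult.assoc[of _ a a])
    then show "(\<integral>w. \<bar>e w i * e w j\<bar> \<partial>M) \<le> a^2"
      by (rule q) (use a_pos in \<open>auto simp: power_numeral_reduce\<close>)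
  }
  {
    assume i: "i < n" "j < n" "k < n"
    show "integrable M (\<lambda>w. e w i * e w j * e w k)"
      using b(1)[of "\<lambda>w. e w i" "\<lambda>w. e w j" "\<lambda>w. e w k" "\<lambda>_. a"] i A a_pos e_int4 e_mom4 e_meas
      by simp
    have "(\<integral>w. \<bar>e w i * e w j * e w k * a\<bar> \<partial>M) \<le> a^4"
      using b(2)[of "\<lambda>w. e w i" "\<lambda>w. e w j" "\<lambda>w. e w k" "\<lambda>_. a"] i A a_pos e_int4 e_mom4 e_meas by simp
    then have "(\<integral>w. \<bar>e w i * e w j * e w k\<bar> \<partial>M) * a \<le> a^4"
      using a_pos by (simp add: abs_mult[of _ a])
    then show "(\<integral>w. \<bar>e w i * e w j * e w k\<bar> \<partial>M) \<le> a^3"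
      by (rule q) (use a_pos in \<open>auto simp: power_numeral_reduce\<close>)
  }
  assume i: "i < n" "j < n" "k < n" "l < n"
  then show "integrable M (\<lambda>w. e w i * e w j * e w k * e w l)"
    by (intro b(1)) (auto intro: e_int4 e_mom4)
qed

lemma N_card: "N m i = (\<Sum>j<n. of_bool (d i j \<le> m))"
proof -
  have "{..<n} \<inter> {j. d i j \<le> m} = B m i" by auto
  then show ?thesis by (simp add: nbhd_size_def flip: sum.inter_restrict)
qed

abbreviation "KR \<equiv> decay_const c1 cc"

text \<open>The cube expands into triples \<open>j\<close>, \<open>k\<close>, \<open>l\<close>,
  which are sorted by the integer part \<open>q\<close> of the largest of their distances to
  \<open>i\<close>. A triple in class \<open>q\<close> weighs at most \<open>r ^ q\<close>, since
  the distances are nonnegative, and lies in the ball of radius \<open>q + 1\<close>. Summing over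
  \<open>i\<close>, \<open>growth3\<close> leaves a geometric series of ratio
  \<open>r * exp (2 * c1)\<close>.\<close>

lemma decay_sum_cube:
  assumes r: "0 < r" "r < 1" "r * exp (2 * c1) < 1"
  shows "(\<Sum>i<n. R r i ^ 3) \<le> real n * KR r"
proof -
  \<comment> \<open>A strict bound on all distances makes the sum over distance classes
    finite.\<close>
  obtain K :: nat where K: "\<And>i j. i < n \<Longrightarrow> j < n \<Longrightarrow> d i j < real K"
  proof -
    obtain K :: nat where "Max ((\<lambda>(i,j). d i j) ` ({..<n} \<times> {..<n})) < real K"
      using reals_Archimedean2 by blast
    then have "d i j < real K" if "i < n" "j < n" for i j
    proof -
      have "(\<lambda>(i,j). d i j) (i, j) \<in> (\<lambda>(i,j). d i j) ` ({..<n} \<times> {..<n})"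
        using that by (intro imageI) auto
      then have "d i j \<le> Max ((\<lambda>(i,j). d i j) ` ({..<n} \<times> {..<n}))" by (intro Max_ge) auto
      then show ?thesis using \<open>Max _ < real K\<close> by linarith
    qed
    then show ?thesis using that by blast
  qed
  have pt: "r powr d i j * r powr d i k * r powr d i l \<le>
     (\<Sum>q<K. r ^ q * (of_bool (d i j \<le> q + 1) * of_bool (d i k \<le> q + 1) * of_bool (d i l \<le> q + 1)))"
    (is "_ \<le> sum ?g _") if "i < n" "j < n" "k < n" "l < n" for i j k l
  proof -
    define D where "D = max (d i j) (max (d i k) (d i l))"
    define q where "q = nat \<lfloor>D\<rfloor>"
    have D0: "D \<ge> 0" "D < K"
      using K[OF that(1,2)] K[OF that(1,3)] K[OF that(1,4)] d_nonneg[OF that(1,2)]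
      unfolding D_def by (simp_all add: le_max_iff_disj)
    then have q: "real q \<le> D" "D \<le> real q + 1" "q < K" unfolding q_def by linarith+
    have "r powr d i j * r powr d i k * r powr d i l = r powr (d i j + d i k + d i l)"
      by (simp add: powr_add)
    also have "\<dots> \<le> r powr (real q)"
    proof (rule powr_mono')
      have "D \<le> d i j + d i k + d i l" 
        using d_nonneg[OF that(1,2)] d_nonneg[OF that(1,3)] d_nonneg[OF that(1,4)] unfolding D_def by (simp add: max_def)
      then show "real q \<le> d i j + d i k + d i l" using q by linarith
    qed (use r in auto)
    also have "\<dots> = ?g q" using q r unfolding D_def by (auto simp: powr_realpow)
    also have "\<dots> \<le> sum ?g {..<K}"
      using q r by (intro member_le_sum) auto
    finally show ?thesis .
  qed
  have R3: "R r i ^ 3 \<le> (\<Sum>q<K. r ^ q * N (q + 1) i ^ 3)" if "i < n" for i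
  proof -
    have "R r i ^ 3 = (\<Sum>j<n. \<Sum>k<n. \<Sum>l<n. r powr d i j * r powr d i k * r powr d i l)"
      unfolding decay_sum_def by (rule cube_sum)
    also have "\<dots> \<le> (\<Sum>j<n. \<Sum>k<n. \<Sum>l<n. \<Sum>q<K. r ^ q * (of_bool (d i j \<le> q + 1) * of_bool (d i k \<le> q + 1) * of_bool (d i l \<le> q + 1)))"
      using that by (intro sum_mono pt) auto
    also have "\<dots> = (\<Sum>q<K. \<Sum>j<n. \<Sum>k<n. \<Sum>l<n. r ^ q * (of_bool (d i j \<le> q + 1) * of_bool (d i k \<le> q + 1) * of_bool (d i l \<le> q + 1)))"
      unfolding sum.swap[of _ "{..<K}" "{..<n}"] ..
    also have "\<dots> = (\<Sum>q<K. r ^ q * N (q + 1) i ^ 3)"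
      unfolding N_card cube_sum sum_distrib_left ..
    finally show ?thesis .
  qed
  have "(\<Sum>i<n. R r i ^ 3) \<le> (\<Sum>i<n. \<Sum>q<K. r ^ q * N (q + 1) i ^ 3)"
    by (intro sum_mono R3) auto
  also have "\<dots> = (\<Sum>q<K. r ^ q * (\<Sum>i<n. N (q + 1) i ^ 3))"
    by (subst sum.swap) (simp add: sum_distrib_left)
  also have "\<dots> \<le> (\<Sum>q<K. r ^ q * (real n * (cc\<^sup>2 * exp (2 * c1 * (q + 1)))))"
    using r by (intro sum_mono mult_left_mono growth3) auto
  also have "\<dots> = real n * (cc\<^sup>2 * exp (2 * c1)) * (\<Sum>q<K. (r * exp (2 * c1)) ^ q)"
    by (simp add: sum_distrib_left power_mult_distrib exp_add algebra_simps flip: exp_of_nat_mult)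
  also have "\<dots> \<le> real n * (cc\<^sup>2 * exp (2 * c1)) * (1 / (1 - r * exp (2 * c1)))"
  proof (intro mult_left_mono)
    have "(\<Sum>q<K. (r * exp (2 * c1)) ^ q) \<le> (\<Sum>q. (r * exp (2 * c1)) ^ q)"
      using r by (intro sum_le_suminf summable_geometric) auto
    then show "(\<Sum>q<K. (r * exp (2 * c1)) ^ q) \<le> 1 / (1 - r * exp (2 * c1))"
      using r by (simp add: suminf_geometric)
  qed auto
  finally show ?thesis by (simp add: decay_const_def)
qed

lemma R_ge_1: "i < n \<Longrightarrow> r > 0 \<Longrightarrow> R r i \<ge> 1"
  using member_le_sum[of i "{..<n}" "\<lambda>j. r powr d i j"] by (simp add: decay_sum_def d_refl)

lemma KR_nonneg: "r * exp (2 * c1) < 1 \<Longrightarrow> KR r \<ge> 0"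
  by (auto simp: decay_const_def)

text \<open>The diagonal term gives \<open>R r i \<ge> 1\<close>, so lower powers are dominated by
  the cube.\<close>

lemma decay_sum_power:
  assumes r: "0 < r" "r < 1" "r * exp (2 * c1) < 1" and k: "k \<le> 3"
  shows "(\<Sum>i<n. R r i ^ k) \<le> real n * KR r"
proof -
  have "(\<Sum>i<n. R r i ^ k) \<le> (\<Sum>i<n. R r i ^ 3)"
    using R_ge_1 r k by (intro sum_mono power_increasing) auto
  then show ?thesis using decay_sum_cube[OF r] by linarith
qed

end

section \<open>Concentration of quadratic forms in the errors\<close>

lemma (in prob_space) variance_linear_combination:
  fixes X :: "'i \<Rightarrow> 'a \<Rightarrow> real"
  assumes P: "finite P" and X: "\<And>p. p \<in> P \<Longrightarrow> integrable M (X p)"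
    and XX: "\<And>p q. p \<in> P \<Longrightarrow> q \<in> P \<Longrightarrow> integrable M (\<lambda>w. X p w * X q w)"
  shows "integrable M (\<lambda>w. (\<Sum>p\<in>P. \<alpha> p * (X p w - expectation (X p)))\<^sup>2)" (is "integrable M ?f")
    and "expectation (\<lambda>w. (\<Sum>p\<in>P. \<alpha> p * (X p w - expectation (X p)))\<^sup>2) =
      (\<Sum>p\<in>P. \<Sum>q\<in>P. \<alpha> p * \<alpha> q * covar M (X p) (X q))"
proof -
  let ?E = "\<lambda>p. expectation (X p)"
  define c where "c p q w = \<alpha> p * \<alpha> q * (X p w * X q w - ?E p * X q w - ?E q * X p w + ?E p * ?E q)" for p q w
  have f: "?f = (\<lambda>w. \<Sum>p\<in>P. \<Sum>q\<in>P. c p q w)"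
    by (auto simp: power2_eq_square sum_product c_def fun_eq_iff algebra_simps intro!: sum.cong)
  have c: "integrable M (c p q)" if "p \<in> P" "q \<in> P" for p q
    unfolding c_def[abs_def] using X XX that by auto
  show "integrable M ?f" unfolding f using c by auto
  have "expectation (c p q) = \<alpha> p * \<alpha> q * covar M (X p) (X q)" if "p \<in> P" "q \<in> P" for p q
    unfolding c_def[abs_def] covar_def using X XX that by (simp add: prob_space)
  then show "expectation ?f = (\<Sum>p\<in>P. \<Sum>q\<in>P. \<alpha> p * \<alpha> q * covar M (X p) (X q))"
    unfolding f using c by simp
qed

context network_errors begin

text \<open>The minimum is attained at one of the four pairs. Replacing it by the sum of all four
  decays lets the later sum over quadruples split into sums over two indices.\<close>

lemma rho_powr_dset_le:
  "\<rho> powr dset d {i, j} {k, l} \<le> \<rho> powr d i k + \<rho> powr d i l + \<rho> powr d j k + \<rho> powr d j l"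
proof -
  have "dset d {i, j} {k, l} \<in> (\<lambda>(i,j). d i j) ` ({i, j} \<times> {k, l})"
    unfolding dset_def by (rule Min_in) auto
  then consider "dset d {i, j} {k, l} = d i k" | "dset d {i, j} {k, l} = d i l"
    | "dset d {i, j} {k, l} = d j k" | "dset d {i, j} {k, l} = d j l" by auto
  moreover have "\<rho> powr z \<ge> 0" for z by simp
  ultimately show ?thesis by cases (smt (verit))+
qed

abbreviation "near m i j \<equiv> (of_bool (d i j \<le> m) :: real)"

lemma near_sym: "i < n \<Longrightarrow> j < n \<Longrightarrow> near m i j = near m j i"
  by (simp add: d_sym)

lemma near_sums:
  "(\<Sum>i<n. \<Sum>j<n. near m i j * F i) = (\<Sum>i<n. N m i * F i)"
  "(\<Sum>i<n. \<Sum>j<n. near m i j * F j) = (\<Sum>i<n. N m i * F i)"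
proof -
  show *: "(\<Sum>i<n. \<Sum>j<n. near m i j * F i) = (\<Sum>i<n. N m i * F i)" for F :: "nat \<Rightarrow> real"
    unfolding N_card sum_distrib_right ..
  have "(\<Sum>i<n. \<Sum>j<n. near m i j * F j) = (\<Sum>j<n. \<Sum>i<n. near m j i * F j)"
    by (subst sum.swap) (auto intro!: sum.cong simp: d_sym)
  then show "(\<Sum>i<n. \<Sum>j<n. near m i j * F j) = (\<Sum>i<n. N m i * F i)" by (simp only: *)
qed

text \<open>By \<open>N m u * N m v \<le> (N m u ^ 2 + N m v ^ 2) / 2\<close> and symmetry the
  double sum is at most the sum of \<open>N m u ^ 2 * R \<rho> u\<close>. Then
  \<open>x\<^sup>2 * y \<le> x ^ 3 + y ^ 3\<close> separates counts from decay; this is where third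
  moments of the neighbourhood sizes enter.\<close>

lemma sum_N_N_decay:
  assumes "m \<ge> 0"
  shows "(\<Sum>u<n. \<Sum>v<n. N m u * N m v * \<rho> powr d u v) \<le> real n * (cc\<^sup>2 * exp (2 * c1 * m) + KR \<rho>)"
proof -
  have sq: "N m u * N m v \<le> (N m u ^ 2 + N m v ^ 2) / 2" for u v
    using sum_squares_bound[of "N m u" "N m v"] by simp
  have "(\<Sum>u<n. \<Sum>v<n. N m u * N m v * \<rho> powr d u v)
      \<le> (\<Sum>u<n. \<Sum>v<n. (N m u ^ 2 + N m v ^ 2) / 2 * \<rho> powr d u v)"
    by (intro sum_mono mult_right_mono sq) auto
  also have "\<dots> = (\<Sum>u<n. \<Sum>v<n. N m u ^ 2 * \<rho> powr d u v) / 2 + (\<Sum>u<n. \<Sum>v<n. N m v ^ 2 * \<rho> powr d u v) / 2"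
    by (simp add: sum.distrib add_divide_distrib distrib_right sum_divide_distrib)
  also have "(\<Sum>u<n. \<Sum>v<n. N m v ^ 2 * \<rho> powr d u v) = (\<Sum>u<n. \<Sum>v<n. N m u ^ 2 * \<rho> powr d u v)"
    by (subst sum.swap) (auto intro!: sum.cong simp: d_sym)
  also have "(\<Sum>u<n. \<Sum>v<n. N m u ^ 2 * \<rho> powr d u v) / 2 + (\<Sum>u<n. \<Sum>v<n. N m u ^ 2 * \<rho> powr d u v) / 2
      = (\<Sum>u<n. N m u ^ 2 * R \<rho> u)"
    by (simp add: decay_sum_def sum_distrib_left)
  also have "\<dots> \<le> (\<Sum>u<n. N m u ^ 3 + R \<rho> u ^ 3)"
  proof (intro sum_mono)
    fix u assume "u \<in> {..<n}"
    then have r: "R \<rho> u \<ge> 0" using R_ge_1[of u \<rho>] rho by auto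
    show "N m u ^ 2 * R \<rho> u \<le> N m u ^ 3 + R \<rho> u ^ 3"
    proof (cases "R \<rho> u \<le> N m u")
      case True
      then have "N m u ^ 2 * R \<rho> u \<le> N m u ^ 2 * N m u" by (intro mult_left_mono) auto
      also have "\<dots> = N m u ^ 3" by (simp add: power_numeral_reduce)
      finally show ?thesis using r by (smt (verit) zero_le_power)
    next
      case False
      then have "N m u ^ 2 * R \<rho> u \<le> R \<rho> u ^ 2 * R \<rho> u" using r by (intro mult_right_mono power_mono) auto
      also have "\<dots> = R \<rho> u ^ 3" by (simp add: power_numeral_reduce)
      finally show ?thesis by (smt (verit) of_nat_0_le_iff zero_le_power)
    qed
  qed
  also have "\<dots> \<le> real n * (cc\<^sup>2 * exp (2 * c1 * m) + KR \<rho>)"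
    using growth3[OF assms] decay_sum_cube[OF rho rate] by (simp add: sum.distrib distrib_left)
  finally show ?thesis .
qed

text \<open>Square root of a variance bound: \<open>cb / n\<^sup>2\<close> times four copies of the
  sum in \<open>sum_N_N_decay\<close>, one for each way a near pair can be linked to another near
  pair.\<close>

definition vbound :: "real \<Rightarrow> real" where
  "vbound m = sqrt (4 * cb * (cc\<^sup>2 * exp (2 * c1 * m) + KR \<rho>) / real n)"

lemma vbound_nonneg: "vbound m \<ge> 0"
  unfolding vbound_def using cb_pos KR_nonneg[OF rate] by auto

text \<open>The variance is a sum over two near pairs of a covariance controlled by Assumption 2(b).
  In each of the four decay terms only one index of each pair occurs; summing the other index over
  its ball produces \<open>N m u * N m v * \<rho> powr d u v\<close>. It serves three times: for the
  variance in the limit theorem, for the diagonal with \<open>m = 0\<close>, and for the covariance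
  estimator.\<close>

lemma near_pairs_deviation:
  assumes m: "m \<ge> 0" and A: "A \<ge> 0"
    and \<alpha>: "\<And>i j. i < n \<Longrightarrow> j < n \<Longrightarrow> \<bar>\<alpha> i j\<bar> \<le> A * near m i j"
  defines "V \<equiv> \<lambda>w. (\<Sum>i<n. \<Sum>j<n. \<alpha> i j * (e w i * e w j)) / real n - (\<Sum>i<n. \<Sum>j<n. \<alpha> i j * S i j) / real n"
  shows "integrable M V" "expectation (\<lambda>w. \<bar>V w\<bar>) \<le> A * vbound m"
proof -
  define P where "P = {..<n} \<times> {..<n}"
  define X where "X p w = e w (fst p) * e w (snd p)" for p w
  define \<beta> where "\<beta> p = \<alpha> (fst p) (snd p) / real n" for p
  have EX: "expectation (X (i, j)) = S i j" for i j by (simp add: X_def[abs_def] Defs.Sigma_def)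
  have V: "V w = (\<Sum>p\<in>P. \<beta> p * (X p w - expectation (X p)))" for w
    unfolding V_def P_def \<beta>_def sum.cartesian_product' diff_divide_distrib[symmetric] sum_subtractf[symmetric]
      sum_divide_distrib
    by (simp add: EX X_def right_diff_distrib diff_divide_distrib)
  have P: "finite P" unfolding P_def by simp
  have X1: "integrable M (X p)" if "p \<in> P" for p
    using that int2 unfolding P_def X_def[abs_def] by auto
  have X2: "integrable M (\<lambda>w. X p w * X q w)" if "p \<in> P" "q \<in> P" for p q
    using that int4 unfolding P_def X_def[abs_def] by (auto simp: mult.assoc)
  note vl = variance_linear_combination[OF P X1 X2, where \<alpha> = \<beta>]
  have Vm[measurable]: "V \<in> borel_measurable M" unfolding V_def by simp
  have i2: "integrable M (\<lambda>w. V w ^ 2)" using vl(1) unfolding V .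
  show "integrable M V" using integral_abs_le_sqrt(1)[OF Vm i2] .
  have "expectation (\<lambda>w. V w ^ 2) = (\<Sum>p\<in>P. \<Sum>q\<in>P. \<beta> p * \<beta> q * covar M (X p) (X q))"
    unfolding V by (rule vl(2))
  also have "\<dots> \<le> (\<Sum>p\<in>P. \<Sum>q\<in>P. (A * near m (fst p) (snd p) / n) * (A * near m (fst q) (snd q) / n) *
      (cb * (\<rho> powr d (fst p) (fst q) + \<rho> powr d (fst p) (snd q) + \<rho> powr d (snd p) (fst q) + \<rho> powr d (snd p) (snd q))))"
  proof (intro sum_mono)
    fix p q assume pq: "p \<in> P" "q \<in> P"
    then have lt: "fst p < n" "snd p < n" "fst q < n" "snd q < n" by (auto simp: P_def)
    have b: "\<bar>\<beta> p\<bar> \<le> A * near m (fst p) (snd p) / n" "\<bar>\<beta> q\<bar> \<le> A * near m (fst q) (snd q) / n"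
      using \<alpha> lt unfolding \<beta>_def by (auto simp: divide_simps)
    have "\<bar>covar M (X p) (X q)\<bar> \<le> cb * \<rho> powr dset d {fst p, snd p} {fst q, snd q}"
      using cov_quad lt unfolding X_def[abs_def] by auto
    also have "\<dots> \<le> cb * (\<rho> powr d (fst p) (fst q) + \<rho> powr d (fst p) (snd q) + \<rho> powr d (snd p) (fst q) + \<rho> powr d (snd p) (snd q))"
      using cb_pos by (intro mult_left_mono rho_powr_dset_le) auto
    finally have c: "\<bar>covar M (X p) (X q)\<bar> \<le> \<dots>" .
    have "\<bar>\<beta> p * \<beta> q * covar M (X p) (X q)\<bar> \<le> (A * near m (fst p) (snd p) / n) * (A * near m (fst q) (snd q) / n) *
      (cb * (\<rho> powr d (fst p) (fst q) + \<rho> powr d (fst p) (snd q) + \<rho> powr d (snd p) (fst q) + \<rho> powr d (snd p) (snd q)))"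
      unfolding abs_mult using A cb_pos by (intro mult_mono b c) auto
    then show "\<beta> p * \<beta> q * covar M (X p) (X q) \<le> (A * near m (fst p) (snd p) / n) * (A * near m (fst q) (snd q) / n) *
      (cb * (\<rho> powr d (fst p) (fst q) + \<rho> powr d (fst p) (snd q) + \<rho> powr d (snd p) (fst q) + \<rho> powr d (snd p) (snd q)))"
      by linarith
  qed
  also have "\<dots> = A^2 * cb / n^2 * (\<Sum>i<n. \<Sum>j<n. near m i j * (\<Sum>k<n. \<Sum>l<n. near m k l *
      (\<rho> powr d i k + \<rho> powr d i l + \<rho> powr d j k + \<rho> powr d j l)))"
    unfolding P_def sum.cartesian_product'
    unfolding sum_distrib_left by (intro sum.cong refl) (simp add: power2_eq_square del: of_bool_eq_0_iff)
  also have "(\<Sum>i<n. \<Sum>j<n. near m i j * (\<Sum>k<n. \<Sum>l<n. near m k l *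
      (\<rho> powr d i k + \<rho> powr d i l + \<rho> powr d j k + \<rho> powr d j l)))
    = 4 * (\<Sum>u<n. \<Sum>v<n. N m u * N m v * \<rho> powr d u v)"
  proof -
    \<comment> \<open>Total decay seen from \<open>u\<close> when a near pair is summed out; both
      ends of the pair contribute equally because nearness is symmetric, hence the factor 2.\<close>
    define H where "H u = 2 * (\<Sum>v<n. N m v * \<rho> powr d u v)" for u
    have inner: "(\<Sum>k<n. \<Sum>l<n. near m k l * (\<rho> powr d i k + \<rho> powr d i l + \<rho> powr d j k + \<rho> powr d j l))
       = H i + H j" for i j
      unfolding distrib_left sum.distrib near_sums(1)[where F = "\<lambda>v. \<rho> powr d i v"]
        near_sums(1)[where F = "\<lambda>v. \<rho> powr d j v"] near_sums(2)[where F = "\<lambda>v. \<rho> powr d i v"]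
        near_sums(2)[where F = "\<lambda>v. \<rho> powr d j v"] by (simp add: H_def)
    have "(\<Sum>u<n. N m u * H u) = 2 * (\<Sum>u<n. \<Sum>v<n. N m u * N m v * \<rho> powr d u v)"
      unfolding H_def sum_distrib_left by (intro sum.cong refl) simp
    then show ?thesis
      unfolding inner unfolding distrib_left sum.distrib near_sums(1)[where F = H] near_sums(2)[where F = H]
      by simp
  qed
  also have "A^2 * cb / n^2 * (4 * (\<Sum>u<n. \<Sum>v<n. N m u * N m v * \<rho> powr d u v))
     \<le> A^2 * cb / n^2 * (4 * (real n * (cc\<^sup>2 * exp (2 * c1 * m) + KR \<rho>)))"
    using cb_pos by (intro mult_left_mono sum_N_N_decay m) auto
  also have "\<dots> = (A * vbound m)^2"
    unfolding vbound_def power_mult_distrib using cb_pos KR_nonneg[OF rate] n_pos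
    by (subst real_sqrt_pow2) (auto simp: divide_simps power2_eq_square)
  finally have "sqrt (expectation (\<lambda>w. V w ^ 2)) \<le> A * vbound m"
    using A vbound_nonneg by (intro real_le_lsqrt) (auto intro!: integral_nonneg)
  then show "expectation (\<lambda>w. \<bar>V w\<bar>) \<le> A * vbound m"
    using integral_abs_le_sqrt(2)[OF Vm i2] by linarith
qed

lemma S_bound: "i < n \<Longrightarrow> j < n \<Longrightarrow> \<bar>S i j\<bar> \<le> cb * \<rho> powr d i j"
  unfolding Defs.Sigma_def by (rule cov_pair)

text \<open>The intermediate rate \<open>r\<close> splits \<open>\<rho> powr d i j\<close> into
  \<open>(\<rho> / r) powr d i j\<close>, at most \<open>(\<rho> / r) powr m\<close> beyond distance
  \<open>m\<close>, and \<open>r powr d i j\<close>, which is still summable on average.\<close>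

lemma far_pairs_bound:
  assumes m: "m \<ge> 0" and A: "A \<ge> 0" and r: "\<rho> < r" "r < 1" "r * exp (2 * c1) < 1"
    and \<alpha>: "\<And>i j. i < n \<Longrightarrow> j < n \<Longrightarrow> \<bar>\<alpha> i j\<bar> \<le> A"
  shows "\<bar>(\<Sum>i<n. \<Sum>j<n. (\<alpha> i j * (1 - near m i j)) * S i j) / n\<bar> \<le> A * cb * KR r * (\<rho> / r) powr m"
proof -
  have "\<bar>\<Sum>i<n. \<Sum>j<n. (\<alpha> i j * (1 - near m i j)) * S i j\<bar>
    \<le> (\<Sum>i<n. \<Sum>j<n. A * cb * (\<rho> / r) powr m * r powr d i j)"
  proof (intro order_trans[OF sum_abs] sum_mono)
    fix i j assume ij: "i \<in> {..<n}" "j \<in> {..<n}"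
    show "\<bar>(\<alpha> i j * (1 - near m i j)) * S i j\<bar> \<le> A * cb * (\<rho> / r) powr m * r powr d i j"
    proof (cases "d i j \<le> m")
      case True then show ?thesis using A cb_pos by auto
    next
      case False
      have "\<rho> powr d i j = (\<rho> / r) powr d i j * r powr d i j"
        using rho r by (simp add: powr_divide)
      also have "\<dots> \<le> (\<rho> / r) powr m * r powr d i j"
        using rho r False by (intro mult_right_mono powr_mono') auto
      finally have *: "\<rho> powr d i j \<le> (\<rho> / r) powr m * r powr d i j" .
      have "\<bar>\<alpha> i j * S i j\<bar> \<le> A * (cb * ((\<rho> / r) powr m * r powr d i j))"
        unfolding abs_mult using S_bound[of i j] ij * cb_pos A \<alpha>
        by (intro mult_mono order_trans[OF S_bound mult_left_mono[OF *]]) auto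
      then show ?thesis using False by (simp add: mult.assoc)
    qed
  qed
  also have "\<dots> = A * cb * (\<rho> / r) powr m * (\<Sum>i<n. R r i ^ 1)"
    by (simp add: decay_sum_def sum_distrib_left)
  also have "\<dots> \<le> A * cb * (\<rho> / r) powr m * (real n * KR r)"
    using A cb_pos rho r by (intro mult_left_mono decay_sum_power) auto
  finally show ?thesis using n_pos by (simp add: divide_simps mult_ac)
qed

end

section \<open>Central limit theorem for unweighted sums\<close>

lemma cmod_iexp_1: "cmod (iexp x - 1 - \<i> * x) \<le> x\<^sup>2 / 2"
  using iexp_approx1[of x 1] by (simp add: numeral_2_eq_2 algebra_simps)

lemma integrable_mult_iexp:
  fixes f g :: "'a \<Rightarrow> real"
  assumes f: "integrable M f" and [measurable]: "g \<in> borel_measurable M"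
  shows "integrable M (\<lambda>w. complex_of_real (f w) * iexp (g w))"
proof (rule Bochner_Integration.integrable_bound[OF f])
  show "AE w in M. cmod (complex_of_real (f w) * iexp (g w)) \<le> norm (f w)"
    by (simp add: norm_mult)
qed (use f in simp)

lemma (in prob_space) integrable_iexp_rv:
  assumes [measurable]: "g \<in> borel_measurable M"
  shows "integrable M (\<lambda>w. iexp (g w))"
  using integrable_mult_iexp[of M "\<lambda>_. 1" g] by simp

lemma integral_double_sum:
  fixes f :: "'i \<Rightarrow> 'j \<Rightarrow> 'a \<Rightarrow> real"
  assumes f: "\<And>i j. i \<in> A \<Longrightarrow> j \<in> B \<Longrightarrow> integrable M (f i j)"
  shows "integrable M (\<lambda>w. \<Sum>i\<in>A. \<Sum>j\<in>B. c i j * f i j w)"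
    and "(\<integral>w. (\<Sum>i\<in>A. \<Sum>j\<in>B. c i j * f i j w) \<partial>M) = (\<Sum>i\<in>A. \<Sum>j\<in>B. c i j * (\<integral>w. f i j w \<partial>M))"
proof -
  have i: "integrable M (\<lambda>w. c i j * f i j w)" if "i \<in> A" "j \<in> B" for i j
    using f that by (intro integrable_mult_right)
  show "integrable M (\<lambda>w. \<Sum>i\<in>A. \<Sum>j\<in>B. c i j * f i j w)"
    by (intro Bochner_Integration.integrable_sum i)
  have "(\<integral>w. (\<Sum>i\<in>A. \<Sum>j\<in>B. c i j * f i j w) \<partial>M) = (\<Sum>i\<in>A. \<integral>w. (\<Sum>j\<in>B. c i j * f i j w) \<partial>M)"
    by (intro Bochner_Integration.integral_sum Bochner_Integration.integrable_sum i)
  also have "\<dots> = (\<Sum>i\<in>A. \<Sum>j\<in>B. \<integral>w. c i j * f i j w \<partial>M)"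
    by (intro sum.cong refl Bochner_Integration.integral_sum i)
  finally show "(\<integral>w. (\<Sum>i\<in>A. \<Sum>j\<in>B. c i j * f i j w) \<partial>M) = (\<Sum>i\<in>A. \<Sum>j\<in>B. c i j * (\<integral>w. f i j w \<partial>M))"
    by simp
qed

lemma cmod_integral_le:
  fixes f :: "'a \<Rightarrow> complex"
  assumes "integrable M f" "integrable M g" "\<And>w. w \<in> space M \<Longrightarrow> cmod (f w) \<le> g w"
  shows "cmod (\<integral>w. f w \<partial>M) \<le> (\<integral>w. g w \<partial>M)"
  by (rule order_trans[OF integral_norm_bound]) (intro integral_mono integrable_norm assms)

text \<open>The second-order remainder \<open>(s - t)\<^sup>2 * (W w)\<^sup>2 / 2\<close> makes the
  difference quotient converge linearly in \<open>s - t\<close>, so a finite second moment is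
  enough.\<close>

lemma (in prob_space) char_fun_derivative:
  fixes W :: "'a \<Rightarrow> real"
  assumes [measurable]: "W \<in> borel_measurable M" and W2: "integrable M (\<lambda>w. W w ^ 2)"
  shows "((\<lambda>t. expectation (\<lambda>w. iexp (t * W w))) has_vector_derivative
     \<i> * expectation (\<lambda>w. of_real (W w) * iexp (t * W w))) (at t)"
proof -
  note W1 = integral_abs_le_sqrt(1)[OF assms]
  let ?\<phi> = "\<lambda>t. expectation (\<lambda>w. iexp (t * W w))"
  let ?D = "\<i> * expectation (\<lambda>w. of_real (W w) * iexp (t * W w))"
  have i0: "integrable M (\<lambda>w. iexp (s * W w))" for s by (rule integrable_iexp_rv) simp
  have i1: "integrable M (\<lambda>w. of_real (W w) * iexp (t * W w))"
    by (rule integrable_mult_iexp[OF W1]) simp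
  have bd: "cmod (?\<phi> s - ?\<phi> t - (s - t) *\<^sub>R ?D) \<le> (s - t)\<^sup>2 * (expectation (\<lambda>w. W w ^ 2) / 2)" for s
  proof -
    have "?\<phi> s - ?\<phi> t - (s - t) *\<^sub>R ?D =
       expectation (\<lambda>w. iexp (s * W w) - iexp (t * W w) - (s - t) *\<^sub>R (\<i> * (of_real (W w) * iexp (t * W w))))"
      using i0 i1 by simp
    also have "cmod \<dots> \<le> expectation (\<lambda>w. (s - t)\<^sup>2 / 2 * W w ^ 2)"
    proof (rule cmod_integral_le)
      fix w
      have "iexp (s * W w) = iexp (t * W w) * iexp ((s - t) * W w)"
        by (simp add: exp_add[symmetric] algebra_simps)
      then have "iexp (s * W w) - iexp (t * W w) - (s - t) *\<^sub>R (\<i> * (of_real (W w) * iexp (t * W w)))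
        = iexp (t * W w) * (iexp ((s - t) * W w) - 1 - \<i> * ((s - t) * W w))"
        by (simp add: algebra_simps scaleR_conv_of_real)
      then show "cmod (iexp (s * W w) - iexp (t * W w) - (s - t) *\<^sub>R (\<i> * (of_real (W w) * iexp (t * W w))))
        \<le> (s - t)\<^sup>2 / 2 * W w ^ 2"
        using cmod_iexp_1[of "(s - t) * W w"] by (simp add: norm_mult power_mult_distrib)
    qed (use i0 i1 W2 in auto)
    finally show ?thesis by simp
  qed
  let ?C = "expectation (\<lambda>w. W w ^ 2) / 2"
  have le: "cmod (?\<phi> s - ?\<phi> t - (s - t) *\<^sub>R ?D) / norm (s - t) \<le> \<bar>s - t\<bar> * ?C" for s
  proof (cases "s = t")
    case False
    have eq: "(s - t)\<^sup>2 * ?C = \<bar>s - t\<bar> * ?C * \<bar>s - t\<bar>" 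
    proof -
      have "(s - t)\<^sup>2 = \<bar>s - t\<bar> * \<bar>s - t\<bar>" by (simp add: power2_eq_square)
      then show ?thesis by (simp only: mult_ac)
    qed
    show ?thesis
      using bd[of s] False unfolding eq real_norm_def by (subst pos_divide_le_eq) linarith+
  qed simp
  have lim: "((\<lambda>s. \<bar>s - t\<bar> * ?C) \<longlongrightarrow> \<bar>t - t\<bar> * ?C) (at t)" by (intro tendsto_intros)
  have "((\<lambda>s. cmod (?\<phi> s - ?\<phi> t - (s - t) *\<^sub>R ?D) / norm (s - t)) \<longlongrightarrow> 0) (at t)"
  proof (rule tendsto_sandwich[OF _ _ tendsto_const])
    show "\<forall>\<^sub>F s in at t. 0 \<le> cmod (?\<phi> s - ?\<phi> t - (s - t) *\<^sub>R ?D) / norm (s - t)"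
      by (intro always_eventually allI divide_nonneg_nonneg norm_ge_zero)
    show "\<forall>\<^sub>F s in at t. cmod (?\<phi> s - ?\<phi> t - (s - t) *\<^sub>R ?D) / norm (s - t) \<le> \<bar>s - t\<bar> * ?C"
      by (intro always_eventually allI le)
    show "((\<lambda>s. \<bar>s - t\<bar> * ?C) \<longlongrightarrow> 0) (at t)" using lim by simp
  qed
  then show ?thesis
    unfolding has_vector_derivative_def has_derivative_iff_norm
    using bounded_linear_scaleR_left by blast
qed

text \<open>The differential equation \<open>\<phi>' = - t s \<phi>\<close> of the Gaussian characteristic function is stable:
  an error in the equation is inherited by the solution without growing.\<close>
lemma (in prob_space) char_fun_gaussian_ode:
  fixes W :: "'a \<Rightarrow> real"
  assumes [measurable]: "W \<in> borel_measurable M" and W2: "integrable M (\<lambda>w. W w ^ 2)"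
    and s: "s \<ge> 0" and T: "T \<ge> 0"
    and err: "\<And>t. 0 \<le> t \<Longrightarrow> t \<le> T \<Longrightarrow>
      cmod (expectation (\<lambda>w. of_real (W w) * iexp (t * W w)) - \<i> * t * s * expectation (\<lambda>w. iexp (t * W w))) \<le> \<epsilon>"
  shows "cmod (expectation (\<lambda>w. iexp (T * W w)) - of_real (exp (- (T\<^sup>2 * s / 2)))) \<le> T * \<epsilon>"
proof -
  let ?\<phi> = "\<lambda>t. expectation (\<lambda>w. iexp (t * W w))"
  let ?D = "\<lambda>t. \<i> * expectation (\<lambda>w. of_real (W w) * iexp (t * W w))"
  \<comment> \<open>Integrating factor: \<open>f\<close> would be constant if the equation were
    exact, and its derivative is the defect of the equation times this factor.\<close>
  define f where "f t = exp (t\<^sup>2 * s / 2) *\<^sub>R ?\<phi> t" for t :: real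
  define f' where "f' t = exp (t\<^sup>2 * s / 2) *\<^sub>R ?D t + (exp (t\<^sup>2 * s / 2) * (t * s)) *\<^sub>R ?\<phi> t" for t :: real
  have der: "(f has_vector_derivative f' t) (at t within {0..T})" for t
  proof -
    have "((\<lambda>t. exp (t\<^sup>2 * s / 2)) has_real_derivative exp (t\<^sup>2 * s / 2) * (t * s)) (at t within {0..T})"
      by (auto intro!: derivative_eq_intros)
    then show ?thesis
      unfolding f_def[abs_def] f'_def
      by (intro has_vector_derivative_scaleR has_vector_derivative_at_within[OF char_fun_derivative] assms)
  qed
  have bd: "cmod (f' t) \<le> exp (T\<^sup>2 * s / 2) * \<epsilon>" if "t \<in> {0..T}" for t
  proof -
    have "f' t = exp (t\<^sup>2 * s / 2) *\<^sub>R (\<i> * (expectation (\<lambda>w. of_real (W w) * iexp (t * W w)) - \<i> * t * s * ?\<phi> t))"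
      unfolding f'_def by (simp add: algebra_simps scaleR_conv_of_real)
    then have "cmod (f' t) = exp (t\<^sup>2 * s / 2) * cmod (expectation (\<lambda>w. of_real (W w) * iexp (t * W w)) - \<i> * t * s * ?\<phi> t)"
      by (simp add: norm_mult)
    also have "\<dots> \<le> exp (T\<^sup>2 * s / 2) * \<epsilon>"
      using that s by (intro mult_mono err) (auto intro!: mult_right_mono power_mono)
    finally show ?thesis .
  qed
  \<comment> \<open>On \<open>{0..T}\<close> the factor is largest at \<open>T\<close>, so dividing
    by it at the end leaves the defect bound without an exponential constant.\<close>
  have "norm (f T - f 0) \<le> exp (T\<^sup>2 * s / 2) * \<epsilon> * norm (T - 0)"
  proof (rule differentiable_bound[where S = "{0..T}" and f' = "\<lambda>t h. h *\<^sub>R f' t"])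
    fix t assume t: "t \<in> {0..T}"
    show "(f has_derivative (\<lambda>h. h *\<^sub>R f' t)) (at t within {0..T})"
      using der unfolding has_vector_derivative_def .
    show "onorm (\<lambda>h. h *\<^sub>R f' t) \<le> exp (T\<^sup>2 * s / 2) * \<epsilon>"
    proof (rule onorm_le)
      fix h :: real
      show "norm (h *\<^sub>R f' t) \<le> exp (T\<^sup>2 * s / 2) * \<epsilon> * norm h"
        using mult_right_mono[OF bd[OF t], of "\<bar>h\<bar>"] by (simp add: mult.commute)
    qed
  qed (use T in auto)
  also have "f 0 = 1" by (simp add: f_def prob_space)
  finally have "cmod (f T - 1) \<le> exp (T\<^sup>2 * s / 2) * (T * \<epsilon>)" using T by (simp add: mult_ac)
  moreover have "f T - 1 = exp (T\<^sup>2 * s / 2) *\<^sub>R (?\<phi> T - of_real (exp (- (T\<^sup>2 * s / 2))))"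
    by (simp add: f_def scaleR_conv_of_real algebra_simps exp_minus flip: of_real_mult)
  ultimately show ?thesis by simp
qed

context network_errors begin

text \<open>Three sources of error in Stein's equation: dependence on far indices, fluctuation and
  truncation bias of the variance, and the Taylor remainder with its third moments.\<close>

definition clt_bound :: "real \<Rightarrow> real \<Rightarrow> real \<Rightarrow> real" where
  "clt_bound r m t = sqrt n * (2 * ch * (1 + t * sqrt n) * \<rho> powr m) +
     t * (vbound m + cb * KR r * (\<rho> / r) powr m) + t\<^sup>2 / 2 * (a^3 * (cc * exp (c1 * m)) / sqrt n)"

text \<open>Assumption 2(c) speaks of real \<open>h\<close>, so the exponential is split into cosine
  and sine, both bounded by 1 together with their derivatives; this gives the factor 2. The scale
  \<open>t / sqrt n\<close> times \<open>card U \<le> n\<close> gives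
  \<open>t * sqrt n\<close>.\<close>

lemma iexp_covariance_far:
  assumes i: "i < n" and U: "U \<subseteq> {j. j < n \<and> m < d i j}" and t: "t \<ge> 0"
  shows "cmod (expectation (\<lambda>w. of_real (e w i) * iexp (t * ((\<Sum>j\<in>U. e w j) / sqrt n))))
    \<le> 2 * ch * (1 + t * sqrt n) * \<rho> powr m"
proof (cases "U = {}")
  \<comment> \<open>The covariance condition concerns nonempty sets; for the empty one the
    exponential is 1 and the mean of \<open>e w i\<close> vanishes.\<close>
  case True
  then show ?thesis using e_mean[OF i] t ch_pos rho by simp
next
  case False
  have Un: "U \<subseteq> {..<n}" "finite U" "card U \<le> n"
    using U finite_subset[of U "{..<n}"] card_mono[of "{..<n}" U] by auto
  define Z where "Z w = t / sqrt n * (\<Sum>j\<in>U. e w j)" for w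
  have [measurable]: "Z \<in> borel_measurable M"
    unfolding Z_def using Un(1) by (intro borel_measurable_times borel_measurable_sum e_meas borel_measurable_const) auto
  have bd: "\<bar>expectation (\<lambda>w. e w i * h (Z w))\<bar> \<le> ch * (1 + t * sqrt n) * \<rho> powr m"
    if h: "\<And>y. \<bar>h y\<bar> \<le> 1" "\<And>y. (h has_real_derivative h' y) (at y)" "\<And>y. \<bar>h' y\<bar> \<le> 1" for h h'
  proof -
    have "\<bar>expectation (\<lambda>w. e w i * h (Z w))\<bar> = \<bar>covar M (\<lambda>w. e w i) (\<lambda>w. h (Z w))\<bar>"
      by (simp add: covar_def e_mean[OF i])
    also have "\<dots> \<le> ch * (1 + \<bar>t / sqrt n\<bar> * real (card U)) * \<rho> powr dset d {i} U"
      unfolding Z_def by (rule cov_fun[OF h i Un(1) False])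
    also have "\<dots> \<le> ch * (1 + t * sqrt n) * \<rho> powr m"
    proof (rule mult_mono, rule mult_left_mono, rule add_left_mono)
      have "\<bar>t / sqrt n\<bar> * real (card U) \<le> \<bar>t / sqrt n\<bar> * real n"
        using Un by (intro mult_left_mono) auto
      also have "\<dots> = t * (real n / sqrt n)" using t by simp
      also have "\<dots> = t * sqrt n" by (simp only: real_div_sqrt[OF of_nat_0_le_iff])
      finally show "\<bar>t / sqrt n\<bar> * real (card U) \<le> t * sqrt n" .
      have "dset d {i} U \<in> (\<lambda>(i,j). d i j) ` ({i} \<times> U)"
        unfolding dset_def using False Un by (intro Min_in) auto
      then have "m \<le> dset d {i} U" using U by auto
      then show "\<rho> powr dset d {i} U \<le> \<rho> powr m" using rho by (intro powr_mono') auto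
    qed (use ch_pos t rho in auto)
    finally show ?thesis .
  qed
  have ib: "integrable M (\<lambda>w. e w i * h (Z w))" if "\<And>y. \<bar>h y\<bar> \<le> 1" "h \<in> borel_measurable borel" for h :: "real \<Rightarrow> real"
    using int1[OF i] that i
    by (intro Bochner_Integration.integrable_bound[OF int1[OF i]])
       (auto simp: abs_mult intro!: AE_I2 mult_left_le)
  have "(\<lambda>w. of_real (e w i) * iexp (t * ((\<Sum>j\<in>U. e w j) / sqrt n))) =
     (\<lambda>w. complex_of_real (e w i * cos (Z w)) + \<i> * complex_of_real (e w i * sin (Z w)))"
  proof
    fix w
    have "t * ((\<Sum>j\<in>U. e w j) / sqrt n) = Z w" by (simp add: Z_def)
    then show "of_real (e w i) * iexp (t * ((\<Sum>j\<in>U. e w j) / sqrt n)) =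
      complex_of_real (e w i * cos (Z w)) + \<i> * complex_of_real (e w i * sin (Z w))"
      by (simp only: cis_conv_exp[symmetric]) (simp add: complex_eq_iff)
  qed
  then have "expectation (\<lambda>w. of_real (e w i) * iexp (t * ((\<Sum>j\<in>U. e w j) / sqrt n)))
    = complex_of_real (expectation (\<lambda>w. e w i * cos (Z w))) + \<i> * complex_of_real (expectation (\<lambda>w. e w i * sin (Z w)))"
    using ib[of cos] ib[of sin] by (simp del: of_real_mult)
  also have "cmod \<dots> \<le> \<bar>expectation (\<lambda>w. e w i * cos (Z w))\<bar> + \<bar>expectation (\<lambda>w. e w i * sin (Z w))\<bar>"
    by (rule order_trans[OF norm_triangle_ineq]) (simp add: norm_mult)
  also have "\<dots> \<le> ch * (1 + t * sqrt n) * \<rho> powr m + ch * (1 + t * sqrt n) * \<rho> powr m"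
    by (intro add_mono bd[of cos "\<lambda>y. - sin y"] bd[of sin cos])
       (auto intro!: derivative_eq_intros)
  also have "\<dots> = 2 * ch * (1 + t * sqrt n) * \<rho> powr m" by simp
  finally show ?thesis .
qed


text \<open>Stein's method with neighbourhoods of radius \<open>m\<close>. For each \<open>i\<close>
  the sum is cut into a near part \<open>L i\<close> and a far part \<open>F i\<close>. Replacing
  \<open>W\<close> by \<open>F i\<close> inside the exponential next to \<open>e w i\<close> leaves
  a small covariance, a linear term that adds up to \<open>V\<close>, close to \<open>s\<close> in
  mean, and a remainder bounded by third moments. The stability of the differential equation
  finishes the argument.\<close>

lemma clt_subset_sum:
  assumes U: "U \<subseteq> {..<n}" and m: "m \<ge> 0" and T: "T \<ge> 0"
    and r: "\<rho> < r" "r < 1" "r * exp (2 * c1) < 1"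
  defines "s \<equiv> (\<Sum>i\<in>U. \<Sum>j\<in>U. S i j) / n"
  shows "cmod (expectation (\<lambda>w. iexp (T * ((\<Sum>j\<in>U. e w j) / sqrt n))) - of_real (exp (- (T\<^sup>2 * s / 2))))
    \<le> T * clt_bound r m T"
proof -
  define u where "u j = (of_bool (j \<in> U) :: real)" for j
  have u01: "0 \<le> u j" "u j \<le> 1" "\<bar>u j\<bar> \<le> 1" for j by (auto simp: u_def)
  have finU: "finite U" using U finite_subset by auto
  have usum: "(\<Sum>j\<in>U. f j) = (\<Sum>j<n. u j * f j)" for f :: "nat \<Rightarrow> real"
  proof -
    have "{..<n} \<inter> {j. j \<in> U} = U" using U by auto
    then show ?thesis unfolding u_def by simp
  qed
  define W where "W w = (\<Sum>j<n. u j * e w j) / sqrt n" for w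
  \<comment> \<open>\<open>L i\<close> holds the selected indices within distance \<open>m\<close>
    of \<open>i\<close> and \<open>F i\<close> those beyond. \<open>V\<close> is the sum of
    \<open>u i * e w i * L i w / sqrt n\<close>, a random version of \<open>s\<close> restricted to
    near pairs.\<close>
  define L where "L i w = (\<Sum>j<n. u j * near m i j * e w j) / sqrt n" for i w
  define F where "F i w = (\<Sum>j\<in>{j\<in>U. m < d i j}. e w j) / sqrt n" for i w
  define V where "V w = (\<Sum>i<n. \<Sum>j<n. u i * u j * near m i j * (e w i * e w j)) / real n" for w
  have WU: "(\<Sum>j\<in>U. e w j) / sqrt n = W w" for w unfolding W_def usum ..
  have s_eq: "s = (\<Sum>i<n. \<Sum>j<n. u i * u j * S i j) / n"
    unfolding s_def usum by (simp add: sum_distrib_left mult.assoc)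
  have mW[measurable]: "W \<in> borel_measurable M" unfolding W_def by simp
  have mL[measurable]: "L i \<in> borel_measurable M" for i unfolding L_def by simp
  have mF[measurable]: "F i \<in> borel_measurable M" for i
    unfolding F_def using U by (intro borel_measurable_divide borel_measurable_sum e_meas borel_measurable_const) auto
  have mV[measurable]: "V \<in> borel_measurable M" unfolding V_def by simp
  have WLF: "W w = L i w + F i w" if "i < n" for i w
  proof -
    have "(\<Sum>j\<in>{j\<in>U. m < d i j}. e w j) = (\<Sum>j\<in>U. (1 - near m i j) * e w j)"
      using finU by (intro sum.mono_neutral_cong_left) (auto simp: not_le)
    also have "\<dots> = (\<Sum>j<n. u j * e w j) - (\<Sum>j<n. u j * near m i j * e w j)"
      unfolding usum sum_subtractf[symmetric] by (intro sum.cong refl) (simp add: algebra_simps)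
    finally show ?thesis unfolding W_def L_def F_def by (simp add: diff_divide_distrib)
  qed
  have W2e: "W w ^ 2 = (\<Sum>i<n. \<Sum>j<n. u i * u j * (e w i * e w j)) / n" for w
    unfolding W_def power_divide by (simp add: power2_eq_square sum_product mult_ac)
  have W2: "integrable M (\<lambda>w. W w ^ 2)" unfolding W2e by (intro Bochner_Integration.integrable_divide Bochner_Integration.integrable_sum integrable_mult_right integrable_abs int2 int3) auto
  have s0: "s \<ge> 0"
  proof -
    have "expectation (\<lambda>w. W w ^ 2) = s" 
      unfolding W2e s_eq integral_divide_zero Defs.Sigma_def
      by (subst integral_double_sum(2)) (auto intro: int2)
    moreover have "expectation (\<lambda>w. W w ^ 2) \<ge> 0" by (rule Bochner_Integration.integral_nonneg) simp
    ultimately show ?thesis by simp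
  qed
  have iV: "integrable M V" unfolding V_def by (intro Bochner_Integration.integrable_divide Bochner_Integration.integrable_sum integrable_mult_right integrable_abs int2 int3) auto
  \<comment> \<open>Fluctuation of the near pairs about their mean, plus the bias from dropping the
    far pairs.\<close>
  have Vs: "expectation (\<lambda>w. \<bar>V w - s\<bar>) \<le> vbound m + cb * KR r * (\<rho> / r) powr m"
  proof -
    let ?mu = "(\<Sum>i<n. \<Sum>j<n. u i * u j * near m i j * S i j) / n"
    have b: "\<bar>u i * u j * near m i j\<bar> \<le> 1 * near m i j" for i j
      using mult_le_one[OF u01(2)[of i] u01(1)[of j] u01(2)[of j]] u01 by (auto simp: abs_mult)
    have b': "\<bar>u i * u j\<bar> \<le> 1" for i j by (auto simp: u_def)
    note dev = near_pairs_deviation[where \<alpha> = "\<lambda>i j. u i * u j * near m i j", OF m zero_le_one b]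
    have "?mu - s = - ((\<Sum>i<n. \<Sum>j<n. (u i * u j * (1 - near m i j)) * S i j) / n)"
      unfolding s_eq diff_divide_distrib[symmetric] minus_divide_left sum_subtractf[symmetric] sum_negf[symmetric]
      by (intro arg_cong2[where f = "(/)"] refl sum.cong) (simp add: algebra_simps)
    then have mus: "\<bar>?mu - s\<bar> \<le> cb * KR r * (\<rho> / r) powr m"
      using far_pairs_bound[OF m zero_le_one r, where \<alpha> = "\<lambda>i j. u i * u j"] b' by simp
    have "expectation (\<lambda>w. \<bar>V w - s\<bar>) \<le> expectation (\<lambda>w. \<bar>V w - ?mu\<bar> + \<bar>?mu - s\<bar>)"
      using iV by (intro integral_mono) auto
    also have "\<dots> = expectation (\<lambda>w. \<bar>V w - ?mu\<bar>) + \<bar>?mu - s\<bar>"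
      using iV by (simp add: prob_space)
    also have "\<dots> \<le> vbound m + cb * KR r * (\<rho> / r) powr m"
      using dev(2) mus unfolding V_def by simp
    finally show ?thesis .
  qed
  have bias: "cmod (expectation (\<lambda>w. of_real (V w) * iexp (t * W w)) - s * expectation (\<lambda>w. iexp (t * W w)))
     \<le> vbound m + cb * KR r * (\<rho> / r) powr m" for t
  proof -
    have iVe: "integrable M (\<lambda>w. of_real (V w) * iexp (t * W w))" by (intro integrable_mult_iexp iV) simp
    have ie: "integrable M (\<lambda>w. iexp (t * W w))" by (rule integrable_iexp_rv) simp
    have "expectation (\<lambda>w. of_real (V w) * iexp (t * W w)) - s * expectation (\<lambda>w. iexp (t * W w))
      = expectation (\<lambda>w. of_real (V w - s) * iexp (t * W w))"
      using iVe ie by (simp add: left_diff_distrib)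
    also have "cmod \<dots> \<le> expectation (\<lambda>w. \<bar>V w - s\<bar>)"
      using iV by (intro cmod_integral_le integrable_mult_iexp) (auto simp: norm_mult simp flip: of_real_diff)
    finally show ?thesis using Vs by linarith
  qed
  \<comment> \<open>The Taylor remainder involves triples inside one ball; there are
    \<open>N m i ^ 2\<close> of them, each of mean at most \<open>a ^ 3\<close>, and
    \<open>growth2\<close> bounds the total.\<close>
  have L2e: "\<bar>e w i\<bar> * L i w ^ 2 \<le> (\<Sum>j<n. \<Sum>k<n. near m i j * near m i k * \<bar>e w i * e w j * e w k\<bar>) / n" for i w
  proof -
    have "\<bar>e w i\<bar> * L i w ^ 2 = (\<Sum>j<n. \<Sum>k<n. \<bar>e w i\<bar> * (u j * near m i j * e w j * (u k * near m i k * e w k))) / n"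
    proof -
      have "(\<Sum>j<n. u j * near m i j * e w j)\<^sup>2 = (\<Sum>j<n. \<Sum>k<n. u j * near m i j * e w j * (u k * near m i k * e w k))"
        by (simp only: power2_eq_square sum_product)
      then show ?thesis unfolding L_def power_divide by (simp only: times_divide_eq_right sum_distrib_left) simp
    qed
    also have "\<dots> \<le> (\<Sum>j<n. \<Sum>k<n. near m i j * near m i k * \<bar>e w i * e w j * e w k\<bar>) / n"
    proof (intro divide_right_mono sum_mono)
      fix j k
      have "\<bar>e w i\<bar> * (u j * near m i j * e w j * (u k * near m i k * e w k))
        = (u j * u k) * (near m i j * near m i k * (\<bar>e w i\<bar> * (e w j * e w k)))" by (simp add: mult_ac)
      also have "\<dots> \<le> near m i j * near m i k * \<bar>e w i * e w j * e w k\<bar>"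
        by (auto simp: u_def abs_mult mult.assoc intro!: mult_left_mono) (metis abs_ge_self abs_mult)
      finally show "\<bar>e w i\<bar> * (u j * near m i j * e w j * (u k * near m i k * e w k)) \<le> \<dots>" .
    qed simp
    finally show ?thesis .
  qed
  have iL2b: "integrable M (\<lambda>w. (\<Sum>j<n. \<Sum>k<n. near m i j * near m i k * \<bar>e w i * e w j * e w k\<bar>) / n)"
    if "i < n" for i using that by (intro Bochner_Integration.integrable_divide Bochner_Integration.integrable_sum integrable_mult_right integrable_abs int2 int3) auto
  have iL2: "integrable M (\<lambda>w. \<bar>e w i\<bar> * L i w ^ 2)" if "i < n" for i
  proof (rule Bochner_Integration.integrable_bound[OF iL2b[OF that]])
    show "AE w in M. norm (\<bar>e w i\<bar> * L i w ^ 2) \<le>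
      norm ((\<Sum>j<n. \<Sum>k<n. near m i j * near m i k * \<bar>e w i * e w j * e w k\<bar>) / n)"
      unfolding real_norm_def
      by (intro AE_I2 order_trans[OF eq_refl[OF abs_of_nonneg] order_trans[OF L2e abs_ge_self]]) simp
  qed (use that in simp)
  have EL2: "expectation (\<lambda>w. \<bar>e w i\<bar> * L i w ^ 2) \<le> N m i ^ 2 * a^3 / n" if i: "i < n" for i
  proof -
    have "expectation (\<lambda>w. \<bar>e w i\<bar> * L i w ^ 2)
      \<le> expectation (\<lambda>w. (\<Sum>j<n. \<Sum>k<n. near m i j * near m i k * \<bar>e w i * e w j * e w k\<bar>) / n)"
      by (intro integral_mono iL2[OF i] iL2b[OF i] L2e)
    also have "\<dots> = (\<Sum>j<n. \<Sum>k<n. near m i j * near m i k * expectation (\<lambda>w. \<bar>e w i * e w j * e w k\<bar>)) / n"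
      unfolding integral_divide_zero
      by (subst integral_double_sum(2)) (use i in \<open>auto intro: int3\<close>)
    also have "\<dots> \<le> (\<Sum>j<n. \<Sum>k<n. near m i j * near m i k * a^3) / n"
      using i by (intro divide_right_mono sum_mono mult_left_mono mom3) auto
    also have "\<dots> = N m i ^ 2 * a^3 / n"
      unfolding N_card power2_eq_square sum_product unfolding sum_distrib_right ..
    finally show ?thesis .
  qed
  have main: "cmod (expectation (\<lambda>w. of_real (W w) * iexp (t * W w)) - \<i> * t * s * expectation (\<lambda>w. iexp (t * W w)))
    \<le> clt_bound r m T" if t: "0 \<le> t" "t \<le> T" for t
  proof -
    have iW: "integrable M W" using integral_abs_le_sqrt(1)[OF mW W2] .
    let ?c = "\<lambda>i. u i / sqrt n"
    have i1: "integrable M (\<lambda>w. of_real (e w i) * iexp (t * W w))" if "i < n" for i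
      using that by (intro integrable_mult_iexp int1) auto
    have i2: "integrable M (\<lambda>w. of_real (e w i) * iexp (t * F i w))" if "i < n" for i
      using that by (intro integrable_mult_iexp int1) auto
    have ieL: "integrable M (\<lambda>w. e w i * L i w)" if "i < n" for i
    proof -
      have eq: "e w i * L i w = (\<Sum>j<n. u j * near m i j * (e w i * e w j)) / sqrt n" for w
        unfolding L_def by (simp add: sum_distrib_left mult_ac del: sum_mult_of_bool_eq sum_of_bool_mult_eq)
      show ?thesis unfolding eq using that by (intro Bochner_Integration.integrable_divide Bochner_Integration.integrable_sum integrable_mult_right integrable_abs int2 int3) auto
    qed
    have i3: "integrable M (\<lambda>w. of_real (e w i * L i w) * iexp (t * W w))" if "i < n" for i
      using that by (intro integrable_mult_iexp ieL) auto
    have EW: "expectation (\<lambda>w. of_real (W w) * iexp (t * W w)) = (\<Sum>i<n. ?c i * expectation (\<lambda>w. of_real (e w i) * iexp (t * W w)))"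
    proof -
      have "of_real (W w) * z = (\<Sum>i<n. ?c i * (of_real (e w i) * z))" for w and z :: complex
        unfolding W_def by (simp add: sum_distrib_right sum_divide_distrib mult.assoc)
      then show ?thesis using i1 by simp
    qed
    have EV: "expectation (\<lambda>w. of_real (V w) * iexp (t * W w)) = (\<Sum>i<n. ?c i * expectation (\<lambda>w. of_real (e w i * L i w) * iexp (t * W w)))"
    proof -
      have "V w = (\<Sum>i<n. ?c i * (e w i * L i w))" for w
        unfolding V_def L_def by (simp add: sum_distrib_left sum_divide_distrib mult_ac)
      then have "of_real (V w) * z = (\<Sum>i<n. ?c i * (of_real (e w i * L i w) * z))" for w and z :: complex
        by (simp add: sum_distrib_right mult.assoc)
      then show ?thesis using i3 by simp
    qed
    \<comment> \<open>The expansion is made around \<open>W\<close>, not around \<open>F i\<close>,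
      so that the linear term carries the same exponential as the differential equation.\<close>
    have taylor: "cmod (expectation (\<lambda>w. of_real (e w i) * iexp (t * W w)) - expectation (\<lambda>w. of_real (e w i) * iexp (t * F i w))
       - \<i> * t * expectation (\<lambda>w. of_real (e w i * L i w) * iexp (t * W w))) \<le> t\<^sup>2 / 2 * (N m i ^ 2 * a^3 / n)"
      (is "cmod ?l \<le> _") if i: "i < n" for i
    proof -
      have "?l = expectation (\<lambda>w. of_real (e w i) * iexp (t * W w) - of_real (e w i) * iexp (t * F i w)
         - \<i> * t * (of_real (e w i * L i w) * iexp (t * W w)))"
        using i1[OF i] i2[OF i] i3[OF i] by simp
      also have "cmod \<dots> \<le> expectation (\<lambda>w. t\<^sup>2 / 2 * (\<bar>e w i\<bar> * L i w ^ 2))"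
      proof (rule cmod_integral_le)
        fix w
        have "iexp (t * F i w) = iexp (t * W w) * iexp (- (t * L i w))"
          unfolding WLF[OF i, of w] by (simp add: exp_add[symmetric] algebra_simps)
        then have "of_real (e w i) * iexp (t * W w) - of_real (e w i) * iexp (t * F i w)
         - \<i> * t * (of_real (e w i * L i w) * iexp (t * W w))
          = - (of_real (e w i) * iexp (t * W w) * (iexp (- (t * L i w)) - 1 - \<i> * of_real (- (t * L i w))))"
          by (simp add: algebra_simps)
        also have "cmod \<dots> \<le> \<bar>e w i\<bar> * ((t * L i w)\<^sup>2 / 2)"
        proof -
          have "cmod (of_real (e w i) * iexp (t * W w)) = \<bar>e w i\<bar>" by (simp add: norm_mult)
          then show ?thesis
            unfolding norm_minus_cancel norm_mult[of "of_real (e w i) * iexp (t * W w)"]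
            using mult_left_mono[OF cmod_iexp_1[of "- (t * L i w)"], of "\<bar>e w i\<bar>"] by (simp only: power2_minus)
        qed
        also have "\<bar>e w i\<bar> * ((t * L i w)\<^sup>2 / 2) = t\<^sup>2 / 2 * (\<bar>e w i\<bar> * L i w ^ 2)"
          by (simp add: power_mult_distrib)
        finally show "cmod (of_real (e w i) * iexp (t * W w) - of_real (e w i) * iexp (t * F i w)
         - \<i> * t * (of_real (e w i * L i w) * iexp (t * W w))) \<le> t\<^sup>2 / 2 * (\<bar>e w i\<bar> * L i w ^ 2)" .
      next
        show "integrable M (\<lambda>w. of_real (e w i) * iexp (t * W w) - of_real (e w i) * iexp (t * F i w)
         - \<i> * t * (of_real (e w i * L i w) * iexp (t * W w)))"
          by (intro Bochner_Integration.integrable_diff integrable_mult_right i1 i2 i3 i)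
        show "integrable M (\<lambda>w. t\<^sup>2 / 2 * (\<bar>e w i\<bar> * L i w ^ 2))"
          by (intro integrable_mult_right iL2 i)
      qed
      also have "\<dots> \<le> t\<^sup>2 / 2 * (N m i ^ 2 * a^3 / n)"
        unfolding integral_mult_right_zero by (intro mult_left_mono EL2 i) simp
      finally show ?thesis .
    qed
    have far: "cmod (expectation (\<lambda>w. of_real (e w i) * iexp (t * F i w))) \<le> 2 * ch * (1 + t * sqrt n) * \<rho> powr m" if i: "i < n" for i
      unfolding F_def using U by (intro iexp_covariance_far i t) auto
    have cu: "cmod (of_real (?c i)) \<le> 1 / sqrt n" for i
      unfolding norm_of_real using u01[of i] by (simp add: divide_right_mono)
    have b1: "cmod (\<Sum>i<n. ?c i * expectation (\<lambda>w. of_real (e w i) * iexp (t * F i w)))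
        \<le> sqrt n * (2 * ch * (1 + t * sqrt n) * \<rho> powr m)"
    proof -
      have "cmod (\<Sum>i<n. ?c i * expectation (\<lambda>w. of_real (e w i) * iexp (t * F i w)))
        \<le> (\<Sum>i<n. 1 / sqrt n * (2 * ch * (1 + t * sqrt n) * \<rho> powr m))"
        using u01 by (intro order_trans[OF norm_sum] sum_mono)
          (unfold norm_mult lessThan_iff, intro mult_mono far cu, auto)
      also have "\<dots> = (real n / sqrt n) * (2 * ch * (1 + t * sqrt n) * \<rho> powr m)" by simp
      finally show ?thesis by (simp only: real_div_sqrt[OF of_nat_0_le_iff])
    qed
    have b2: "cmod (\<Sum>i<n. ?c i * (expectation (\<lambda>w. of_real (e w i) * iexp (t * W w)) - expectation (\<lambda>w. of_real (e w i) * iexp (t * F i w))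
       - \<i> * t * expectation (\<lambda>w. of_real (e w i * L i w) * iexp (t * W w)))) \<le> t\<^sup>2 / 2 * (a^3 * (cc * exp (c1 * m)) / sqrt n)"
      (is "cmod (\<Sum>i<n. ?c i * ?l i) \<le> _")
    proof -
      have "cmod (\<Sum>i<n. ?c i * ?l i) \<le> (\<Sum>i<n. 1 / sqrt n * (t\<^sup>2 / 2 * (N m i ^ 2 * a^3 / n)))"
        using u01 by (intro order_trans[OF norm_sum] sum_mono)
          (unfold norm_mult[of "of_real _"] lessThan_iff, intro mult_mono taylor cu, auto)
      also have "\<dots> = 1 / sqrt n * (t\<^sup>2 / 2 * (a^3 / n)) * (\<Sum>i<n. N m i ^ 2)"
        unfolding sum_distrib_left by (intro sum.cong refl) simp
      also have "\<dots> \<le> 1 / sqrt n * (t\<^sup>2 / 2 * (a^3 / n)) * (real n * (cc * exp (c1 * m)))"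
        using a_pos by (intro mult_left_mono growth2 m) auto
      also have "\<dots> = t\<^sup>2 / 2 * (a^3 * (cc * exp (c1 * m)) / sqrt n)" using n_pos by simp
      finally show ?thesis .
    qed
    have b3: "cmod (\<i> * t * (expectation (\<lambda>w. of_real (V w) * iexp (t * W w)) - s * expectation (\<lambda>w. iexp (t * W w))))
      \<le> t * (vbound m + cb * KR r * (\<rho> / r) powr m)"
      using mult_left_mono[OF bias[of t] t(1)] t by (simp only: norm_mult norm_ii norm_of_real abs_of_nonneg mult_1_left)
    have "expectation (\<lambda>w. of_real (W w) * iexp (t * W w)) - \<i> * t * s * expectation (\<lambda>w. iexp (t * W w))
      = (\<Sum>i<n. ?c i * expectation (\<lambda>w. of_real (e w i) * iexp (t * F i w)))
      + \<i> * t * (expectation (\<lambda>w. of_real (V w) * iexp (t * W w)) - s * expectation (\<lambda>w. iexp (t * W w)))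
      + (\<Sum>i<n. ?c i * ?l i)"
      unfolding EW EV by (simp add: algebra_simps sum.distrib sum_subtractf sum_distrib_left)
    also have "cmod \<dots> \<le> sqrt n * (2 * ch * (1 + t * sqrt n) * \<rho> powr m)
      + t * (vbound m + cb * KR r * (\<rho> / r) powr m) + t\<^sup>2 / 2 * (a^3 * (cc * exp (c1 * m)) / sqrt n)"
      by (intro order_trans[OF norm_triangle_ineq] add_mono b1 b2 b3)
    also have "\<dots> \<le> clt_bound r m T"
      unfolding clt_bound_def using t a_pos ch_pos cc_pos cb_pos KR_nonneg[OF r(3)] vbound_nonneg rho
      by (intro add_mono mult_left_mono mult_right_mono divide_right_mono power_mono) auto
    finally show ?thesis .
  qed
  show ?thesis
    unfolding WU by (rule char_fun_gaussian_ode[OF mW W2 s0 T main])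
qed

end

section \<open>Weights in the unit interval\<close>

text \<open>Probability that independent coin flips with success probabilities \<open>p j\<close>
  select exactly \<open>U\<close>. Finite sums over the power set stand for the expectation over
  random sets.\<close>

definition thin :: "nat \<Rightarrow> (nat \<Rightarrow> real) \<Rightarrow> nat set \<Rightarrow> real" where
  "thin n p U = (\<Prod>j\<in>U. p j) * (\<Prod>j\<in>{..<n} - U. 1 - p j)"

lemma thin_prod:
  fixes z :: "nat \<Rightarrow> 'b::{comm_ring_1,real_algebra_1}"
  shows "(\<Sum>U\<in>Pow {..<n}. of_real (thin n p U) * (\<Prod>j\<in>U. z j)) = (\<Prod>j<n. of_real (p j) * z j + of_real (1 - p j))"
  by (simp add: prod_add thin_def prod.distrib mult_ac)

text \<open>Inclusion probability of \<open>J\<close>. Multiplying the exclusion factor of each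
  \<open>j\<close> in \<open>J\<close> by zero before expanding the product removes exactly the sets
  that miss an element of \<open>J\<close>.\<close>

lemma thin_subset:
  assumes "J \<subseteq> {..<n}"
  shows "(\<Sum>U\<in>Pow {..<n}. thin n p U * of_bool (J \<subseteq> U)) = (\<Prod>j\<in>J. p j)"
proof -
  have "(\<Prod>j\<in>J. p j) = (\<Prod>j<n. if j \<in> J then p j else 1)"
    using assms by (simp add: prod.If_cases Int_absorb1 flip: prod.inter_restrict)
  also have "\<dots> = (\<Prod>j<n. p j + (1 - p j) * of_bool (j \<notin> J))"
    by (intro prod.cong) auto
  also have "\<dots> = (\<Sum>U\<in>Pow {..<n}. (\<Prod>j\<in>U. p j) * (\<Prod>j\<in>{..<n} - U. (1 - p j) * of_bool (j \<notin> J)))"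
    by (simp add: prod_add)
  also have "\<dots> = (\<Sum>U\<in>Pow {..<n}. thin n p U * of_bool (J \<subseteq> U))"
  proof (intro sum.cong refl)
    fix U assume "U \<in> Pow {..<n}"
    have "(\<Prod>j\<in>{..<n} - U. of_bool (j \<notin> J)) = (of_bool (J \<subseteq> U) :: real)"
    proof (cases "J \<subseteq> U")
      case False
      then obtain j where "j \<in> J" "j \<notin> U" by auto
      then show ?thesis using False assms by (auto intro!: prod_zero)
    qed (auto intro!: prod.neutral)
    then show "(\<Prod>j\<in>U. p j) * (\<Prod>j\<in>{..<n} - U. (1 - p j) * of_bool (j \<notin> J)) = thin n p U * of_bool (J \<subseteq> U)"
      by (simp add: thin_def prod.distrib)
  qed
  finally show ?thesis ..
qed

lemma thin_sum_1: "(\<Sum>U\<in>Pow {..<n}. thin n p U) = 1"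
  using thin_subset[of "{}" n p] by simp

lemma thin_nonneg: "(\<And>j. j < n \<Longrightarrow> 0 \<le> p j \<and> p j \<le> 1) \<Longrightarrow> U \<in> Pow {..<n} \<Longrightarrow> thin n p U \<ge> 0"
  unfolding thin_def by (intro mult_nonneg_nonneg prod_nonneg) auto

lemma weighted_abs_le_sqrt:
  fixes \<pi> f :: "'i \<Rightarrow> real"
  assumes "finite A" "\<And>i. i \<in> A \<Longrightarrow> \<pi> i \<ge> 0" "sum \<pi> A = 1"
  shows "(\<Sum>i\<in>A. \<pi> i * \<bar>f i\<bar>) \<le> sqrt (\<Sum>i\<in>A. \<pi> i * (f i)\<^sup>2)"
proof (rule real_le_rsqrt)
  let ?m = "\<Sum>i\<in>A. \<pi> i * \<bar>f i\<bar>"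
  have "0 \<le> (\<Sum>i\<in>A. \<pi> i * (\<bar>f i\<bar> - ?m)\<^sup>2)" using assms by (intro sum_nonneg) auto
  also have "\<dots> = (\<Sum>i\<in>A. \<pi> i * (f i)\<^sup>2 - 2 * ?m * (\<pi> i * \<bar>f i\<bar>) + ?m\<^sup>2 * \<pi> i)"
    by (intro sum.cong refl) (simp add: power2_diff algebra_simps)
  also have "\<dots> = (\<Sum>i\<in>A. \<pi> i * (f i)\<^sup>2) - 2 * ?m * ?m + ?m\<^sup>2 * sum \<pi> A"
    by (simp only: sum.distrib sum_subtractf sum_distrib_left)
  finally show "?m\<^sup>2 \<le> (\<Sum>i\<in>A. \<pi> i * (f i)\<^sup>2)" using assms by (simp add: power2_eq_square)
qed

lemma exp_minus_diff_le:
  fixes x y :: real assumes "x \<ge> 0" "y \<ge> 0"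
  shows "\<bar>exp (- x) - exp (- y)\<bar> \<le> \<bar>x - y\<bar>"
proof -
  have *: "exp (- x) - exp (- y) \<le> y - x" if "0 \<le> x" "x \<le> y" for x y :: real
  proof -
    have le: "1 - exp (x - y) \<le> y - x" using exp_ge_add_one_self[of "x - y"] by linarith
    have "exp (- x) - exp (- y) = exp (- x) * (1 - exp (x - y))" by (simp add: algebra_simps flip: exp_add)
    also have "\<dots> \<le> 1 * (y - x)"
      using that by (intro mult_mono le) auto
    finally show ?thesis by simp
  qed
  show ?thesis using *[of x y] *[of y x] assms by (cases "x \<le> y") (auto simp: abs_if)
qed

text \<open>Gaussian approximation of a Bernoulli variable with mean \<open>p\<close> and variance
  \<open>p * (1 - p)\<close>; matching two moments leaves a cubic error, uniform in
  \<open>p\<close>.\<close>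

lemma bernoulli_char_approx:
  fixes p y :: real assumes p: "0 \<le> p" "p \<le> 1"
  shows "cmod (p * iexp y + of_real (1 - p) - iexp (p * y) * of_real (exp (- (p * (1 - p) * y\<^sup>2 / 2)))) \<le> 2 * \<bar>y\<bar>^3"
proof -
  define b where "b = p * (1 - p) * y\<^sup>2 / 2"
  have pp: "0 \<le> p * (1 - p)" "p * (1 - p) \<le> 1" using p by (auto intro!: mult_le_one)
  have b: "0 \<le> b" "b \<le> y\<^sup>2 / 2" unfolding b_def using pp mult_right_mono[OF pp(2), of "y\<^sup>2"] by auto
  have ap: "cmod (iexp x - 1 - \<i> * of_real x + (of_real x)\<^sup>2 / 2) \<le> \<bar>x\<bar>^3 / 6" for x
    using iexp_approx1[of x 2] by (simp add: numeral_2_eq_2 fact_numeral algebra_simps power2_eq_square power3_eq_cube)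
  have py: "\<bar>p * y\<bar> \<le> \<bar>y\<bar>" using p by (simp add: abs_mult mult_left_le_one_le)
  have t1: "cmod (p * (iexp y - 1 - \<i> * of_real y + (of_real y)\<^sup>2 / 2)) \<le> \<bar>y\<bar>^3 / 6"
    unfolding norm_mult using ap[of y] p by (intro order_trans[OF mult_left_le_one_le]) auto
  have t2: "cmod (iexp (p * y) - 1 - \<i> * of_real (p * y) + (of_real (p * y))\<^sup>2 / 2) \<le> \<bar>y\<bar>^3 / 6"
    by (rule order_trans[OF ap]) (intro divide_right_mono power_mono py; simp)
  have t3: "cmod (of_real b * (iexp (p * y) - 1)) \<le> \<bar>y\<bar>^3 / 2"
  proof -
    have "cmod (iexp (p * y) - 1) \<le> \<bar>p * y\<bar>" using iexp_approx1[of "p * y" 0] by simp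
    then have "cmod (of_real b * (iexp (p * y) - 1)) \<le> (y\<^sup>2 / 2) * \<bar>y\<bar>"
      unfolding norm_mult using b py by (intro mult_mono) auto
    also have "\<dots> = \<bar>y\<bar>^3 / 2" by (simp add: power_numeral_reduce abs_if)
    finally show ?thesis .
  qed
  have t4: "cmod (iexp (p * y) * of_real (exp (- b) - 1 + b)) \<le> \<bar>y\<bar>^3"
  proof -
    have e0: "exp (- b) - 1 + b \<ge> 0" using exp_ge_add_one_self[of "- b"] by simp
    have e1: "exp (- b) - 1 + b \<le> b" using b by simp
    have e2: "exp (- b) - 1 + b \<le> b\<^sup>2"
    proof -
      have "exp (- b) \<le> 1 / (1 + b)"
        using exp_ge_add_one_self[of b] b unfolding exp_minus by (simp add: field_simps)
      also have "\<dots> \<le> 1 - b + b\<^sup>2"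
        using b by (simp add: field_simps power2_eq_square)
      finally show ?thesis by simp
    qed
    have "exp (- b) - 1 + b \<le> \<bar>y\<bar>^3"
    \<comment> \<open>For small \<open>y\<close> the quadratic error in \<open>b\<close> is of
      fourth order; for large \<open>y\<close> the bound by \<open>b\<close> itself is already below
      the cube.\<close>
    proof (cases "\<bar>y\<bar> \<le> 1")
      case True
      have "b\<^sup>2 \<le> (y\<^sup>2 / 2)\<^sup>2" using b by (intro power_mono) auto
      also have "\<dots> = \<bar>y\<bar>^4 / 4" by (simp add: power_divide flip: power_mult)
      also have "\<dots> \<le> \<bar>y\<bar>^3" using power_decreasing[of 3 4 "\<bar>y\<bar>"] True zero_le_power[of "\<bar>y\<bar>" 3] by linarith
      finally show ?thesis using e2 by linarith
    next
      case False
      have "b \<le> \<bar>y\<bar>^2" using b by simp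
      also have "\<dots> \<le> \<bar>y\<bar>^3" using False by (intro power_increasing) auto
      finally show ?thesis using e1 by linarith
    qed
    then show ?thesis using e0 by (simp only: norm_mult norm_of_real norm_exp_i_times) simp
  qed
  \<comment> \<open>The quadratic terms cancel because \<open>p = p\<^sup>2 + p * (1 - p)\<close>;
    the four errors have coefficients 1/6, 1/6, 1/2 and 1, at most 2 in total.\<close>
  have "p * iexp y + of_real (1 - p) - iexp (p * y) * of_real (exp (- b)) =
      p * (iexp y - 1 - \<i> * of_real y + (of_real y)\<^sup>2 / 2)
      - (iexp (p * y) - 1 - \<i> * of_real (p * y) + (of_real (p * y))\<^sup>2 / 2)
      + of_real b * (iexp (p * y) - 1) - iexp (p * y) * of_real (exp (- b) - 1 + b)"
    by (simp add: b_def algebra_simps power2_eq_square) (simp add: field_simps)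
  also have "cmod \<dots> \<le> \<bar>y\<bar>^3 / 6 + \<bar>y\<bar>^3 / 6 + \<bar>y\<bar>^3 / 2 + \<bar>y\<bar>^3"
    by (intro order_trans[OF norm_triangle_ineq4] order_trans[OF norm_triangle_ineq] add_mono t1 t2 t3 t4)
  also have "\<dots> \<le> 2 * \<bar>y\<bar>^3" using zero_le_power[of "\<bar>y\<bar>" 3] by linarith
  finally show ?thesis unfolding b_def .
qed

context network_errors begin

lemma S_sym: "S i j = S j i" by (simp add: Defs.Sigma_def mult.commute)

lemma quadratic_form_expectation:
  "(\<Sum>i<n. \<Sum>j<n. u i * u j * S i j) / n = expectation (\<lambda>w. ((\<Sum>j<n. u j * e w j) / sqrt n)\<^sup>2)"
proof -
  have "((\<Sum>j<n. u j * e w j) / sqrt n)\<^sup>2 = (\<Sum>i<n. \<Sum>j<n. u i * u j * (e w i * e w j)) / n" for w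
    unfolding power_divide by (simp add: power2_eq_square sum_product mult_ac)
  then show ?thesis
    by (simp only: integral_divide_zero Defs.Sigma_def) (subst integral_double_sum(2), auto intro: int2)
qed

lemma quadratic_form_nonneg: "(\<Sum>i<n. \<Sum>j<n. u i * u j * S i j) / n \<ge> 0"
  unfolding quadratic_form_expectation by (rule Bochner_Integration.integral_nonneg) simp

text \<open>Variance over the random set: membership of two disjoint index pairs is independent, so
  only overlapping pairs contribute. Fixing the shared index leaves squares of row sums of
  \<open>\<bar>S i j\<bar>\<close>, which \<open>S_bound\<close> and the mean of
  \<open>R \<rho> i ^ 2\<close> control, and the factor \<open>1 / n\<close> remains.\<close>

lemma thinned_variance_concentration:
  assumes p: "\<And>j. j < n \<Longrightarrow> 0 \<le> p j \<and> p j \<le> 1"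
  defines "q \<equiv> \<lambda>U. (\<Sum>i\<in>U. \<Sum>j\<in>U. S i j) / n"
    and "qm \<equiv> (\<Sum>i<n. \<Sum>j<n. (\<Prod>k\<in>{i, j}. p k) * S i j) / n"
  shows "(\<Sum>U\<in>Pow {..<n}. thin n p U * \<bar>q U - qm\<bar>) \<le> sqrt (4 * cb\<^sup>2 * KR \<rho> / n)"
proof -
  define P where "P = {..<n} \<times> {..<n}"
  \<comment> \<open>A set, so that a diagonal pair is a singleton and has inclusion probability
    \<open>p i\<close> instead of its square.\<close>
  define J where "J x = {fst x, snd x}" for x :: "nat \<times> nat"
  define c where "c x = S (fst x) (snd x) / n" for x
  define f where "f x U = (of_bool (J x \<subseteq> U) - (\<Prod>k\<in>J x. p k))" for x U
  have qf: "q U - qm = (\<Sum>x\<in>P. c x * f x U)" if "U \<in> Pow {..<n}" for U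
  proof -
    have "(\<Sum>i\<in>U. \<Sum>j\<in>U. S i j) = (\<Sum>i<n. \<Sum>j<n. S i j * of_bool ({i, j} \<subseteq> U))"
    proof -
      have U: "{..<n} \<inter> {j. j \<in> U} = U" "{..<n} \<inter> U = U" using that by auto
      have "(\<Sum>i<n. \<Sum>j<n. S i j * of_bool ({i, j} \<subseteq> U)) = (\<Sum>i<n. (\<Sum>j<n. S i j * of_bool (j \<in> U)) * of_bool (i \<in> U))"
        unfolding sum_distrib_right by (intro sum.cong refl) auto
      also have "\<dots> = (\<Sum>i\<in>U. \<Sum>j\<in>U. S i j)" using U by simp
      finally show ?thesis ..
    qed
    then have "q U - qm = (\<Sum>i<n. \<Sum>j<n. S i j * of_bool ({i, j} \<subseteq> U) - (\<Prod>k\<in>{i, j}. p k) * S i j) / n"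
      unfolding q_def qm_def by (simp only: sum_subtractf diff_divide_distrib)
    also have "\<dots> = (\<Sum>x\<in>P. c x * f x U)"
      unfolding P_def sum.cartesian_product' sum_divide_distrib c_def f_def J_def
      by (intro sum.cong refl) (simp add: algebra_simps diff_divide_distrib)
    finally show ?thesis .
  qed
  have finP: "finite P" by (simp add: P_def)
  have JP: "J x \<subseteq> {..<n}" "finite (J x)" if "x \<in> P" for x using that by (auto simp: P_def J_def)
  \<comment> \<open>Covariance of the two inclusion indicators: zero for disjoint pairs by the
    product formula, and at most 1 otherwise.\<close>
  have cov: "\<bar>\<Sum>U\<in>Pow {..<n}. thin n p U * (f x U * f y U)\<bar> \<le> of_bool (J x \<inter> J y \<noteq> {})" if xy: "x \<in> P" "y \<in> P" for x y
  proof -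
    have pr: "0 \<le> (\<Prod>k\<in>K. p k) \<and> (\<Prod>k\<in>K. p k) \<le> 1" if "K \<subseteq> {..<n}" for K
      using that p by (auto intro!: prod_nonneg prod_le_1 simp: subset_eq)
    have "(\<Sum>U\<in>Pow {..<n}. thin n p U * (f x U * f y U)) =
       (\<Sum>U\<in>Pow {..<n}. thin n p U * of_bool (J x \<union> J y \<subseteq> U)
         - (\<Prod>k\<in>J x. p k) * (thin n p U * of_bool (J y \<subseteq> U)) - (\<Prod>k\<in>J y. p k) * (thin n p U * of_bool (J x \<subseteq> U))
         + (\<Prod>k\<in>J x. p k) * (\<Prod>k\<in>J y. p k) * thin n p U)"
      by (intro sum.cong refl) (auto simp: f_def algebra_simps)
    also have "\<dots> = (\<Prod>k\<in>J x \<union> J y. p k) - (\<Prod>k\<in>J x. p k) * (\<Prod>k\<in>J y. p k)"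
    proof -
      have "J x \<union> J y \<subseteq> {..<n}" using JP xy by blast
      note t = thin_subset[OF this, of p] thin_subset[OF JP(1)[OF xy(1)], of p] thin_subset[OF JP(1)[OF xy(2)], of p]
      show ?thesis by (simp only: sum.distrib sum_subtractf sum_distrib_left[symmetric] thin_sum_1 t) simp
    qed
    finally have eq: "(\<Sum>U\<in>Pow {..<n}. thin n p U * (f x U * f y U)) = \<dots>" .
    show ?thesis
    proof (cases "J x \<inter> J y = {}")
      case True
      then show ?thesis unfolding eq using JP xy by (simp add: prod.union_disjoint)
    next
      case False
      have "\<bar>X - A * B\<bar> \<le> 1" if "0 \<le> X \<and> X \<le> 1" "0 \<le> A \<and> A \<le> 1" "0 \<le> B \<and> B \<le> 1" for X A B :: real
      proof -
        have "0 \<le> A * B" "A * B \<le> 1" using that by (auto intro: mult_le_one)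
        then show ?thesis using that by linarith
      qed
      from this[OF pr pr pr, of "J x \<union> J y" "J x" "J y"] show ?thesis unfolding eq using False JP xy by simp
    qed
  qed
  have "(\<Sum>U\<in>Pow {..<n}. thin n p U * (q U - qm)\<^sup>2) = (\<Sum>x\<in>P. \<Sum>y\<in>P. c x * c y * (\<Sum>U\<in>Pow {..<n}. thin n p U * (f x U * f y U)))"
  proof -
    have "(\<Sum>U\<in>Pow {..<n}. thin n p U * (q U - qm)\<^sup>2) = (\<Sum>U\<in>Pow {..<n}. \<Sum>x\<in>P. \<Sum>y\<in>P. c x * c y * (thin n p U * (f x U * f y U)))"
      by (intro sum.cong refl) (simp add: qf power2_eq_square sum_product sum_distrib_left mult_ac)
    also have "\<dots> = (\<Sum>x\<in>P. \<Sum>U\<in>Pow {..<n}. \<Sum>y\<in>P. c x * c y * (thin n p U * (f x U * f y U)))"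
      by (rule sum.swap)
    also have "\<dots> = (\<Sum>x\<in>P. \<Sum>y\<in>P. \<Sum>U\<in>Pow {..<n}. c x * c y * (thin n p U * (f x U * f y U)))"
      by (intro sum.cong refl sum.swap)
    finally show ?thesis by (simp only: sum_distrib_left)
  qed
  also have "\<dots> \<le> (\<Sum>x\<in>P. \<Sum>y\<in>P. \<bar>c x\<bar> * \<bar>c y\<bar> * of_bool (J x \<inter> J y \<noteq> {}))"
  proof (intro sum_mono)
    fix x y assume xy: "x \<in> P" "y \<in> P"
    have "c x * c y * (\<Sum>U\<in>Pow {..<n}. thin n p U * (f x U * f y U)) \<le> \<bar>c x\<bar> * \<bar>c y\<bar> * \<bar>\<Sum>U\<in>Pow {..<n}. thin n p U * (f x U * f y U)\<bar>"
      unfolding abs_mult[symmetric] by (rule abs_ge_self)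
    also have "\<dots> \<le> \<bar>c x\<bar> * \<bar>c y\<bar> * of_bool (J x \<inter> J y \<noteq> {})"
      by (intro mult_left_mono cov xy) auto
    finally show "c x * c y * (\<Sum>U\<in>Pow {..<n}. thin n p U * (f x U * f y U)) \<le> \<dots>" .
  qed
  \<comment> \<open>An overlap means one of four coincidences of coordinates; counting them
    separately makes the sums over \<open>y\<close> explicit.\<close>
  also have "\<dots> \<le> (\<Sum>x\<in>P. \<Sum>y\<in>P. \<bar>c x\<bar> * \<bar>c y\<bar> * (of_bool (fst y = fst x) + of_bool (fst y = snd x) + of_bool (snd y = fst x) + of_bool (snd y = snd x)))"
    by (intro sum_mono mult_left_mono) (auto simp: J_def)
  also have "\<dots> = (\<Sum>i<n. \<Sum>j<n. \<bar>S i j\<bar> / n * (\<Sum>k<n. \<Sum>l<n. \<bar>S k l\<bar> / n *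
      (of_bool (k = i) + of_bool (k = j) + of_bool (l = i) + of_bool (l = j))))"
    unfolding P_def sum.cartesian_product' c_def by (simp add: sum_distrib_left mult.assoc)
  also have "\<dots> = (\<Sum>i<n. \<Sum>j<n. \<bar>S i j\<bar> / n * (2 * (\<Sum>l<n. \<bar>S i l\<bar> / n) + 2 * (\<Sum>l<n. \<bar>S j l\<bar> / n)))"
  proof (intro sum.cong refl arg_cong2[where f = "(*)"])
    fix i j assume ij: "i \<in> {..<n}" "j \<in> {..<n}"
    have k: "(\<Sum>k<n. \<Sum>l<n. \<bar>S k l\<bar> / n * of_bool (k = i)) = (\<Sum>l<n. \<bar>S i l\<bar> / n)" if "i < n" for i
    proof -
      have "(\<Sum>k<n. \<Sum>l<n. \<bar>S k l\<bar> / n * of_bool (k = i)) = (\<Sum>k<n. if k = i then (\<Sum>l<n. \<bar>S k l\<bar> / n) else 0)"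
        by (intro sum.cong refl) auto
      then show ?thesis using that by simp
    qed
    have l: "(\<Sum>k<n. \<Sum>l<n. \<bar>S k l\<bar> / n * of_bool (l = i)) = (\<Sum>l<n. \<bar>S i l\<bar> / n)" if "i < n" for i
    proof -
      have "(\<Sum>k<n. \<Sum>l<n. \<bar>S k l\<bar> / n * of_bool (l = i)) = (\<Sum>k<n. \<Sum>l<n. if l = i then \<bar>S k l\<bar> / n else 0)"
        by (intro sum.cong refl) auto
      then show ?thesis using that by (simp add: S_sym[of _ i])
    qed
    show "(\<Sum>k<n. \<Sum>l<n. \<bar>S k l\<bar> / n * (of_bool (k = i) + of_bool (k = j) + of_bool (l = i) + of_bool (l = j)))
      = 2 * (\<Sum>l<n. \<bar>S i l\<bar> / n) + 2 * (\<Sum>l<n. \<bar>S j l\<bar> / n)"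
      unfolding distrib_left sum.distrib using ij k l by simp
  qed
  also have "\<dots> = 4 * (\<Sum>i<n. (\<Sum>l<n. \<bar>S i l\<bar> / n)\<^sup>2)"
  proof -
    define h where "h i = (\<Sum>l<n. \<bar>S i l\<bar> / n)" for i
    have "(\<Sum>i<n. \<Sum>j<n. \<bar>S i j\<bar> / n * (2 * h j)) = (\<Sum>i<n. \<Sum>j<n. \<bar>S i j\<bar> / n * (2 * h i))"
      by (subst sum.swap) (simp add: S_sym)
    moreover have "(\<Sum>i<n. \<Sum>j<n. \<bar>S i j\<bar> / n * (2 * h i)) = 2 * (\<Sum>i<n. (h i)\<^sup>2)"
    proof -
      have "(\<Sum>j<n. \<bar>S i j\<bar> / n * (2 * h i)) = 2 * (h i)\<^sup>2" for i
        unfolding sum_distrib_right[symmetric] h_def[of i, symmetric] by (simp add: power2_eq_square)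
      then show ?thesis by (simp add: sum_distrib_left)
    qed
    ultimately show ?thesis unfolding h_def[symmetric] distrib_left sum.distrib by simp
  qed
  also have "\<dots> \<le> 4 * (\<Sum>i<n. (cb * R \<rho> i / n)\<^sup>2)"
  proof (intro mult_left_mono sum_mono power_mono)
    fix i assume i: "i \<in> {..<n}"
    have "(\<Sum>l<n. \<bar>S i l\<bar> / n) \<le> (\<Sum>l<n. cb * \<rho> powr d i l / n)"
      using i by (intro sum_mono divide_right_mono S_bound) auto
    then show "(\<Sum>l<n. \<bar>S i l\<bar> / n) \<le> cb * R \<rho> i / n"
      by (simp add: decay_sum_def sum_distrib_left sum_divide_distrib)
  qed (auto intro: sum_nonneg)
  also have "\<dots> = 4 * (cb\<^sup>2 / (real n)\<^sup>2) * (\<Sum>i<n. R \<rho> i ^ 2)"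
    by (simp add: sum_distrib_left power_mult_distrib power_divide mult.assoc)
  also have "\<dots> \<le> 4 * (cb\<^sup>2 / (real n)\<^sup>2) * (real n * KR \<rho>)"
    using rho rate by (intro mult_left_mono decay_sum_power) auto
  also have "\<dots> = 4 * cb\<^sup>2 * KR \<rho> / n" using n_pos by (simp add: power2_eq_square)
  finally have var: "(\<Sum>U\<in>Pow {..<n}. thin n p U * (q U - qm)\<^sup>2) \<le> 4 * cb\<^sup>2 * KR \<rho> / n" .
  have "(\<Sum>U\<in>Pow {..<n}. thin n p U * \<bar>q U - qm\<bar>) \<le> sqrt (\<Sum>U\<in>Pow {..<n}. thin n p U * (q U - qm)\<^sup>2)"
    by (intro weighted_abs_le_sqrt thin_nonneg p thin_sum_1) auto
  also have "\<dots> \<le> sqrt (4 * cb\<^sup>2 * KR \<rho> / n)" using var by (rule real_sqrt_le_mono)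
  finally show ?thesis .
qed


text \<open>The summands stem from the unweighted theorem, the spread of the subset variances, the
  Bernoulli approximation and the spread of the conditional variance. The exponential in front is
  the cost of dividing out the Gaussian factor, whose variance is at most
  \<open>a\<^sup>2\<close>.\<close>

definition weighted_clt_bound :: "real \<Rightarrow> real \<Rightarrow> real \<Rightarrow> real" where
  "weighted_clt_bound r m t = exp (t\<^sup>2 * a\<^sup>2 / 2) *
     (t * clt_bound r m t + t\<^sup>2 / 2 * sqrt (4 * cb\<^sup>2 * KR \<rho> / n) + 2 * t^3 * a^3 / sqrt n + t\<^sup>2 / 2 * vbound 0)"

text \<open>Averaging \<open>iexp (t S\<^sub>U)\<close> over random sets \<open>U\<close> that contain \<open>j\<close> independently with probability
  \<open>p j\<close> produces \<open>\<Sum>j. p j * e j\<close>, perturbed by a fluctuation that is conditionally Gaussian with the nearly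
  deterministic variance \<open>\<Sum>j. p j * (1 - p j) * (e j)\<^sup>2\<close>.\<close>
lemma clt_unit_weights:
  assumes p: "\<And>j. j < n \<Longrightarrow> 0 \<le> p j \<and> p j \<le> 1" and m: "m \<ge> 0" and T: "T \<ge> 0"
    and r: "\<rho> < r" "r < 1" "r * exp (2 * c1) < 1"
  defines "v \<equiv> (\<Sum>i<n. \<Sum>j<n. p i * p j * S i j) / n"
  shows "cmod (expectation (\<lambda>w. iexp (T * ((\<Sum>j<n. p j * e w j) / sqrt n))) - of_real (exp (- (T\<^sup>2 * v / 2))))
    \<le> weighted_clt_bound r m T"
proof -
  define W where "W w = (\<Sum>j<n. p j * e w j) / sqrt n" for w
  \<comment> \<open>Variance of the random subset sum divided by \<open>sqrt n\<close>, given the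
    errors; \<open>q0\<close> is its mean.\<close>
  define Q where "Q w = (\<Sum>j<n. p j * (1 - p j) * (e w j)\<^sup>2) / n" for w
  define q0 where "q0 = (\<Sum>j<n. p j * (1 - p j) * S j j) / n"
  define q where "q U = (\<Sum>i\<in>U. \<Sum>j\<in>U. S i j) / n" for U
  define qm where "qm = (\<Sum>i<n. \<Sum>j<n. (\<Prod>k\<in>{i, j}. p k) * S i j) / n"
  define y where "y j w = T * (e w j / sqrt n)" for j w
  \<comment> \<open>\<open>G\<close> is the conditional characteristic function of the random subset
    sum given the errors, and \<open>\<theta>\<close> its Gaussian approximation with mean
    \<open>W\<close> and variance \<open>Q\<close>. The proof evaluates the mean of \<open>G\<close>
    through subset sums and the mean of \<open>\<theta>\<close> through \<open>W\<close>.\<close>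
  define \<theta> where "\<theta> w = iexp (T * W w) * of_real (exp (- (T\<^sup>2 / 2 * Q w)))" for w
  define G where "G w = (\<Prod>j<n. of_real (p j) * iexp (y j w) + of_real (1 - p j))" for w
  have ym[measurable]: "j < n \<Longrightarrow> y j \<in> borel_measurable M" for j unfolding y_def by simp
  have Wm[measurable]: "W \<in> borel_measurable M" unfolding W_def by simp
  have Qm[measurable]: "Q \<in> borel_measurable M" unfolding Q_def by simp
  have Gm[measurable]: "G \<in> borel_measurable M" unfolding G_def by measurable
  have pp: "0 \<le> p j * (1 - p j)" "p j * (1 - p j) \<le> 1" if "j < n" for j
    using p[OF that] by (auto intro!: mult_le_one)
  have Q0: "Q w \<ge> 0" for w unfolding Q_def using pp by (auto intro!: divide_nonneg_nonneg sum_nonneg)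
  \<comment> \<open>Law of total variance: on the diagonal \<open>p i\<close> exceeds
    \<open>p i * p i\<close> by \<open>p i * (1 - p i)\<close>.\<close>
  have qm_eq: "qm = v + q0"
  proof -
    have "(\<Sum>j<n. (\<Prod>k\<in>{i, j}. p k) * S i j) = (\<Sum>j<n. p i * p j * S i j) + p i * (1 - p i) * S i i" if "i < n" for i
    proof -
      have "(\<Sum>j<n. (\<Prod>k\<in>{i, j}. p k) * S i j) = (\<Sum>j<n. p i * p j * S i j + (if j = i then p i * (1 - p i) * S i i else 0))"
        by (intro sum.cong refl) (auto simp: algebra_simps)
      then show ?thesis using that by (simp add: sum.distrib)
    qed
    then show ?thesis unfolding qm_def v_def q0_def by (simp add: sum.distrib add_divide_distrib)
  qed
  have q0_nonneg: "q0 \<ge> 0" and q0_le: "q0 \<le> a\<^sup>2"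
  proof -
    have S: "0 \<le> S j j \<and> S j j \<le> a\<^sup>2" if "j < n" for j
      using mom2[OF that that] by (simp add: Defs.Sigma_def abs_mult)
    then show "q0 \<ge> 0" unfolding q0_def using p by (auto intro!: divide_nonneg_nonneg sum_nonneg mult_nonneg_nonneg)
    have "q0 \<le> (\<Sum>j<n. 1 * a\<^sup>2) / n"
      unfolding q0_def using S pp by (intro divide_right_mono sum_mono mult_mono) auto
    then show "q0 \<le> a\<^sup>2" using n_pos by simp
  qed
  have qU: "q U \<ge> 0" if "U \<in> Pow {..<n}" for U
  proof -
    have "{..<n} \<inter> {j. j \<in> U} = U" "{..<n} \<inter> U = U" using that by auto
    then show ?thesis using quadratic_form_nonneg[of "\<lambda>i. of_bool (i \<in> U)"]
      unfolding q_def by (simp add: mult.assoc flip: sum_distrib_left)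
  qed
  have v0: "v \<ge> 0" unfolding v_def by (rule quadratic_form_nonneg)
  have y3: "expectation (\<lambda>w. \<bar>y j w\<bar>^3) \<le> T^3 * a^3 / (n * sqrt n)" "integrable M (\<lambda>w. \<bar>y j w\<bar>^3)" if "j < n" for j
  proof -
    have sq: "sqrt n ^ 3 = n * sqrt n" by (simp add: power3_eq_cube)
    have eq: "\<bar>y j w\<bar>^3 = T^3 / (n * sqrt n) * \<bar>e w j * e w j * e w j\<bar>" for w
      unfolding y_def abs_mult power_mult_distrib abs_divide power_divide sq[symmetric] using T
      by (simp add: power3_eq_cube)
    show "integrable M (\<lambda>w. \<bar>y j w\<bar>^3)" unfolding eq using that by (intro integrable_mult_right integrable_abs int3)
    have "T^3 / (n * sqrt n) * expectation (\<lambda>w. \<bar>e w j * e w j * e w j\<bar>) \<le> T^3 / (n * sqrt n) * a^3"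
      using T that by (intro mult_left_mono mom3) auto
    then show "expectation (\<lambda>w. \<bar>y j w\<bar>^3) \<le> T^3 * a^3 / (n * sqrt n)"
      unfolding eq integral_mult_right_zero by simp
  qed
  have fac: "cmod (of_real (p j) * iexp (y j w) + of_real (1 - p j)) \<le> 1" if "j < n" for j w
  proof -
    have "cmod (of_real (p j) * iexp (y j w) + of_real (1 - p j)) \<le> cmod (of_real (p j) * iexp (y j w)) + cmod (of_real (1 - p j))"
      by (rule norm_triangle_ineq)
    also have "\<dots> = 1" using p[OF that] by (simp add: norm_mult del: of_real_diff)
    finally show ?thesis .
  qed
  have G1: "cmod (G w) \<le> 1" for w
    unfolding G_def prod_norm[symmetric] using fac by (intro prod_le_1) auto
  have \<theta>1: "cmod (\<theta> w) \<le> 1" for w unfolding \<theta>_def norm_mult using Q0[of w] by simp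
  have iG: "integrable M G"
    by (rule integrable_const_bound[where B = 1]) (use G1 in auto)
  have \<theta>m[measurable]: "\<theta> \<in> borel_measurable M" unfolding \<theta>_def by measurable
  have i\<theta>: "integrable M \<theta>"
    by (rule integrable_const_bound[where B = 1]) (use \<theta>1 in auto)
  have G\<theta>: "cmod (expectation \<theta> - expectation G) \<le> 2 * T^3 * a^3 / sqrt n"
  proof -
    have \<theta>_prod: "\<theta> w = (\<Prod>j<n. iexp (p j * y j w) * of_real (exp (- (p j * (1 - p j) * (y j w)\<^sup>2 / 2))))" for w
    proof -
      have "T * W w = (\<Sum>j<n. p j * y j w)" unfolding W_def y_def by (simp add: sum_distrib_left sum_divide_distrib mult_ac)
      then have "iexp (T * W w) = (\<Prod>j<n. iexp (p j * y j w))"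
        by (simp only: of_real_sum sum_distrib_left exp_sum[OF finite_lessThan])
      moreover have "- (T\<^sup>2 / 2 * Q w) = (\<Sum>j<n. - (p j * (1 - p j) * (y j w)\<^sup>2 / 2))"
        unfolding Q_def y_def by (simp add: sum_distrib_left sum_divide_distrib power_mult_distrib power_divide sum_negf mult_ac)
      ultimately show ?thesis unfolding \<theta>_def by (simp add: exp_sum prod.distrib)
    qed
    \<comment> \<open>All factors lie in the unit disc, so the products differ by at most the sum of
      the differences of their factors.\<close>
    have pt: "cmod (\<theta> w - G w) \<le> (\<Sum>j<n. 2 * \<bar>y j w\<bar>^3)" for w
    proof -
      have "cmod (G w - \<theta> w) \<le> (\<Sum>j<n. cmod (of_real (p j) * iexp (y j w) + of_real (1 - p j)
         - iexp (p j * y j w) * of_real (exp (- (p j * (1 - p j) * (y j w)\<^sup>2 / 2)))))"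
        unfolding \<theta>_prod G_def using fac pp by (intro norm_prod_diff) (auto simp: norm_mult)
      also have "\<dots> \<le> (\<Sum>j<n. 2 * \<bar>y j w\<bar>^3)"
        using p by (intro sum_mono bernoulli_char_approx) auto
      finally show ?thesis by (simp add: norm_minus_commute)
    qed
    have "expectation \<theta> - expectation G = expectation (\<lambda>w. \<theta> w - G w)" using i\<theta> iG by simp
    also have "cmod \<dots> \<le> expectation (\<lambda>w. \<Sum>j<n. 2 * \<bar>y j w\<bar>^3)"
      using pt i\<theta> iG y3(2) by (intro cmod_integral_le) auto
    also have "\<dots> = (\<Sum>j<n. 2 * expectation (\<lambda>w. \<bar>y j w\<bar>^3))" using y3(2) by simp
    also have "\<dots> \<le> (\<Sum>j<n. 2 * (T^3 * a^3 / (n * sqrt n)))"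
      using y3(1) by (intro sum_mono mult_left_mono) auto
    also have "\<dots> = 2 * T^3 * a^3 / sqrt n" using n_pos by simp
    finally show ?thesis .
  qed
  \<comment> \<open>The unweighted theorem holds for each \<open>U\<close> with its own variance
    \<open>q U\<close>; the average over \<open>U\<close> may use the common value \<open>qm\<close>
    because \<open>q U\<close> concentrates there.\<close>
  have G_lim: "cmod (expectation G - of_real (exp (- (T\<^sup>2 * qm / 2)))) \<le> T * clt_bound r m T + T\<^sup>2 / 2 * sqrt (4 * cb\<^sup>2 * KR \<rho> / n)"
  proof -
    let ?\<phi> = "\<lambda>U. expectation (\<lambda>w. iexp (T * ((\<Sum>j\<in>U. e w j) / sqrt n)))"
    let ?P = "Pow {..<n}"
    have iU: "integrable M (\<lambda>w. iexp (T * ((\<Sum>j\<in>U. e w j) / sqrt n)))" if "U \<in> ?P" for U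
      using that by (intro integrable_iexp_rv borel_measurable_times borel_measurable_divide borel_measurable_sum e_meas borel_measurable_const) auto
    have Gw: "G w = (\<Sum>U\<in>?P. of_real (thin n p U) * iexp (T * ((\<Sum>j\<in>U. e w j) / sqrt n)))" for w
    proof -
      have "(\<Prod>j\<in>U. iexp (y j w)) = iexp (T * ((\<Sum>j\<in>U. e w j) / sqrt n))" if "U \<in> ?P" for U
      proof -
        have "finite U" using that finite_subset by auto
        then have "(\<Prod>j\<in>U. iexp (y j w)) = iexp (\<Sum>j\<in>U. y j w)" by (simp only: of_real_sum sum_distrib_left exp_sum)
        also have "(\<Sum>j\<in>U. y j w) = T * ((\<Sum>j\<in>U. e w j) / sqrt n)"
          unfolding y_def by (simp only: sum_distrib_left sum_divide_distrib)
        finally show ?thesis .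
      qed
      then show ?thesis unfolding G_def thin_prod[symmetric] by (intro sum.cong refl) simp
    qed
    have "expectation G = (\<Sum>U\<in>?P. expectation (\<lambda>w. of_real (thin n p U) * iexp (T * ((\<Sum>j\<in>U. e w j) / sqrt n))))"
      unfolding Gw by (intro Bochner_Integration.integral_sum integrable_mult_right iU)
    then have EG: "expectation G = (\<Sum>U\<in>?P. of_real (thin n p U) * ?\<phi> U)"
      unfolding integral_mult_right_zero .
    have one: "(\<Sum>U\<in>?P. complex_of_real (thin n p U)) = 1" by (simp flip: of_real_sum add: thin_sum_1)
    have pi0: "thin n p U \<ge> 0" if "U \<in> ?P" for U using that p by (intro thin_nonneg) auto
    have gen: "(\<Sum>U\<in>?P. thin n p U * (K + L * f U)) = K * (\<Sum>U\<in>?P. thin n p U) + L * (\<Sum>U\<in>?P. thin n p U * f U)"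
      for K L :: real and f :: "nat set \<Rightarrow> real"
      by (simp only: distrib_left sum.distrib sum_distrib_left mult_ac)
    have qm0: "qm \<ge> 0" using qm_eq v0 q0_nonneg by simp
    have eq: "expectation G - of_real (exp (- (T\<^sup>2 * qm / 2)))
        = (\<Sum>U\<in>?P. of_real (thin n p U) * (?\<phi> U - of_real (exp (- (T\<^sup>2 * qm / 2)))))"
      unfolding EG right_diff_distrib sum_subtractf sum_distrib_right[symmetric] one by simp
    have "cmod (expectation G - of_real (exp (- (T\<^sup>2 * qm / 2)))) \<le> (\<Sum>U\<in>?P. thin n p U * (T * clt_bound r m T + T\<^sup>2 / 2 * \<bar>q U - qm\<bar>))"
      unfolding eq
    proof (intro order_trans[OF norm_sum] sum_mono)
      fix U assume U: "U \<in> ?P"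
      have c1: "cmod (?\<phi> U - of_real (exp (- (T\<^sup>2 * q U / 2)))) \<le> T * clt_bound r m T"
        unfolding q_def using U by (intro clt_subset_sum m T r) auto
      have "\<bar>exp (- (T\<^sup>2 * q U / 2)) - exp (- (T\<^sup>2 * qm / 2))\<bar> \<le> \<bar>T\<^sup>2 * q U / 2 - T\<^sup>2 * qm / 2\<bar>"
        using qU[OF U] qm0 by (intro exp_minus_diff_le) auto
      also have "\<dots> = T\<^sup>2 / 2 * \<bar>q U - qm\<bar>"
        by (simp only: right_diff_distrib[symmetric] diff_divide_distrib[symmetric] abs_mult abs_divide) simp
      finally have c2: "cmod (of_real (exp (- (T\<^sup>2 * q U / 2))) - of_real (exp (- (T\<^sup>2 * qm / 2)))) \<le> T\<^sup>2 / 2 * \<bar>q U - qm\<bar>"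
        by (simp only: of_real_diff[symmetric] norm_of_real)
      have "cmod (?\<phi> U - of_real (exp (- (T\<^sup>2 * qm / 2)))) \<le> T * clt_bound r m T + T\<^sup>2 / 2 * \<bar>q U - qm\<bar>"
        using norm_triangle_le[OF add_mono[OF c1 c2]] by simp
      then show "cmod (of_real (thin n p U) * (?\<phi> U - of_real (exp (- (T\<^sup>2 * qm / 2)))))
        \<le> thin n p U * (T * clt_bound r m T + T\<^sup>2 / 2 * \<bar>q U - qm\<bar>)"
        using pi0[OF U] unfolding norm_mult norm_of_real by (simp only: abs_of_nonneg) (rule mult_left_mono)
    qed
    also have "\<dots> = T * clt_bound r m T * (\<Sum>U\<in>?P. thin n p U) + T\<^sup>2 / 2 * (\<Sum>U\<in>?P. thin n p U * \<bar>q U - qm\<bar>)"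
      by (rule gen)
    also have "\<dots> \<le> T * clt_bound r m T + T\<^sup>2 / 2 * sqrt (4 * cb\<^sup>2 * KR \<rho> / n)"
    proof -
      have "(\<Sum>U\<in>?P. thin n p U * \<bar>q U - qm\<bar>) \<le> sqrt (4 * cb\<^sup>2 * KR \<rho> / n)"
        unfolding q_def qm_def using p by (rule thinned_variance_concentration)
      then have "T\<^sup>2 / 2 * (\<Sum>U\<in>?P. thin n p U * \<bar>q U - qm\<bar>) \<le> T\<^sup>2 / 2 * sqrt (4 * cb\<^sup>2 * KR \<rho> / n)"
        by (rule mult_left_mono) simp
      then show ?thesis unfolding thin_sum_1 by linarith
    qed
    finally show ?thesis .
  qed
  have \<theta>_lim: "cmod (expectation \<theta> - of_real (exp (- (T\<^sup>2 / 2 * q0))) * expectation (\<lambda>w. iexp (T * W w))) \<le> T\<^sup>2 / 2 * vbound 0"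
  proof -
    \<comment> \<open>\<open>Q\<close> is a quadratic form on the diagonal, hence supported on pairs
      within distance 0, and the near-pair estimate applies with radius 0.\<close>
    define \<alpha> where "\<alpha> i j = (if i = j then p i * (1 - p i) else 0)" for i j :: nat
    have \<alpha>: "\<bar>\<alpha> i j\<bar> \<le> 1 * near 0 i j" if "i < n" "j < n" for i j
      using pp that by (auto simp: \<alpha>_def d_refl)
    have diag: "(\<Sum>i<n. \<Sum>j<n. \<alpha> i j * f i j) = (\<Sum>j<n. p j * (1 - p j) * f j j)" for f :: "nat \<Rightarrow> nat \<Rightarrow> real"
      unfolding \<alpha>_def by (intro sum.cong refl) (simp add: if_distrib[of "\<lambda>x. x * _"] cong: if_cong)
    note dev = near_pairs_deviation[OF order_refl zero_le_one \<alpha>, unfolded diag]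
    have iQ: "integrable M (\<lambda>w. Q w - q0)" and EQ: "expectation (\<lambda>w. \<bar>Q w - q0\<bar>) \<le> vbound 0"
      using dev unfolding Q_def q0_def by (simp_all add: power2_eq_square)
    have ie: "integrable M (\<lambda>w. iexp (T * W w))" by (rule integrable_iexp_rv) simp
    have "expectation \<theta> - of_real (exp (- (T\<^sup>2 / 2 * q0))) * expectation (\<lambda>w. iexp (T * W w))
      = expectation (\<lambda>w. \<theta> w - of_real (exp (- (T\<^sup>2 / 2 * q0))) * iexp (T * W w))"
      using i\<theta> ie by simp
    also have "cmod \<dots> \<le> expectation (\<lambda>w. T\<^sup>2 / 2 * \<bar>Q w - q0\<bar>)"
    proof (rule cmod_integral_le)
      fix w
      have "\<theta> w - of_real (exp (- (T\<^sup>2 / 2 * q0))) * iexp (T * W w) = iexp (T * W w) * of_real (exp (- (T\<^sup>2 / 2 * Q w)) - exp (- (T\<^sup>2 / 2 * q0)))"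
        unfolding \<theta>_def by (simp add: algebra_simps)
      then have "cmod (\<theta> w - of_real (exp (- (T\<^sup>2 / 2 * q0))) * iexp (T * W w)) = \<bar>exp (- (T\<^sup>2 / 2 * Q w)) - exp (- (T\<^sup>2 / 2 * q0))\<bar>"
        by (simp only: norm_mult norm_of_real norm_exp_i_times) simp
      also have "\<dots> \<le> \<bar>T\<^sup>2 / 2 * Q w - T\<^sup>2 / 2 * q0\<bar>"
        using Q0[of w] q0_nonneg by (intro exp_minus_diff_le) auto
      also have "\<dots> = T\<^sup>2 / 2 * \<bar>Q w - q0\<bar>"
        by (simp only: right_diff_distrib[symmetric] abs_mult) simp
      finally show "cmod (\<theta> w - of_real (exp (- (T\<^sup>2 / 2 * q0))) * iexp (T * W w)) \<le> T\<^sup>2 / 2 * \<bar>Q w - q0\<bar>" .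
    qed (use i\<theta> ie iQ in auto)
    also have "\<dots> \<le> T\<^sup>2 / 2 * vbound 0"
      unfolding integral_mult_right_zero by (intro mult_left_mono EQ) simp
    finally show ?thesis .
  qed
  \<comment> \<open>By \<open>qm_eq\<close> both characteristic functions carry the factor with
    variance \<open>q0\<close>. Since \<open>q0 \<le> a\<^sup>2\<close>, dividing by it costs a
    constant independent of \<open>n\<close>.\<close>
  let ?X = "expectation (\<lambda>w. iexp (T * W w)) - of_real (exp (- (T\<^sup>2 * v / 2)))"
  let ?E = "T * clt_bound r m T + T\<^sup>2 / 2 * sqrt (4 * cb\<^sup>2 * KR \<rho> / n) + 2 * T^3 * a^3 / sqrt n + T\<^sup>2 / 2 * vbound 0"
  have "of_real (exp (- (T\<^sup>2 / 2 * q0))) * ?X = (expectation G - of_real (exp (- (T\<^sup>2 * qm / 2)))) + (expectation \<theta> - expectation G)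
     - (expectation \<theta> - of_real (exp (- (T\<^sup>2 / 2 * q0))) * expectation (\<lambda>w. iexp (T * W w)))"
  proof -
    have "exp (- (T\<^sup>2 * qm / 2)) = exp (- (T\<^sup>2 / 2 * q0)) * exp (- (T\<^sup>2 * v / 2))"
      unfolding qm_eq by (simp add: algebra_simps add_divide_distrib flip: exp_add)
    then show ?thesis by (simp add: algebra_simps)
  qed
  also have "cmod \<dots> \<le> ?E"
    by (intro order_trans[OF norm_triangle_ineq4] order_trans[OF norm_triangle_ineq] add_mono G_lim G\<theta> \<theta>_lim)
  finally have E: "exp (- (T\<^sup>2 / 2 * q0)) * cmod ?X \<le> ?E"
    by (simp only: norm_mult norm_of_real abs_exp_cancel)
  then have E0: "?E \<ge> 0" by (rule order_trans[rotated]) simp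
  have "cmod ?X = exp (T\<^sup>2 / 2 * q0) * (exp (- (T\<^sup>2 / 2 * q0)) * cmod ?X)"
    by (simp add: exp_minus)
  also have "\<dots> \<le> exp (T\<^sup>2 * a\<^sup>2 / 2) * ?E"
    using q0_le by (intro mult_mono E) (auto intro!: mult_left_mono)
  finally show ?thesis unfolding weighted_clt_bound_def W_def .
qed

end

section \<open>Signed weights\<close>

text \<open>Termwise comparison of the tails. The bound depends on \<open>cmod w\<close> only, so
  one truncation index serves a whole circle.\<close>

lemma exp_partial_sum_error:
  fixes w :: complex
  shows "cmod (exp w - (\<Sum>j<J. w ^ j /\<^sub>R fact j)) \<le> exp (cmod w) - (\<Sum>j<J. cmod w ^ j /\<^sub>R fact j)"
proof -
  define f where "f j = w ^ j /\<^sub>R fact j" for j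
  define g where "g j = cmod w ^ j /\<^sub>R fact j" for j
  have fg: "cmod (f j) = g j" for j by (simp add: f_def g_def norm_power)
  have sf: "f sums exp w" unfolding f_def by (rule exp_converges)
  have sg: "g sums exp (cmod w)" unfolding g_def by (rule exp_converges)
  have "exp w - (\<Sum>j<J. f j) = (\<Sum>j. f (j + J))"
    using suminf_split_initial_segment[OF sums_summable[OF sf], of J] sums_unique[OF sf] by simp
  also have "cmod \<dots> \<le> (\<Sum>j. g (j + J))"
    using summable_ignore_initial_segment[OF sums_summable[OF sg], of J]
    by (intro order_trans[OF summable_norm]) (simp_all add: fg)
  also have "\<dots> = exp (cmod w) - (\<Sum>j<J. g j)"
    using suminf_split_initial_segment[OF sums_summable[OF sg], of J] sums_unique[OF sg] by simp
  finally show ?thesis unfolding f_def g_def .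
qed

lemma cmod_exp_diff_le:
  fixes a b :: complex
  assumes "cmod a \<le> r" "cmod b \<le> r"
  shows "cmod (exp a - exp b) \<le> exp r * cmod (a - b)"
proof (rule field_differentiable_bound[where S = "cball 0 r" and f' = exp])
  show "(exp has_field_derivative exp z) (at z within cball 0 r)" for z :: complex
    by (rule DERIV_subset[OF DERIV_exp]) simp
  show "cmod (exp z) \<le> exp r" if "z \<in> cball 0 r" for z
    using that norm_exp[of z] by (simp add: order_trans)
qed (use assms in auto)

text \<open>\<open>exp (- (iexp (\<epsilon> x) - 1) / \<epsilon>)\<close> is close to \<open>iexp (- x)\<close>, yet its Fourier series only contains nonnegative
  frequencies. This is how the sign of a coefficient is reversed.\<close>
lemma negative_frequency_approx:
  fixes \<epsilon> :: real assumes \<epsilon>: "\<epsilon> > 0"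
  shows "\<exists>J c. \<forall>x. cmod ((\<Sum>j<J. c j * iexp (real j * \<epsilon> * x)) - iexp (- x)) \<le> \<epsilon> * (1 + x\<^sup>2 / 2 * exp \<bar>x\<bar>)"
proof -
  define r where "r = 1 / \<epsilon>"
  have r: "r > 0" using \<epsilon> by (simp add: r_def)
  have "(\<lambda>J. \<Sum>j<J. r ^ j /\<^sub>R fact j) \<longlonglongrightarrow> exp r"
    using exp_converges[of r] by (simp add: sums_def)
  \<comment> \<open>The partial sum is later multiplied by \<open>exp r\<close>, so its error must
    stay below \<open>\<epsilon> / exp r\<close>. The index \<open>J\<close> is independent of
    \<open>x\<close> because \<open>cmod w = r\<close> throughout.\<close>
  moreover have "exp r - \<epsilon> / exp r < exp r" using \<epsilon> by simp
  ultimately obtain J where J: "(\<Sum>j<J. r ^ j /\<^sub>R fact j) > exp r - \<epsilon> / exp r"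
    by (metis (no_types, lifting) eventually_sequentially order_refl order_tendstoD(1))
  define c where "c j = complex_of_real (exp r * ((- r) ^ j / fact j))" for j
  have "cmod ((\<Sum>j<J. c j * iexp (real j * \<epsilon> * x)) - iexp (- x)) \<le> \<epsilon> * (1 + x\<^sup>2 / 2 * exp \<bar>x\<bar>)" for x
  proof -
    define w where "w = complex_of_real (- r) * iexp (\<epsilon> * x)"
    have nw: "cmod w = r" using r by (simp add: w_def norm_mult)
    have sum: "(\<Sum>j<J. c j * iexp (real j * \<epsilon> * x)) = of_real (exp r) * (\<Sum>j<J. w ^ j /\<^sub>R fact j)"
    proof -
      have "c j * iexp (real j * \<epsilon> * x) = of_real (exp r) * (w ^ j /\<^sub>R fact j)" for j
      proof -
        have "iexp (real j * \<epsilon> * x) = iexp (\<epsilon> * x) ^ j" by (simp add: exp_of_nat_mult[symmetric] mult_ac)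
        moreover have "w ^ j = of_real ((- r) ^ j) * iexp (\<epsilon> * x) ^ j"
          by (simp only: w_def power_mult_distrib of_real_power)
        ultimately show ?thesis unfolding c_def by (simp add: scaleR_conv_of_real divide_inverse)
      qed
      then show ?thesis by (simp add: sum_distrib_left)
    qed
    have "cmod (of_real (exp r) * (exp w - (\<Sum>j<J. w ^ j /\<^sub>R fact j))) \<le> exp r * (\<epsilon> / exp r)"
    proof -
      have "cmod (exp w - (\<Sum>j<J. w ^ j /\<^sub>R fact j)) \<le> \<epsilon> / exp r"
        using exp_partial_sum_error[of w J] J unfolding nw by linarith
      then show ?thesis unfolding norm_mult by (intro mult_mono) auto
    qed
    then have e1: "cmod (of_real (exp r) * (exp w - (\<Sum>j<J. w ^ j /\<^sub>R fact j))) \<le> \<epsilon>" by simp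
    \<comment> \<open>\<open>exp r * exp w = exp u\<close>, where \<open>u\<close> is
      \<open>- \<i> * x\<close> up to second order in \<open>x\<close>; the choice
      \<open>r = 1 / \<epsilon>\<close> cancels the step \<open>\<epsilon>\<close> in the linear
      term.\<close>
    define u where "u = - of_real r * (iexp (\<epsilon> * x) - 1)"
    have eu: "of_real (exp r) * exp w = exp u"
      unfolding u_def w_def by (simp add: algebra_simps exp_add exp_diff exp_minus divide_inverse flip: exp_of_real)
    have nu: "cmod u \<le> \<bar>x\<bar>"
    proof -
      have "cmod (iexp (\<epsilon> * x) - 1) \<le> \<epsilon> * \<bar>x\<bar>" using iexp_approx1[of "\<epsilon> * x" 0] \<epsilon> by (simp add: abs_mult)
      then have "r * cmod (iexp (\<epsilon> * x) - 1) \<le> r * (\<epsilon> * \<bar>x\<bar>)" using r by (intro mult_left_mono) auto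
      moreover have "cmod u = r * cmod (iexp (\<epsilon> * x) - 1)" unfolding u_def using r by (simp only: norm_mult norm_minus_cancel norm_of_real abs_of_pos)
      ultimately show ?thesis using \<epsilon> by (simp add: r_def)
    qed
    have du: "cmod (u - \<i> * of_real (- x)) \<le> \<epsilon> * x\<^sup>2 / 2"
    proof -
      have "u - \<i> * of_real (- x) = - of_real r * (iexp (\<epsilon> * x) - 1 - \<i> * of_real (\<epsilon> * x))"
        unfolding u_def r_def using \<epsilon> by (simp add: field_simps)
      then have "cmod (u - \<i> * of_real (- x)) = r * cmod (iexp (\<epsilon> * x) - 1 - \<i> * of_real (\<epsilon> * x))"
        using r by (simp only: norm_mult norm_minus_cancel norm_of_real abs_of_pos)
      also have "\<dots> \<le> r * ((\<epsilon> * x)\<^sup>2 / 2)" using r by (intro mult_left_mono cmod_iexp_1) auto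
      also have "\<dots> = \<epsilon> * x\<^sup>2 / 2" using \<epsilon> by (simp add: r_def power2_eq_square)
      finally show ?thesis .
    qed
    have "cmod (exp u - iexp (- x)) \<le> exp \<bar>x\<bar> * cmod (u - \<i> * of_real (- x))"
      by (rule cmod_exp_diff_le) (use nu in \<open>auto simp: norm_mult\<close>)
    also have "\<dots> \<le> exp \<bar>x\<bar> * (\<epsilon> * x\<^sup>2 / 2)" by (intro mult_left_mono du) auto
    finally have e2: "cmod (exp u - iexp (- x)) \<le> exp \<bar>x\<bar> * (\<epsilon> * x\<^sup>2 / 2)" .
    have "(\<Sum>j<J. c j * iexp (real j * \<epsilon> * x)) - iexp (- x)
      = (exp u - iexp (- x)) - of_real (exp r) * (exp w - (\<Sum>j<J. w ^ j /\<^sub>R fact j))"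
      unfolding sum right_diff_distrib eu by simp
    then have "cmod ((\<Sum>j<J. c j * iexp (real j * \<epsilon> * x)) - iexp (- x)) \<le> exp \<bar>x\<bar> * (\<epsilon> * x\<^sup>2 / 2) + \<epsilon>"
      by (simp only:) (intro order_trans[OF norm_triangle_ineq4] add_mono e1 e2)
    then show ?thesis by (simp add: algebra_simps)
  qed
  then show ?thesis by blast
qed

text \<open>The squared modulus of a trigonometric polynomial is again one, with the frequency
  differences. So this L2 norm depends only on finitely many values of the characteristic function
  and passes to the Gaussian limit.\<close>

lemma (in prob_space) trig_poly_second_moment:
  fixes X :: "'a \<Rightarrow> real" and \<delta> :: "nat \<Rightarrow> complex" and \<theta> :: "nat \<Rightarrow> real"
  assumes [measurable]: "X \<in> borel_measurable M"
  shows "complex_of_real (expectation (\<lambda>w. (cmod (\<Sum>k<K. \<delta> k * iexp (\<theta> k * X w)))\<^sup>2))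
    = (\<Sum>k<K. \<Sum>l<K. \<delta> k * cnj (\<delta> l) * expectation (\<lambda>w. iexp ((\<theta> k - \<theta> l) * X w)))"
proof -
  have "complex_of_real ((cmod (\<Sum>k<K. \<delta> k * iexp (\<theta> k * x)))\<^sup>2) = (\<Sum>k<K. \<Sum>l<K. \<delta> k * cnj (\<delta> l) * iexp ((\<theta> k - \<theta> l) * x))" for x
  proof -
    have "complex_of_real ((cmod (\<Sum>k<K. \<delta> k * iexp (\<theta> k * x)))\<^sup>2) = (\<Sum>k<K. \<delta> k * iexp (\<theta> k * x)) * cnj (\<Sum>k<K. \<delta> k * iexp (\<theta> k * x))"
      by (simp only: complex_norm_square[symmetric])
    also have "\<dots> = (\<Sum>k<K. \<Sum>l<K. (\<delta> k * iexp (\<theta> k * x)) * (cnj (\<delta> l) * iexp (- \<theta> l * x)))"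
      by (simp add: cnj_sum sum_product exp_cnj)
    also have "\<dots> = (\<Sum>k<K. \<Sum>l<K. \<delta> k * cnj (\<delta> l) * iexp ((\<theta> k - \<theta> l) * x))"
      by (intro sum.cong refl) (simp add: algebra_simps exp_diff exp_minus divide_inverse)
    finally show ?thesis .
  qed
  note eq = this
  have "complex_of_real (expectation (\<lambda>w. (cmod (\<Sum>k<K. \<delta> k * iexp (\<theta> k * X w)))\<^sup>2))
    = expectation (\<lambda>w. complex_of_real ((cmod (\<Sum>k<K. \<delta> k * iexp (\<theta> k * X w)))\<^sup>2))" by (rule integral_complex_of_real[symmetric])
  also have "\<dots> = expectation (\<lambda>w. \<Sum>k<K. \<Sum>l<K. \<delta> k * cnj (\<delta> l) * iexp ((\<theta> k - \<theta> l) * X w))" by (simp only: eq)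
  also have "\<dots> = (\<Sum>k<K. \<Sum>l<K. expectation (\<lambda>w. \<delta> k * cnj (\<delta> l) * iexp ((\<theta> k - \<theta> l) * X w)))"
  proof -
    have i: "integrable M (\<lambda>w. \<delta> k * cnj (\<delta> l) * iexp ((\<theta> k - \<theta> l) * X w))" for k l
      by (intro integrable_mult_right integrable_iexp_rv) simp
    show ?thesis
      by (subst Bochner_Integration.integral_sum, intro Bochner_Integration.integrable_sum i)
         (intro sum.cong refl Bochner_Integration.integral_sum i)
  qed
  also have "\<dots> = (\<Sum>k<K. \<Sum>l<K. \<delta> k * cnj (\<delta> l) * expectation (\<lambda>w. iexp ((\<theta> k - \<theta> l) * X w)))"
    by (intro sum.cong refl integral_mult_right_zero)
  finally show ?thesis .
qed

lemma integrable_std_normal_exp_abs: "integrable std_normal_distribution (\<lambda>x. exp (c * \<bar>x\<bar>))"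
proof -
  have e: "integrable std_normal_distribution (\<lambda>x. exp (b * x))" for b
  proof -
    \<comment> \<open>Completing the square gives the density of the normal law with mean
      \<open>b\<close>.\<close>
    have "std_normal_density x * exp (b * x) = exp (b\<^sup>2 / 2) * normal_density b 1 x" for x
      unfolding normal_density_def
      by (simp add: exp_add[symmetric] power2_eq_square) (simp add: algebra_simps field_simps exp_add[symmetric])
    then have "integrable lborel (\<lambda>x. std_normal_density x *\<^sub>R exp (b * x))"
      using integrable_mult_right[OF integrable_normal_moment[of 1 b 0], of "exp (b\<^sup>2 / 2)"] by simp
    then show ?thesis by (subst integrable_density) auto
  qed
  show ?thesis
  proof (rule Bochner_Integration.integrable_bound)
    show "integrable std_normal_distribution (\<lambda>x. exp (c * x) + exp (- c * x))" by (intro Bochner_Integration.integrable_add e)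
    show "AE x in std_normal_distribution. norm (exp (c * \<bar>x\<bar>)) \<le> norm (exp (c * x) + exp (- c * x))"
      unfolding real_norm_def abs_of_pos[OF add_pos_pos[OF exp_gt_zero exp_gt_zero]] abs_exp_cancel
      by (rule AE_I2) (auto simp: abs_if)
  qed simp
qed

lemma iexp_std_normal: "(\<integral>x. iexp (t * x) \<partial>std_normal_distribution) = of_real (exp (- t\<^sup>2 / 2))"
  using fun_cong[OF char_std_normal_distribution, of t] by (simp add: char_def)

lemma exp_ge_power4:
  fixes y :: real assumes "y \<ge> 0" shows "y ^ 4 / 24 \<le> exp y"
proof -
  have "(\<Sum>j\<in>{4}. y ^ j /\<^sub>R fact j) \<le> (\<Sum>j. y ^ j /\<^sub>R fact j)"
    using assms summable_exp_generic[of y] by (intro sum_le_suminf) auto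
  then show ?thesis by (simp add: exp_def fact_numeral)
qed

text \<open>Let \<open>P\<close> be the trigonometric approximation of \<open>iexp (- x)\<close>
  minus that function. The approximation has nonnegative frequencies, so \<open>conv\<close> treats
  it. The rest, the mean of \<open>iexp A * P B\<close>, is at most the L2 norm of
  \<open>P B\<close>, whose square involves the law of \<open>B\<close> alone and is therefore close
  to the Gaussian value, small by construction. The same splitting is made on the Gaussian
  side.\<close>

lemma char_fun_negative_weight:
  fixes A B :: "nat \<Rightarrow> 'a \<Rightarrow> real" and a b c :: "nat \<Rightarrow> real"
  assumes M: "\<And>n. prob_space (M n)"
    and A: "\<And>n. A n \<in> borel_measurable (M n)" and B: "\<And>n. B n \<in> borel_measurable (M n)"
    and q: "\<And>n x y. a n * x\<^sup>2 + 2 * b n * x * y + c n * y\<^sup>2 \<ge> 0" and K: "\<And>n. c n \<le> K"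
    and conv: "\<And>x y. x \<ge> 0 \<Longrightarrow> y \<ge> 0 \<Longrightarrow>
      (\<lambda>n. (\<integral>w. iexp (x * A n w + y * B n w) \<partial>M n) - of_real (exp (- (a n * x\<^sup>2 + 2 * b n * x * y + c n * y\<^sup>2) / 2))) \<longlonglongrightarrow> 0"
  shows "(\<lambda>n. (\<integral>w. iexp (A n w - B n w) \<partial>M n) - of_real (exp (- (a n - 2 * b n + c n) / 2))) \<longlonglongrightarrow> 0"
proof (rule LIMSEQ_I)
  fix \<eta> :: real assume \<eta>: "\<eta> > 0"
  interpret N: real_distribution std_normal_distribution by (rule real_dist_normal_dist)
  \<comment> \<open>The variances \<open>c n\<close> need not converge. Bounding them by
    \<open>K\<close> makes the majorant \<open>H\<close>, and with it \<open>C\<close> and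
    \<open>\<epsilon>\<close>, independent of \<open>n\<close>.\<close>
  define K' where "K' = sqrt (max K 0)"
  define H where "H x = 2 + 12 * exp (3 * K' * \<bar>x\<bar>)" for x
  have Hi: "integrable std_normal_distribution H"
    unfolding H_def by (intro Bochner_Integration.integrable_add integrable_mult_right integrable_std_normal_exp_abs) simp
  define C where "C = (\<integral>x. H x \<partial>std_normal_distribution)"
  have C0: "C \<ge> 0" unfolding C_def H_def by (intro Bochner_Integration.integral_nonneg) (simp add: add_nonneg_nonneg)
  define \<epsilon> where "\<epsilon> = \<eta> / (4 * (sqrt C + 1))"
  have \<epsilon>: "\<epsilon> > 0" using \<eta> C0 by (simp add: \<epsilon>_def add_nonneg_pos)
  have \<epsilon>C: "\<epsilon> * sqrt C < \<eta> / 4"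
  proof -
    have "\<epsilon> * sqrt C < \<epsilon> * (sqrt C + 1)" using \<epsilon> by (simp add: mult_strict_left_mono)
    also have "\<dots> = \<eta> / 4" using C0 by (simp add: \<epsilon>_def field_simps add_nonneg_eq_0_iff)
    finally show ?thesis .
  qed
  obtain J c' where J: "\<And>x. cmod ((\<Sum>j<J. c' j * iexp (real j * \<epsilon> * x)) - iexp (- x)) \<le> \<epsilon> * (1 + x\<^sup>2 / 2 * exp \<bar>x\<bar>)"
    using negative_frequency_approx[OF \<epsilon>] by blast
  \<comment> \<open>The extra index \<open>J\<close> carries frequency -1 with coefficient -1, so
    that the approximation error is itself a trigonometric polynomial.\<close>
  define \<delta> where "\<delta> k = (if k < J then c' k else -1)" for k
  define \<theta> where "\<theta> k = (if k < J then real k * \<epsilon> else -1)" for k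
  define P where "P x = (\<Sum>k<Suc J. \<delta> k * iexp (\<theta> k * x))" for x
  have P_eq: "P x = (\<Sum>j<J. c' j * iexp (real j * \<epsilon> * x)) - iexp (- x)" for x
    unfolding P_def by (simp add: \<delta>_def \<theta>_def)
  have [measurable]: "P \<in> borel_measurable borel" unfolding P_def by measurable
  have Pb: "cmod (P x) \<le> (\<Sum>k<Suc J. cmod (\<delta> k))" for x
    unfolding P_def by (rule order_trans[OF norm_sum]) (simp add: norm_mult)
  have P2b: "(cmod (P x))\<^sup>2 \<le> (\<Sum>k<Suc J. cmod (\<delta> k))\<^sup>2" for x by (intro power_mono Pb) auto
  have c0: "c n \<ge> 0" for n using q[of n 0 1] by simp
  define \<tau> where "\<tau> n = sqrt (c n)" for n
  have \<tau>: "0 \<le> \<tau> n" "\<tau> n \<le> K'" "(\<tau> n)\<^sup>2 = c n" for n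
    using c0[of n] K[of n] unfolding \<tau>_def K'_def by (auto intro!: real_sqrt_le_mono)
  have gaussP: "(\<integral>x. (cmod (P (\<tau> n * x)))\<^sup>2 \<partial>std_normal_distribution) \<le> \<epsilon>\<^sup>2 * C" for n
  proof -
    have "(cmod (P (\<tau> n * x)))\<^sup>2 \<le> \<epsilon>\<^sup>2 * H x" for x
    proof -
      let ?y = "\<bar>\<tau> n * x\<bar>"
      have e4: "?y ^ 4 / 24 \<le> exp ?y"
        by (rule exp_ge_power4) simp
      have "(cmod (P (\<tau> n * x)))\<^sup>2 \<le> (\<epsilon> * (1 + (\<tau> n * x)\<^sup>2 / 2 * exp ?y))\<^sup>2"
        unfolding P_eq by (intro power_mono J) auto
      also have "\<dots> = \<epsilon>\<^sup>2 * (1 + ?y\<^sup>2 / 2 * exp ?y)\<^sup>2" by (simp add: power_mult_distrib)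
      also have "(1 + ?y\<^sup>2 / 2 * exp ?y)\<^sup>2 \<le> 2 + 2 * (?y\<^sup>2 / 2 * exp ?y)\<^sup>2"
        using sum_squares_bound[of 1 "?y\<^sup>2 / 2 * exp ?y"] unfolding power2_sum by simp
      also have "2 * (?y\<^sup>2 / 2 * exp ?y)\<^sup>2 = 12 * (?y ^ 4 / 24 * exp (2 * ?y))"
        by (simp add: power_mult_distrib power_divide exp_double flip: power_mult)
      also have "?y ^ 4 / 24 * exp (2 * ?y) \<le> exp ?y * exp (2 * ?y)" using e4 by (intro mult_right_mono) auto
      also have "exp ?y * exp (2 * ?y) = exp (3 * \<tau> n * \<bar>x\<bar>)" using \<tau>[of n] by (simp add: abs_mult flip: exp_add)
      also have "\<dots> \<le> exp (3 * K' * \<bar>x\<bar>)" using \<tau>[of n] by (simp add: mult_right_mono)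
      finally show ?thesis using \<epsilon> by (simp add: H_def mult_left_mono)
    qed
    then have "(\<integral>x. (cmod (P (\<tau> n * x)))\<^sup>2 \<partial>std_normal_distribution) \<le> (\<integral>x. \<epsilon>\<^sup>2 * H x \<partial>std_normal_distribution)"
      using P2b by (intro integral_mono integrable_mult_right Hi N.integrable_const_bound[where B = "(\<Sum>k<Suc J. cmod (\<delta> k))\<^sup>2"]) auto
    then show ?thesis by (simp add: C_def)
  qed
  \<comment> \<open>For \<open>B\<close> alone, negative frequencies follow by complex conjugation;
    they occur among the differences of frequencies in the second moment.\<close>
  have conv1: "(\<lambda>n. (\<integral>w. iexp (t * B n w) \<partial>M n) - of_real (exp (- c n * t\<^sup>2 / 2))) \<longlonglongrightarrow> 0" for t
  proof (cases "t \<ge> 0")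
    case True
    then show ?thesis using conv[of 0 t] by simp
  next
    case False
    then have "(\<lambda>n. cnj ((\<integral>w. iexp ((- t) * B n w) \<partial>M n) - of_real (exp (- c n * (- t)\<^sup>2 / 2)))) \<longlonglongrightarrow> cnj 0"
      using conv[of 0 "- t"] by (intro tendsto_cnj) simp
    moreover have "cnj (\<integral>w. iexp ((- t) * B n w) \<partial>M n) = (\<integral>w. iexp (t * B n w) \<partial>M n)" for n
    proof -
      have "cnj (\<integral>w. iexp ((- t) * B n w) \<partial>M n) = (\<integral>w. cnj (iexp ((- t) * B n w)) \<partial>M n)"
        by (rule Bochner_Integration.integral_cnj[symmetric])
      then show ?thesis by (simp add: exp_cnj del: Bochner_Integration.integral_cnj)
    qed
    ultimately show ?thesis by simp
  qed
  have momP: "(\<lambda>n. complex_of_real (\<integral>w. (cmod (P (B n w)))\<^sup>2 \<partial>M n) - complex_of_real (\<integral>x. (cmod (P (\<tau> n * x)))\<^sup>2 \<partial>std_normal_distribution)) \<longlonglongrightarrow> 0"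
  proof -
    have "complex_of_real (\<integral>w. (cmod (P (B n w)))\<^sup>2 \<partial>M n) - complex_of_real (\<integral>x. (cmod (P (\<tau> n * x)))\<^sup>2 \<partial>std_normal_distribution)
      = (\<Sum>k<Suc J. \<Sum>l<Suc J. \<delta> k * cnj (\<delta> l) * ((\<integral>w. iexp ((\<theta> k - \<theta> l) * B n w) \<partial>M n) - of_real (exp (- c n * (\<theta> k - \<theta> l)\<^sup>2 / 2))))" for n
    proof -
      have g: "(\<integral>x. iexp (t * (\<tau> n * x)) \<partial>std_normal_distribution) = of_real (exp (- c n * t\<^sup>2 / 2))" for t
        using iexp_std_normal[of "t * \<tau> n"] by (simp only: mult.assoc power_mult_distrib \<tau>(3)) (simp add: mult_ac)
      have m: "(\<lambda>x. \<tau> n * x) \<in> borel_measurable std_normal_distribution" by simp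
      show ?thesis
        unfolding P_def prob_space.trig_poly_second_moment[OF M B] N.trig_poly_second_moment[OF m] g
        by (simp only: right_diff_distrib sum_subtractf)
    qed
    then show ?thesis by (simp only:) (intro tendsto_null_sum tendsto_mult_right_zero conv1)
  qed
  have lim: "(\<lambda>n. \<Sum>j<J. c' j * ((\<integral>w. iexp (1 * A n w + (real j * \<epsilon>) * B n w) \<partial>M n)
      - of_real (exp (- (a n * 1\<^sup>2 + 2 * b n * 1 * (real j * \<epsilon>) + c n * (real j * \<epsilon>)\<^sup>2) / 2)))) \<longlonglongrightarrow> 0"
    by (intro tendsto_null_sum tendsto_mult_right_zero conv) (use \<epsilon> in auto)
  have eC: "\<epsilon>\<^sup>2 * C < (\<eta> / 4)\<^sup>2"
    using power_strict_mono[OF \<epsilon>C, of 2] \<epsilon> C0 by (simp add: power_mult_distrib)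
  then have "(\<eta> / 4)\<^sup>2 - \<epsilon>\<^sup>2 * C > 0" by simp
  from LIMSEQ_D[OF momP this] obtain N1 where N1: "\<And>n. n \<ge> N1 \<Longrightarrow>
     cmod (complex_of_real (\<integral>w. (cmod (P (B n w)))\<^sup>2 \<partial>M n) - complex_of_real (\<integral>x. (cmod (P (\<tau> n * x)))\<^sup>2 \<partial>std_normal_distribution)) < (\<eta> / 4)\<^sup>2 - \<epsilon>\<^sup>2 * C"
    by auto
  from LIMSEQ_D[OF lim, of "\<eta> / 4"] \<eta> obtain N2 where N2: "\<And>n. n \<ge> N2 \<Longrightarrow>
     cmod (\<Sum>j<J. c' j * ((\<integral>w. iexp (1 * A n w + (real j * \<epsilon>) * B n w) \<partial>M n)
      - of_real (exp (- (a n * 1\<^sup>2 + 2 * b n * 1 * (real j * \<epsilon>) + c n * (real j * \<epsilon>)\<^sup>2) / 2)))) < \<eta> / 4"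
    by auto
  have "norm (((\<integral>w. iexp (A n w - B n w) \<partial>M n) - of_real (exp (- (a n - 2 * b n + c n) / 2))) - 0) < \<eta>" if n: "n \<ge> max N1 N2" for n
  proof -
    interpret prob_space "M n" by (rule M)
    note A[of n, measurable] B[of n, measurable]
    \<comment> \<open>Regression in the Gaussian model: the second coordinate is
      \<open>\<tau> n * x\<close> and the first is \<open>\<alpha> * x\<close> plus an independent
      part of variance \<open>\<kappa>\<close>, which only contributes
      \<open>exp (- \<kappa> / 2)\<close>. If \<open>\<tau> n = 0\<close>, the division gives
      \<open>\<alpha> = 0\<close>, which is consistent because \<open>b n\<close> then
      vanishes.\<close>
    define \<alpha> where "\<alpha> = b n / \<tau> n"
    have \<alpha>\<tau>: "\<alpha> * \<tau> n = b n"
    proof (cases "\<tau> n = 0")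
      case True
      then have c: "c n = 0" using \<tau>(3)[of n] by simp
      have "b n = 0"
      proof (rule ccontr)
        assume "b n \<noteq> 0"
        \<comment> \<open>With \<open>c n = 0\<close> the form at \<open>(1, y)\<close> is affine in
          \<open>y\<close>, and at this point it equals -1.\<close>
        then show False using q[of n 1 "- (a n + 1) / (2 * b n)"] c by (simp add: field_simps)
      qed
      then show ?thesis by (simp add: \<alpha>_def)
    qed (simp add: \<alpha>_def)
    define \<kappa> where "\<kappa> = a n - \<alpha>\<^sup>2"
    have \<kappa>: "\<kappa> \<ge> 0"
    proof (cases "\<tau> n = 0")
      case True
      then show ?thesis using q[of n 1 0] by (simp add: \<kappa>_def \<alpha>_def)
    next
      case False
      have "a n * 1\<^sup>2 + 2 * b n * 1 * (- \<alpha> / \<tau> n) + c n * (- \<alpha> / \<tau> n)\<^sup>2 = a n - \<alpha>\<^sup>2"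
        using False unfolding \<alpha>\<tau>[symmetric] \<tau>(3)[symmetric] by (simp add: field_simps power2_eq_square)
      then show ?thesis using q[of n 1 "- \<alpha> / \<tau> n"] by (simp add: \<kappa>_def)
    qed
    have quad: "a n + 2 * b n * y + c n * y\<^sup>2 = \<kappa> + (\<alpha> + y * \<tau> n)\<^sup>2" for y
      unfolding \<kappa>_def \<alpha>\<tau>[symmetric] \<tau>(3)[symmetric] by (simp add: algebra_simps power2_eq_square)
    have gy: "of_real (exp (- (a n + 2 * b n * y + c n * y\<^sup>2) / 2))
      = of_real (exp (- \<kappa> / 2)) * (\<integral>x. iexp (\<alpha> * x) * iexp (y * (\<tau> n * x)) \<partial>std_normal_distribution)" for y
    proof -
      have "iexp (\<alpha> * x) * iexp (y * (\<tau> n * x)) = iexp ((\<alpha> + y * \<tau> n) * x)" for x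
        by (simp add: algebra_simps flip: exp_add)
      then show ?thesis unfolding quad
        by (simp only: iexp_std_normal of_real_mult[symmetric]) (simp add: add_divide_distrib flip: exp_add)
    qed
    have iB: "integrable (M n) (\<lambda>w. iexp (A n w) * iexp (t * B n w))" for t
      by (rule integrable_const_bound[where B = 1]) (auto simp: norm_mult)
    have iG: "integrable std_normal_distribution (\<lambda>x. iexp (\<alpha> * x) * iexp (t * (\<tau> n * x)))" for t
      by (rule N.integrable_const_bound[where B = 1]) (auto simp: norm_mult)
    have EP: "(\<integral>w. iexp (A n w) * P (B n w) \<partial>M n) = (\<Sum>j<J. c' j * (\<integral>w. iexp (1 * A n w + (real j * \<epsilon>) * B n w) \<partial>M n)) - (\<integral>w. iexp (A n w - B n w) \<partial>M n)"
    proof -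
      have "iexp (A n w) * P (B n w) = (\<Sum>j<J. c' j * (iexp (A n w) * iexp ((real j * \<epsilon>) * B n w))) - iexp (A n w) * iexp ((-1) * B n w)" for w
        unfolding P_eq by (simp add: right_diff_distrib sum_distrib_left mult_ac)
      then have "(\<integral>w. iexp (A n w) * P (B n w) \<partial>M n) = (\<Sum>j<J. c' j * (\<integral>w. iexp (A n w) * iexp ((real j * \<epsilon>) * B n w) \<partial>M n)) - (\<integral>w. iexp (A n w) * iexp ((-1) * B n w) \<partial>M n)"
        using iB by (simp only: Bochner_Integration.integral_diff Bochner_Integration.integral_sum Bochner_Integration.integrable_sum integrable_mult_right integral_mult_right_zero)
      moreover have "iexp (A n w) * iexp (t * B n w) = iexp (1 * A n w + t * B n w)" for w t
        by (simp add: exp_add distrib_left)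
      ultimately show ?thesis by (simp only:) simp
    qed
    have GP: "of_real (exp (- \<kappa> / 2)) * (\<integral>x. iexp (\<alpha> * x) * P (\<tau> n * x) \<partial>std_normal_distribution)
      = (\<Sum>j<J. c' j * of_real (exp (- (a n * 1\<^sup>2 + 2 * b n * 1 * (real j * \<epsilon>) + c n * (real j * \<epsilon>)\<^sup>2) / 2))) - of_real (exp (- (a n - 2 * b n + c n) / 2))"
    proof -
      have "iexp (\<alpha> * x) * P (\<tau> n * x) = (\<Sum>j<J. c' j * (iexp (\<alpha> * x) * iexp ((real j * \<epsilon>) * (\<tau> n * x)))) - iexp (\<alpha> * x) * iexp ((-1) * (\<tau> n * x))" for x
        unfolding P_eq by (simp add: right_diff_distrib sum_distrib_left mult_ac)
      then have "(\<integral>x. iexp (\<alpha> * x) * P (\<tau> n * x) \<partial>std_normal_distribution) = (\<Sum>j<J. c' j * (\<integral>x. iexp (\<alpha> * x) * iexp ((real j * \<epsilon>) * (\<tau> n * x)) \<partial>std_normal_distribution)) - (\<integral>x. iexp (\<alpha> * x) * iexp ((-1) * (\<tau> n * x)) \<partial>std_normal_distribution)"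
        using iG by (simp only: Bochner_Integration.integral_diff Bochner_Integration.integral_sum Bochner_Integration.integrable_sum integrable_mult_right integral_mult_right_zero)
      then have "of_real (exp (- \<kappa> / 2)) * (\<integral>x. iexp (\<alpha> * x) * P (\<tau> n * x) \<partial>std_normal_distribution)
        = (\<Sum>j<J. c' j * of_real (exp (- (a n + 2 * b n * (real j * \<epsilon>) + c n * (real j * \<epsilon>)\<^sup>2) / 2))) - of_real (exp (- (a n + 2 * b n * (-1) + c n * (-1)\<^sup>2) / 2))"
        unfolding gy by (simp only: right_diff_distrib sum_distrib_left mult.left_commute)
      then show ?thesis by simp
    qed
    have bP: "cmod (\<integral>w. iexp (A n w) * P (B n w) \<partial>M n) < \<eta> / 4"
    proof -
      have m: "(\<lambda>w. cmod (P (B n w))) \<in> borel_measurable (M n)" by measurable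
      have i2: "integrable (M n) (\<lambda>w. (cmod (P (B n w)))\<^sup>2)"
        by (rule integrable_const_bound[where B = "(\<Sum>k<Suc J. cmod (\<delta> k))\<^sup>2"]) (use P2b in auto)
      have "cmod (\<integral>w. iexp (A n w) * P (B n w) \<partial>M n) \<le> (\<integral>w. \<bar>cmod (P (B n w))\<bar> \<partial>M n)"
        by (rule order_trans[OF integral_norm_bound]) (simp add: norm_mult)
      also have "\<dots> \<le> sqrt (\<integral>w. (cmod (P (B n w)))\<^sup>2 \<partial>M n)" by (rule integral_abs_le_sqrt[OF m i2])
      also have "\<dots> < sqrt ((\<eta> / 4)\<^sup>2)"
      proof (rule real_sqrt_less_mono)
        have "\<bar>(\<integral>w. (cmod (P (B n w)))\<^sup>2 \<partial>M n) - (\<integral>x. (cmod (P (\<tau> n * x)))\<^sup>2 \<partial>std_normal_distribution)\<bar> < (\<eta> / 4)\<^sup>2 - \<epsilon>\<^sup>2 * C"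
          using N1[of n] n unfolding of_real_diff[symmetric] norm_of_real by simp
        then show "(\<integral>w. (cmod (P (B n w)))\<^sup>2 \<partial>M n) < (\<eta> / 4)\<^sup>2" using gaussP[of n] by linarith
      qed
      finally show ?thesis using \<eta> by simp
    qed
    have bG: "cmod (of_real (exp (- \<kappa> / 2)) * (\<integral>x. iexp (\<alpha> * x) * P (\<tau> n * x) \<partial>std_normal_distribution)) < \<eta> / 4"
    proof -
      have m: "(\<lambda>x. cmod (P (\<tau> n * x))) \<in> borel_measurable std_normal_distribution" by measurable
      have i2: "integrable std_normal_distribution (\<lambda>x. (cmod (P (\<tau> n * x)))\<^sup>2)"
        by (rule N.integrable_const_bound[where B = "(\<Sum>k<Suc J. cmod (\<delta> k))\<^sup>2"]) (use P2b in auto)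
      have "cmod (of_real (exp (- \<kappa> / 2)) * (\<integral>x. iexp (\<alpha> * x) * P (\<tau> n * x) \<partial>std_normal_distribution))
        \<le> 1 * cmod (\<integral>x. iexp (\<alpha> * x) * P (\<tau> n * x) \<partial>std_normal_distribution)"
        unfolding norm_mult using \<kappa> by (intro mult_right_mono) auto
      also have "\<dots> \<le> (\<integral>x. \<bar>cmod (P (\<tau> n * x))\<bar> \<partial>std_normal_distribution)"
        unfolding mult_1_left by (rule order_trans[OF integral_norm_bound]) (simp add: norm_mult)
      also have "\<dots> \<le> sqrt (\<integral>x. (cmod (P (\<tau> n * x)))\<^sup>2 \<partial>std_normal_distribution)" by (rule N.integral_abs_le_sqrt[OF m i2])
      also have "\<dots> \<le> sqrt (\<epsilon>\<^sup>2 * C)" by (rule real_sqrt_le_mono[OF gaussP])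
      also have "\<dots> < sqrt ((\<eta> / 4)\<^sup>2)" by (rule real_sqrt_less_mono[OF eC])
      finally show ?thesis using \<eta> by simp
    qed
    \<comment> \<open>Convergent polynomial part, minus the error under the given law, plus the
      error under the Gaussian law; each is at most \<open>\<eta> / 4\<close>.\<close>
    have "(\<integral>w. iexp (A n w - B n w) \<partial>M n) - of_real (exp (- (a n - 2 * b n + c n) / 2))
      = (\<Sum>j<J. c' j * ((\<integral>w. iexp (1 * A n w + (real j * \<epsilon>) * B n w) \<partial>M n)
        - of_real (exp (- (a n * 1\<^sup>2 + 2 * b n * 1 * (real j * \<epsilon>) + c n * (real j * \<epsilon>)\<^sup>2) / 2))))
      - (\<integral>w. iexp (A n w) * P (B n w) \<partial>M n) + of_real (exp (- \<kappa> / 2)) * (\<integral>x. iexp (\<alpha> * x) * P (\<tau> n * x) \<partial>std_normal_distribution)"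
      unfolding EP GP right_diff_distrib sum_subtractf by simp
    then have "norm ((\<integral>w. iexp (A n w - B n w) \<partial>M n) - of_real (exp (- (a n - 2 * b n + c n) / 2))) \<le> \<eta> / 4 + \<eta> / 4 + \<eta> / 4"
      by (simp only:) (intro order_trans[OF norm_triangle_ineq] order_trans[OF norm_triangle_ineq4] add_mono less_imp_le[OF bP] less_imp_le[OF bG] less_imp_le[OF N2]; use n in simp)
    then show ?thesis using \<eta> unfolding diff_zero by linarith
  qed
  then show "\<exists>N. \<forall>n\<ge>N. norm (((\<integral>w. iexp (A n w - B n w) \<partial>M n) - of_real (exp (- (a n - 2 * b n + c n) / 2))) - 0) < \<eta>" by blast
qed

section \<open>Inverse square roots of positive definite matrices\<close>

lemma matrix_diff_distrib:
  fixes A B C :: "real^'n^'n"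
  shows "A ** (B - C) = A ** B - A ** C" "(A - B) ** C = A ** C - B ** C"
  by (simp_all add: vec_eq_iff matrix_matrix_mult_def algebra_simps sum_subtractf)

lemma symmetric_matrix_inner:
  fixes A :: "real^'n^'n"
  assumes "transpose A = A" shows "(A *v x) \<bullet> y = x \<bullet> (A *v y)"
  by (metis assms dot_lmul_matrix transpose_matrix_vector)

lemma transpose_eqI:
  fixes A :: "real^'n^'n"
  assumes "\<And>x y. (A *v x) \<bullet> y = x \<bullet> (A *v y)" shows "transpose A = A"
proof -
  have "(transpose A *v x) \<bullet> y = (A *v x) \<bullet> y" for x y
    using assms by (simp add: transpose_matrix_vector dot_lmul_matrix)
  then have "transpose A *v x = A *v x" for x by (metis vector_eq_rdot)
  then show ?thesis by (simp add: matrix_eq)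
qed

lemma matrix_inv_eqI:
  fixes A B :: "real^'n^'n"
  assumes "A ** B = mat 1" shows "matrix_inv A = B"
proof -
  have BA: "B ** A = mat 1" using assms matrix_left_right_inverse by blast
  then have "A ** matrix_inv A = mat 1 \<and> matrix_inv A ** A = mat 1"
    unfolding matrix_inv_def using assms someI[of "\<lambda>A'. A ** A' = mat 1 \<and> A' ** A = mat 1" B] by blast
  then show ?thesis using BA by (metis matrix_mul_assoc matrix_mul_lid matrix_mul_rid)
qed

lemma coercive_invertible:
  fixes A :: "real^'n^'n"
  assumes "a > 0" "\<And>v. a * (v \<bullet> v) \<le> v \<bullet> (A *v v)"
  shows "A ** matrix_inv A = mat 1" "matrix_inv A ** A = mat 1"
proof -
  have "x = 0" if "A *v x = 0" for x
  proof -
    have "x \<bullet> x \<le> 0" using assms(2)[of x] that assms(1) by (simp add: mult_le_0_iff)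
    then have "x \<bullet> x = 0" using inner_ge_zero[of x] by linarith
    then show ?thesis by simp
  qed
  then obtain B where B: "B ** A = mat 1" using matrix_left_invertible_ker[of A] by blast
  then have "A ** B = mat 1" using matrix_left_right_inverse by blast
  then show "A ** matrix_inv A = mat 1" "matrix_inv A ** A = mat 1" using B matrix_inv_eqI by metis+
qed

lemma coercive_inverse_bound:
  fixes A :: "real^'n^'n"
  assumes a: "a > 0" "\<And>v. a * (v \<bullet> v) \<le> v \<bullet> (A *v v)"
  shows "norm (matrix_inv A *v w) \<le> norm w / a"
proof -
  let ?v = "matrix_inv A *v w"
  have "A *v ?v = w" using coercive_invertible(1)[OF a] by (simp add: matrix_vector_mul_assoc)
  then have "a * (norm ?v * norm ?v) \<le> norm ?v * norm w"
    using a(2)[of ?v] norm_cauchy_schwarz[of ?v w] by (simp add: norm_eq_sqrt_inner)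
  then have "norm ?v * (a * norm ?v) \<le> norm ?v * norm w" by (simp add: mult_ac)
  then have "a * norm ?v \<le> norm w"
    by (cases "norm ?v = 0") auto
  then show ?thesis using a by (simp add: field_simps)
qed

text \<open>The minimum of the quadratic form over the compact unit sphere, extended by homogeneity,
  plays the role of the smallest eigenvalue.\<close>

lemma pos_def_bounds:
  fixes A :: "real^'n^'n"
  assumes "pos_def A"
  obtains a b where "0 < a" "0 < b" "\<And>v. a * (v \<bullet> v) \<le> v \<bullet> (A *v v)" "\<And>v. v \<bullet> (A *v v) \<le> b * (v \<bullet> v)"
    "\<And>v. norm (A *v v) \<le> b * norm v"
proof -
  have c: "continuous_on (sphere 0 1) (\<lambda>v. v \<bullet> (A *v v))"
    by (intro continuous_intros linear_continuous_on matrix_vector_mul_bounded_linear)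
  have "axis (undefined :: 'n) 1 \<in> sphere (0 :: real^'n) 1" by (simp add: norm_axis_1)
  then have "sphere (0 :: real^'n) 1 \<noteq> {}" by (rule ex_in_conv[THEN iffD1, OF exI])
  then obtain u where u: "u \<in> sphere 0 1" "\<And>v. v \<in> sphere 0 1 \<Longrightarrow> u \<bullet> (A *v u) \<le> v \<bullet> (A *v v)"
    using continuous_attains_inf[OF compact_sphere _ c] by blast
  let ?a = "u \<bullet> (A *v u)"
  have "u \<noteq> 0" using u by auto
  then have a: "?a > 0" using assms by (simp add: pos_def_def)
  have low: "?a * (v \<bullet> v) \<le> v \<bullet> (A *v v)" for v
  proof (cases "v = 0")
    case False
    have "?a \<le> (v /\<^sub>R norm v) \<bullet> (A *v (v /\<^sub>R norm v))"
      by (intro u(2)) (use False in simp)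
    also have "\<dots> = (v \<bullet> (A *v v)) / (v \<bullet> v)"
      using False by (simp add: matrix_vector_mult_scaleR dot_square_norm power2_eq_square divide_inverse)
    finally show ?thesis using False by (simp add: pos_le_divide_eq)
  qed simp
  obtain B where B: "B > 0" "\<And>v. norm (A *v v) \<le> norm v * B"
    using bounded_linear.pos_bounded[OF matrix_vector_mul_bounded_linear[of A]] by auto
  show thesis
  proof (rule that[OF a B(1) low])
    show "norm (A *v v) \<le> B * norm v" for v using B(2)[of v] by (simp add: mult.commute)
    fix v
    have "v \<bullet> (A *v v) \<le> norm v * norm (A *v v)" by (rule norm_cauchy_schwarz)
    also have "\<dots> \<le> norm v * (norm v * B)" by (intro mult_left_mono B) auto
    finally show "v \<bullet> (A *v v) \<le> B * (v \<bullet> v)" by (simp add: dot_square_norm power2_eq_square mult_ac)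
  qed
qed

lemma pos_def_inverse:
  fixes A :: "real^'n^'n"
  assumes "pos_def A" shows "pos_def (matrix_inv A)"
proof -
  obtain a where a: "a > 0" "\<And>v. a * (v \<bullet> v) \<le> v \<bullet> (A *v v)"
    by (rule pos_def_bounds[OF assms]) blast
  note inv = coercive_invertible[OF a]
  have sym: "transpose A = A" using assms by (simp add: pos_def_def)
  have Ai: "A *v (matrix_inv A *v w) = w" for w using inv by (simp add: matrix_vector_mul_assoc)
  show ?thesis unfolding pos_def_def
  proof (intro conjI allI impI transpose_eqI)
    fix x y
    show "(matrix_inv A *v x) \<bullet> y = x \<bullet> (matrix_inv A *v y)"
      using symmetric_matrix_inner[OF sym, of "matrix_inv A *v x" "matrix_inv A *v y"] by (simp add: Ai)
  next
    fix v :: "real^'n" assume "v \<noteq> 0"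
    then have "matrix_inv A *v v \<noteq> 0" using Ai[of v] by auto
    then have "(matrix_inv A *v v) \<bullet> (A *v (matrix_inv A *v v)) > 0" using assms by (simp add: pos_def_def)
    then show "v \<bullet> (matrix_inv A *v v) > 0" by (simp add: Ai inner_commute)
  qed
qed

text \<open>The norm of nested vectors is the Frobenius norm. Written by columns it controls
  products with a factor on the left, written by rows products with a factor on the right.\<close>

lemma norm_matrix_columns: "(norm (D :: real^'n^'n))\<^sup>2 = (\<Sum>k\<in>UNIV. (norm (column k D))\<^sup>2)"
  unfolding power2_norm_eq_inner inner_vec_def column_def by (simp add: inner_vec_def) (rule sum.swap)

lemma norm_matrix_rows: "(norm (D :: real^'n^'n))\<^sup>2 = (\<Sum>k\<in>UNIV. (norm (D $ k))\<^sup>2)"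
  unfolding power2_norm_eq_inner by (simp add: inner_vec_def)

lemma column_matrix_mult: "column k (S ** D) = S *v column k (D :: real^'n^'n)"
  by (simp add: vec_eq_iff column_def matrix_matrix_mult_def matrix_vector_mult_def)

lemma row_matrix_mult: "(D ** S) $ i = transpose S *v (D $ i)" for D :: "real^'n^'n"
  by (simp add: vec_eq_iff transpose_def matrix_matrix_mult_def matrix_vector_mult_def mult.commute)

lemma norm_matrix_mult_left:
  fixes P Q :: "real^'n^'n"
  assumes "k \<ge> 0" "\<And>v. norm (P *v v) \<le> k * norm v"
  shows "norm (P ** Q) \<le> k * norm Q"
proof (rule power2_le_imp_le)
  show "(norm (P ** Q))\<^sup>2 \<le> (k * norm Q)\<^sup>2"
    unfolding norm_matrix_columns column_matrix_mult power_mult_distrib sum_distrib_left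
    using assms by (intro sum_mono) (simp add: power_mono flip: power_mult_distrib)
qed (use assms in auto)

lemma norm_matrix_mult_right:
  fixes P Q :: "real^'n^'n"
  assumes "k \<ge> 0" "\<And>v. norm (transpose P *v v) \<le> k * norm v"
  shows "norm (Q ** P) \<le> k * norm Q"
proof (rule power2_le_imp_le)
  show "(norm (Q ** P))\<^sup>2 \<le> (k * norm Q)\<^sup>2"
    unfolding norm_matrix_rows row_matrix_mult power_mult_distrib sum_distrib_left
    using assms by (intro sum_mono) (simp add: power_mono flip: power_mult_distrib)
qed (use assms in auto)

text \<open>With \<open>D = S - S'\<close> one has \<open>S D + D S' = S\<^sup>2 - S'\<^sup>2\<close>; pairing this with \<open>D\<close> in the Frobenius inner product
  bounds \<open>D\<close>, without any spectral decomposition.\<close>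
lemma norm_diff_le_norm_diff_squares:
  fixes S S' :: "real^'n^'n"
  assumes S': "transpose S' = S'"
    and b: "\<And>v. \<mu> * (v \<bullet> v) \<le> v \<bullet> (S *v v)" "\<And>v. \<mu>' * (v \<bullet> v) \<le> v \<bullet> (S' *v v)"
  shows "(\<mu> + \<mu>') * norm (S - S') \<le> norm (S ** S - S' ** S')"
proof -
  define D where "D = S - S'"
  have eq: "S ** D + D ** S' = S ** S - S' ** S'"
    by (simp add: D_def matrix_diff_distrib)
  have ip: "X \<bullet> Y = (\<Sum>k\<in>UNIV. column k X \<bullet> column k Y)" for X Y :: "real^'n^'n"
    by (simp add: inner_vec_def column_def) (rule sum.swap)
  \<comment> \<open>Left multiplication acts on columns and right multiplication on rows, so the
    coercivity of \<open>S\<close> and of \<open>S'\<close> applies vector by vector.\<close>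
  have "\<mu> * (D \<bullet> D) \<le> D \<bullet> (S ** D)"
    unfolding ip column_matrix_mult sum_distrib_left by (intro sum_mono b)
  moreover have "\<mu>' * (D \<bullet> D) \<le> D \<bullet> (D ** S')"
    unfolding inner_vec_def[of D] row_matrix_mult S' sum_distrib_left by (intro sum_mono b)
  ultimately have "(\<mu> + \<mu>') * (D \<bullet> D) \<le> D \<bullet> (S ** S - S' ** S')"
    unfolding eq[symmetric] by (simp add: algebra_simps inner_add_right)
  also have "\<dots> \<le> norm D * norm (S ** S - S' ** S')" by (rule norm_cauchy_schwarz)
  finally have "norm D * ((\<mu> + \<mu>') * norm D) \<le> norm D * norm (S ** S - S' ** S')"
    by (simp add: dot_square_norm power2_eq_square mult_ac)
  then show ?thesis unfolding D_def[symmetric]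
    by (cases "norm D = 0") auto
qed

section \<open>Uniqueness and existence of the positive definite square root\<close>

lemma pos_def_sqrt_unique:
  fixes S S' :: "real^'n^'n"
  assumes "pos_def S" "pos_def S'" "S ** S = S' ** S'" shows "S = S'"
proof -
  obtain a b where "a > 0" "\<And>v. a * (v \<bullet> v) \<le> v \<bullet> (S *v v)" by (rule pos_def_bounds[OF assms(1)]) blast
  moreover obtain a' b' where "a' > 0" "\<And>v. a' * (v \<bullet> v) \<le> v \<bullet> (S' *v v)" by (rule pos_def_bounds[OF assms(2)]) blast
  moreover have "transpose S' = S'" using assms by (simp add: pos_def_def)
  ultimately have "(a + a') * norm (S - S') \<le> norm (S ** S - S' ** S')" and "a + a' > 0"
    by (auto intro: norm_diff_le_norm_diff_squares)
  then have "norm (S - S') \<le> 0" using assms(3) by (simp add: mult_le_0_iff)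
  then show ?thesis by simp
qed

text \<open>The square root of \<open>1 - E\<close> is \<open>1 - X\<close> for the fixed point \<open>X\<close> of the contraction
  \<open>X \<mapsto> (E + X\<^sup>2) / 2\<close> on the ball of radius \<open>norm E\<close>.\<close>
lemma pos_def_sqrt_exists:
  fixes A :: "real^'n^'n"
  assumes "pos_def A" shows "\<exists>S. pos_def S \<and> S ** S = A"
proof -
  obtain l b where lb: "0 < l" "0 < b" "\<And>v. l * (v \<bullet> v) \<le> v \<bullet> (A *v v)" "\<And>v. norm (A *v v) \<le> b * norm v"
    by (rule pos_def_bounds[OF assms]) blast
  have sym: "transpose A = A" using assms by (simp add: pos_def_def)
  define K where "K = max l b"
  have K: "K > 0" "l \<le> K" "\<And>v. norm (A *v v) \<le> K * norm v"
    using lb(1,2) by (auto simp: K_def intro!: order_trans[OF lb(4)] mult_right_mono)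
  \<comment> \<open>This scale minimizes the bound for the squared norm of
    \<open>v - A v / s\<close>, with relative value \<open>1 - (l / K)\<^sup>2\<close>; thus
    \<open>E\<close> is a strict contraction.\<close>
  define s where "s = K\<^sup>2 / l"
  have s: "s > 0" using K lb by (simp add: s_def)
  define q where "q = sqrt (1 - (l / K)\<^sup>2)"
  have lK: "0 < l / K" "l / K \<le> 1" using K lb by auto
  have lK2: "(l / K)\<^sup>2 \<le> 1" "0 < (l / K)\<^sup>2" using lK power_le_one[of "l / K" 2] by (auto simp only: zero_less_power)
  have q: "0 \<le> q" "q < 1" "q\<^sup>2 = 1 - (l / K)\<^sup>2" using lK2 by (auto simp: q_def)
  define E :: "(real^'n) \<Rightarrow>\<^sub>L (real^'n)" where "E = id_blinfun - Blinfun ((*v) A) /\<^sub>R s"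
  have E: "blinfun_apply E v = v - (A *v v) /\<^sub>R s" for v
    by (simp add: E_def minus_blinfun.rep_eq scaleR_blinfun.rep_eq bounded_linear_Blinfun_apply matrix_vector_mul_bounded_linear)
  have nE: "norm E \<le> q"
  proof (rule norm_blinfun_bound[OF q(1)])
    fix v
    have "(norm (blinfun_apply E v))\<^sup>2 = v \<bullet> v - 2 / s * (v \<bullet> (A *v v)) + (norm (A *v v))\<^sup>2 / s\<^sup>2"
      unfolding E power2_norm_eq_inner
      by (simp add: inner_diff_left inner_diff_right inner_commute algebra_simps power2_eq_square divide_inverse)
    also have "\<dots> \<le> v \<bullet> v - 2 / s * (l * (v \<bullet> v)) + (K * norm v)\<^sup>2 / s\<^sup>2"
      using s lb K by (intro add_mono diff_mono order_refl mult_left_mono divide_right_mono power_mono) auto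
    also have "\<dots> = q\<^sup>2 * (v \<bullet> v)"
    proof -
      have c: "2 / s * l = 2 * (l / K)\<^sup>2" "K\<^sup>2 / s\<^sup>2 = (l / K)\<^sup>2"
        using K lb by (simp_all add: s_def field_simps power2_eq_square)
      have "v \<bullet> v - 2 / s * (l * (v \<bullet> v)) + (K * norm v)\<^sup>2 / s\<^sup>2 = v \<bullet> v - (2 / s * l) * (v \<bullet> v) + (K\<^sup>2 / s\<^sup>2) * (v \<bullet> v)"
        by (simp add: power_mult_distrib dot_square_norm)
      then show ?thesis unfolding c q(3) by (simp add: left_diff_distrib)
    qed
    finally have "(norm (blinfun_apply E v))\<^sup>2 \<le> (q * norm v)\<^sup>2"
      unfolding power_mult_distrib dot_square_norm .
    then show "norm (blinfun_apply E v) \<le> q * norm v"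
      by (rule power2_le_imp_le) (use q(1) in simp)
  qed
  define sym_on where "sym_on X \<longleftrightarrow> (\<forall>u v. blinfun_apply X u \<bullet> v = u \<bullet> blinfun_apply X v)" for X :: "(real^'n) \<Rightarrow>\<^sub>L (real^'n)"
  define F where "F X = (E + (X o\<^sub>L X)) /\<^sub>R 2" for X
  \<comment> \<open>Symmetry is a closed condition preserved by \<open>F\<close>, so the fixed point
    inherits it.\<close>
  define B where "B = cball 0 q \<inter> {X. sym_on X}"
  have symE: "sym_on E" unfolding sym_on_def E
    using symmetric_matrix_inner[OF sym] by (simp add: inner_diff_left inner_diff_right)
  have "closed {X. sym_on X}"
    unfolding sym_on_def
    by (intro closed_Collect_all closed_Collect_eq continuous_intros)
  then have cB: "Topological_Spaces.complete B" unfolding B_def complete_eq_closed by (intro closed_Int closed_cball)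
  have FB: "F ` B \<subseteq> B"
  proof (rule image_subsetI)
    fix X assume "X \<in> B"
    then have X: "norm X \<le> q" "sym_on X" by (auto simp: B_def)
    have "norm (F X) \<le> (norm E + norm X * norm X) / 2"
      unfolding F_def by (simp add: order_trans[OF norm_triangle_ineq] norm_blinfun_compose add_left_mono)
    also have "\<dots> \<le> (q + q * 1) / 2" using nE X q by (intro divide_right_mono add_mono mult_mono) auto
    finally have "norm (F X) \<le> q" by simp
    moreover have "sym_on (F X)"
      using symE X(2) unfolding sym_on_def F_def
      by (simp add: plus_blinfun.rep_eq scaleR_blinfun.rep_eq inner_add_left inner_add_right)
    ultimately show "F X \<in> B" by (simp add: B_def)
  qed
  have lip: "dist (F X) (F Y) \<le> q * dist X Y" if "X \<in> B" "Y \<in> B" for X Y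
  proof -
    have n: "norm X \<le> q" "norm Y \<le> q" using that by (auto simp: B_def)
    have "F X - F Y = ((X o\<^sub>L (X - Y)) + ((X - Y) o\<^sub>L Y)) /\<^sub>R 2"
      unfolding F_def by (rule blinfun_eqI)
        (simp add: plus_blinfun.rep_eq scaleR_blinfun.rep_eq minus_blinfun.rep_eq blinfun.diff_right algebra_simps)
    then have "dist (F X) (F Y) \<le> (norm X * norm (X - Y) + norm (X - Y) * norm Y) / 2"
      unfolding dist_norm by (simp add: order_trans[OF norm_triangle_ineq] norm_blinfun_compose add_mono)
    also have "\<dots> \<le> (q * norm (X - Y) + norm (X - Y) * q) / 2"
      using n q(1) by (intro divide_right_mono add_mono mult_mono) auto
    finally show ?thesis by (simp add: dist_norm)
  qed
  have "0 \<in> B" using q by (simp add: B_def sym_on_def)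
  then obtain X where X: "X \<in> B" "F X = X"
    using Banach_fix[OF cB _ q(1,2) FB lip] by blast
  have XX: "blinfun_apply X (blinfun_apply X v) = 2 *\<^sub>R blinfun_apply X v - blinfun_apply E v" for v
  proof -
    have "blinfun_apply (F X) v = blinfun_apply X v" using X by simp
    then have "2 *\<^sub>R blinfun_apply X v = blinfun_apply E v + blinfun_apply X (blinfun_apply X v)"
      unfolding F_def by (simp add: plus_blinfun.rep_eq scaleR_blinfun.rep_eq) (metis scaleR_half_double scaleR_2 scaleR_right_distrib)
    then show ?thesis by simp
  qed
  \<comment> \<open>The fixed-point equation reads \<open>X\<^sup>2 = 2 X - E\<close>, hence
    \<open>(1 - X)\<^sup>2 = 1 - E = A / s\<close>.\<close>
  define f where "f v = sqrt s *\<^sub>R (v - blinfun_apply X v)" for v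
  have linf: "linear f"
    unfolding f_def by (intro bounded_linear.linear bounded_linear_intros)
  have fS: "matrix f *v v = f v" for v using matrix_vector_mul(2)[OF linf] by (rule fun_cong)
  have ff: "f (f v) = A *v v" for v
  proof -
    have "f (f v) = (sqrt s * sqrt s) *\<^sub>R (v - 2 *\<^sub>R blinfun_apply X v + blinfun_apply X (blinfun_apply X v))"
      unfolding f_def by (simp add: blinfun.diff_right blinfun.scaleR_right scaleR_diff_right algebra_simps scaleR_2)
    also have "\<dots> = s *\<^sub>R ((A *v v) /\<^sub>R s)" unfolding XX E using s by simp
    finally show ?thesis using s by simp
  qed
  have Xs: "sym_on X" "norm X \<le> q" using X by (auto simp: B_def)
  show ?thesis
  proof (intro exI conjI)
    show "matrix f ** matrix f = A"
      by (simp add: matrix_eq fS ff flip: matrix_vector_mul_assoc)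
    show "pos_def (matrix f)" unfolding pos_def_def
    proof (intro conjI transpose_eqI allI impI)
      show "(matrix f *v x) \<bullet> y = x \<bullet> (matrix f *v y)" for x y
        using Xs(1) unfolding fS f_def sym_on_def by (simp add: inner_diff_left inner_diff_right)
      fix v :: "real^'n" assume v: "v \<noteq> 0"
      have "v \<bullet> blinfun_apply X v \<le> norm v * (norm X * norm v)"
        by (rule order_trans[OF norm_cauchy_schwarz]) (intro mult_left_mono norm_blinfun; simp)
      also have "\<dots> \<le> norm v * (q * norm v)" by (intro mult_left_mono mult_right_mono Xs) auto
      also have "\<dots> < norm v * (1 * norm v)" using v q by (intro mult_strict_left_mono mult_strict_right_mono) auto
      finally have "v \<bullet> blinfun_apply X v < v \<bullet> v" by (simp add: dot_square_norm power2_eq_square)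
      then show "v \<bullet> (matrix f *v v) > 0" unfolding fS f_def using s by (simp add: inner_diff_right)
    qed
  qed
qed

lemma inv_sqrtm_spec:
  fixes A :: "real^'n^'n"
  assumes "pos_def A" shows "pos_def (inv_sqrtm A)" "inv_sqrtm A ** inv_sqrtm A = matrix_inv A"
proof -
  have "\<exists>!S. pos_def S \<and> S ** S = matrix_inv A"
    using pos_def_sqrt_exists[OF pos_def_inverse[OF assms]] pos_def_sqrt_unique by metis
  from theI'[OF this] show "pos_def (inv_sqrtm A)" "inv_sqrtm A ** inv_sqrtm A = matrix_inv A"
    using assms by (simp_all add: inv_sqrtm_def)
qed

section \<open>Lipschitz continuity and measurability of the inverse square root\<close>

definition spectrum_between :: "real \<Rightarrow> real \<Rightarrow> real^'n^'n \<Rightarrow> bool" where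
  "spectrum_between a b A \<longleftrightarrow> transpose A = A \<and> (\<forall>v. a * (v \<bullet> v) \<le> v \<bullet> (A *v v) \<and> v \<bullet> (A *v v) \<le> b * (v \<bullet> v))"

lemma spectrum_between_pos_def: "a > 0 \<Longrightarrow> spectrum_between a b A \<Longrightarrow> pos_def A"
  unfolding spectrum_between_def pos_def_def by (metis inner_gt_zero_iff less_le_trans mult_pos_pos)

lemma inv_sqrtm_facts:
  fixes A :: "real^'n^'n"
  assumes "pos_def A"
  shows "inv_sqrtm A *v (A *v (inv_sqrtm A *v v)) = v" "inv_sqrtm A *v (inv_sqrtm A *v (A *v v)) = v"
    "(inv_sqrtm A *v v) \<bullet> w = v \<bullet> (inv_sqrtm A *v w)"
proof -
  obtain a where a: "a > 0" "\<And>v. a * (v \<bullet> v) \<le> v \<bullet> (A *v v)" by (rule pos_def_bounds[OF assms]) blast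
  note s = inv_sqrtm_spec[OF assms]
  have 1: "inv_sqrtm A ** (inv_sqrtm A ** A) = mat 1"
    using s(2) coercive_invertible(2)[OF a] by (simp add: matrix_mul_assoc)
  then have 2: "(inv_sqrtm A ** A) ** inv_sqrtm A = mat 1" using matrix_left_right_inverse by blast
  show "inv_sqrtm A *v (inv_sqrtm A *v (A *v v)) = v" using 1 by (simp add: matrix_vector_mul_assoc matrix_mul_assoc)
  show "inv_sqrtm A *v (A *v (inv_sqrtm A *v v)) = v" using 2 by (simp add: matrix_vector_mul_assoc matrix_mul_assoc)
  show "(inv_sqrtm A *v v) \<bullet> w = v \<bullet> (inv_sqrtm A *v w)"
    using s(1) by (intro symmetric_matrix_inner) (simp add: pos_def_def)
qed

lemma pos_def_cauchy_schwarz: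
  fixes S :: "real^'n^'n"
  assumes "pos_def S"
  shows "(x \<bullet> (S *v y))\<^sup>2 \<le> (x \<bullet> (S *v x)) * (y \<bullet> (S *v y))"
proof (cases "y = 0")
  case False
  let ?b = "x \<bullet> (S *v y)" let ?c = "y \<bullet> (S *v y)" let ?t = "?b / ?c"
  have c: "?c > 0" using assms False by (simp add: pos_def_def)
  have nn: "v \<bullet> (S *v v) \<ge> 0" for v using assms by (cases "v = 0") (auto simp: pos_def_def intro: less_imp_le)
  have yx: "y \<bullet> (S *v x) = ?b"
    using assms symmetric_matrix_inner[of S y x] by (simp add: pos_def_def inner_commute)
  have "0 \<le> (x - ?t *\<^sub>R y) \<bullet> (S *v (x - ?t *\<^sub>R y))" by (rule nn)
  also have "\<dots> = x \<bullet> (S *v x) - 2 * ?t * ?b + ?t\<^sup>2 * ?c"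
    by (simp add: matrix_vector_mult_diff_distrib matrix_vector_mult_scaleR inner_diff_left inner_diff_right yx
        power2_eq_square algebra_simps)
  also have "\<dots> = x \<bullet> (S *v x) - ?b\<^sup>2 / ?c" using c by (simp add: power2_eq_square field_simps)
  finally show ?thesis using c by (simp add: field_simps)
qed simp

text \<open>With \<open>S = inv_sqrtm A\<close>, the vector \<open>y = S *v (A *v v)\<close>
  satisfies \<open>S *v y = v\<close> and \<open>y \<bullet> y = v \<bullet> (A *v v)\<close>, so
  its norm is at most \<open>sqrt b * norm v\<close>. The Cauchy-Schwarz inequality for the form of
  \<open>S\<close>, applied to \<open>v\<close> and \<open>y\<close>, then bounds
  \<open>v \<bullet> (S *v v)\<close> from below.\<close>

lemma inv_sqrtm_lower:
  fixes A :: "real^'n^'n"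
  assumes a: "a > 0" and A: "spectrum_between a b A"
  shows "1 / sqrt b * (v \<bullet> v) \<le> v \<bullet> (inv_sqrtm A *v v)"
proof (cases "v = 0")
  case False
  have pd: "pos_def A" using spectrum_between_pos_def[OF a A] .
  let ?S = "inv_sqrtm A"
  let ?y = "?S *v (A *v v)"
  have "0 < a * (v \<bullet> v)" using a False by simp
  also have "\<dots> \<le> b * (v \<bullet> v)" using A unfolding spectrum_between_def by (meson order_trans)
  finally have b: "b > 0" using False zero_less_mult_pos2[of b "v \<bullet> v"] by simp
  have Sy: "?S *v ?y = v" using inv_sqrtm_facts[OF pd] by simp
  have yy: "?y \<bullet> ?y = v \<bullet> (A *v v)"
    using inv_sqrtm_facts(3)[OF pd, of "A *v v" ?y] by (simp add: Sy inner_commute)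
  have "norm ?y \<le> sqrt b * norm v"
    using A yy b unfolding spectrum_between_def norm_eq_sqrt_inner by (metis real_sqrt_le_iff real_sqrt_mult)
  then have yv: "v \<bullet> ?y \<le> sqrt b * (v \<bullet> v)"
    using norm_cauchy_schwarz[of v ?y] mult_left_mono[of "norm ?y" "sqrt b * norm v" "norm v"]
    by (simp add: dot_square_norm power2_eq_square mult_ac)
  have vSv: "v \<bullet> (?S *v v) \<ge> 0" using inv_sqrtm_spec(1)[OF pd] False by (auto simp: pos_def_def intro: less_imp_le)
  have "(v \<bullet> v)\<^sup>2 \<le> (v \<bullet> (?S *v v)) * (?y \<bullet> v)"
    using pos_def_cauchy_schwarz[OF inv_sqrtm_spec(1)[OF pd], of v ?y] by (simp add: Sy)
  also have "\<dots> \<le> (v \<bullet> (?S *v v)) * (sqrt b * (v \<bullet> v))"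
    using yv vSv by (intro mult_left_mono) (auto simp: inner_commute)
  finally have "(v \<bullet> v) * (v \<bullet> v) \<le> (v \<bullet> v) * (sqrt b * (v \<bullet> (?S *v v)))"
    by (simp add: power2_eq_square mult_ac)
  then have "v \<bullet> v \<le> sqrt b * (v \<bullet> (?S *v v))" using False mult_le_cancel_left_pos[of "v \<bullet> v"] by simp
  then show ?thesis using b by (simp add: field_simps)
qed simp

text \<open>The inverses differ by \<open>matrix_inv A ** (B - A) ** matrix_inv B\<close>, which
  gives \<open>1 / a\<^sup>2\<close>. Their square roots are both coercive with constant
  \<open>1 / sqrt b\<close>, so the comparison with squares adds the factor
  \<open>sqrt b / 2\<close>.\<close>

lemma inv_sqrtm_lipschitz:
  fixes A B :: "real^'n^'n"
  assumes a: "a > 0" and A: "spectrum_between a b A" and B: "spectrum_between a b B" and b: "b > 0"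
  shows "norm (inv_sqrtm A - inv_sqrtm B) \<le> sqrt b / (2 * a\<^sup>2) * norm (A - B)"
proof -
  have pA: "pos_def A" and pB: "pos_def B" using spectrum_between_pos_def a A B by auto
  have cA: "a * (v \<bullet> v) \<le> v \<bullet> (A *v v)" and cB: "a * (v \<bullet> v) \<le> v \<bullet> (B *v v)" for v
    using A B by (auto simp: spectrum_between_def)
  have "matrix_inv A - matrix_inv B = matrix_inv A ** ((B - A) ** matrix_inv B)"
    using coercive_invertible[OF a cA] coercive_invertible[OF a cB]
    by (simp add: matrix_diff_distrib matrix_mul_assoc)
  also have "norm \<dots> \<le> 1 / a * norm ((B - A) ** matrix_inv B)"
    using coercive_inverse_bound[OF a cA] a by (intro norm_matrix_mult_left) auto
  also have "\<dots> \<le> 1 / a * (1 / a * norm (B - A))"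
    using coercive_inverse_bound[OF a cB] a pos_def_inverse[OF pB]
    by (intro mult_left_mono norm_matrix_mult_right) (auto simp: pos_def_def)
  finally have inv: "norm (matrix_inv A - matrix_inv B) \<le> 1 / a\<^sup>2 * norm (A - B)"
    by (simp add: power2_eq_square norm_minus_commute)
  have "(1 / sqrt b + 1 / sqrt b) * norm (inv_sqrtm A - inv_sqrtm B)
      \<le> norm (inv_sqrtm A ** inv_sqrtm A - inv_sqrtm B ** inv_sqrtm B)"
    using inv_sqrtm_spec(1)[OF pB]
    by (intro norm_diff_le_norm_diff_squares inv_sqrtm_lower[OF a A] inv_sqrtm_lower[OF a B]) (simp add: pos_def_def)
  also have "\<dots> \<le> 1 / a\<^sup>2 * norm (A - B)" using inv inv_sqrtm_spec(2)[OF pA] inv_sqrtm_spec(2)[OF pB] by simp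
  finally show ?thesis using b a by (simp add: field_simps)
qed

text \<open>The positive definite matrices are a countable union of closed sets on each of which the
  map is Lipschitz; elsewhere it is zero by convention.\<close>

lemma inv_sqrtm_measurable [measurable]: "(inv_sqrtm :: real^'n^'n \<Rightarrow> _) \<in> borel_measurable borel"
proof -
  define F where "F k = {A :: real^'n^'n. spectrum_between (1 / real (Suc k)) (real (Suc k)) A}" for k
  have clF: "closed (F k)" for k
  proof -
    have c: "continuous_on UNIV (\<lambda>A :: real^'n^'n. v \<bullet> (A *v v))" for v
      unfolding matrix_vector_mult_def inner_vec_def by (intro continuous_intros)
    have t: "continuous_on UNIV (\<lambda>A :: real^'n^'n. transpose A)"
      unfolding transpose_def by (intro continuous_intros)
    show ?thesis unfolding F_def spectrum_between_def
      by (intro closed_Collect_conj closed_Collect_all closed_Collect_eq closed_Collect_le t c continuous_intros)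
  qed
  have cont: "continuous_on (F k) inv_sqrtm" for k
  proof -
    let ?L = "sqrt (real (Suc k)) / (2 * (1 / real (Suc k))\<^sup>2)"
    have "?L-lipschitz_on (F k) inv_sqrtm"
    proof (rule lipschitz_onI)
      fix A B assume "A \<in> F k" "B \<in> F k"
      then show "dist (inv_sqrtm A) (inv_sqrtm B) \<le> ?L * dist A B"
        unfolding dist_norm F_def mem_Collect_eq by (intro inv_sqrtm_lipschitz) simp_all
    qed simp
    then show ?thesis by (rule lipschitz_on_continuous_on)
  qed
  have UF: "pos_def A \<longleftrightarrow> A \<in> (\<Union>k. F k)" for A :: "real^'n^'n"
  proof
    assume "pos_def A"
    then obtain a b where ab: "0 < a" "0 < b" "\<And>v. a * (v \<bullet> v) \<le> v \<bullet> (A *v v)" "\<And>v. v \<bullet> (A *v v) \<le> b * (v \<bullet> v)"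
      by (rule pos_def_bounds) blast
    obtain k1 :: nat where k1: "1 / a \<le> real k1" using real_arch_simple by blast
    obtain k2 :: nat where k2: "b \<le> real k2" using real_arch_simple by blast
    define k where "k = max k1 k2"
    have "1 / a \<le> real (Suc k)" "b \<le> real (Suc k)" using k1 k2 by (auto simp: k_def)
    then have k: "1 / real (Suc k) \<le> a" "b \<le> real (Suc k)" using ab by (auto simp: field_simps)
    have "A \<in> F k" unfolding F_def spectrum_between_def mem_Collect_eq
    proof (intro conjI allI)
      show "transpose A = A" using \<open>pos_def A\<close> by (simp add: pos_def_def)
      show "1 / real (Suc k) * (v \<bullet> v) \<le> v \<bullet> (A *v v)" for v
        using mult_right_mono[OF k(1), of "v \<bullet> v"] ab(3)[of v] by (meson inner_ge_zero order_trans)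
      show "v \<bullet> (A *v v) \<le> real (Suc k) * (v \<bullet> v)" for v
        using mult_right_mono[OF k(2), of "v \<bullet> v"] ab(4)[of v] by (meson inner_ge_zero order_trans)
    qed
    then show "A \<in> (\<Union>k. F k)" by blast
  next
    assume "A \<in> (\<Union>k. F k)"
    then show "pos_def A" by (auto simp: F_def intro: spectrum_between_pos_def[rotated])
  qed
  show ?thesis
  proof (rule measurable_piecewise_restrict[where C = "insert (- (\<Union>k. F k)) (range F)"])
    fix \<Omega> assume "\<Omega> \<in> insert (- (\<Union>k. F k)) (range F)"
    then consider "\<Omega> = - (\<Union>k. F k)" | k where "\<Omega> = F k" by blast
    then show "inv_sqrtm \<in> borel_measurable (restrict_space borel \<Omega>)"
    proof cases
      case 1
      have "inv_sqrtm A = mat 0" if "A \<in> \<Omega>" for A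
        using that UF[of A] unfolding 1 inv_sqrtm_def by simp
      then show ?thesis by (subst measurable_cong[where g = "\<lambda>_. mat 0"]) (auto simp: space_restrict_space)
    next
      case 2
      show ?thesis unfolding 2 by (intro borel_measurable_continuous_on_restrict cont)
    qed
    have [measurable]: "F k \<in> sets borel" for k using clF by (rule borel_closed)
    show "\<Omega> \<inter> space borel \<in> sets borel"
      using \<open>\<Omega> \<in> _\<close> by auto
  qed auto
qed

section \<open>Continuity theorem for the standard normal law on vectors\<close>

lemma vec_nth_basis_sum: "(\<Sum>b\<in>Basis. f b *\<^sub>R b) $ k = f (axis k 1)" for f :: "real^'p \<Rightarrow> real"
proof -
  have "(\<Sum>b\<in>Basis. f b *\<^sub>R b) $ k = (\<Sum>b\<in>Basis. f b *\<^sub>R b) \<bullet> axis k 1" by (simp add: inner_axis)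
  also have "\<dots> = f (axis k 1)" by (rule inner_sum_left_Basis) (simp add: axis_in_Basis_iff)
  finally show ?thesis .
qed

lemma prod_Basis_axis: "(\<Prod>b\<in>(Basis :: (real^'p) set). F b) = (\<Prod>k\<in>UNIV. F (axis k 1))"
proof -
  have eq: "(Basis :: (real^'p) set) = range (\<lambda>k. axis k 1)" by (auto simp: Basis_vec_def)
  have "inj (\<lambda>k::'p. axis k (1::real))" by (simp add: inj_on_def axis_eq_axis)
  then show ?thesis unfolding eq by (subst prod.reindex) simp_all
qed

lemma integral_lborel_vec_prod:
  fixes h :: "'p::finite \<Rightarrow> real \<Rightarrow> complex"
  assumes h: "\<And>k. integrable lborel (h k)"
  shows "(\<integral>z. (\<Prod>k\<in>UNIV. h k ((z :: real^'p) $ k)) \<partial>lborel) = (\<Prod>k\<in>UNIV. \<integral>t. h k t \<partial>lborel)"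
proof -
  interpret product_sigma_finite "\<lambda>_::real^'p. lborel :: real measure" ..
  define H where "H b = h (the_inv (\<lambda>k. axis k (1::real)) b)" for b :: "real^'p"
  have inj: "inj (\<lambda>k::'p. axis k (1::real))" by (simp add: inj_on_def axis_eq_axis)
  have H: "H (axis k 1) = h k" for k by (simp add: H_def the_inv_f_f[OF inj])
  have [measurable]: "h k \<in> borel_measurable borel" for k using h[of k] by (simp add: borel_measurable_integrable)
  have "(\<integral>z. (\<Prod>k\<in>UNIV. h k ((z :: real^'p) $ k)) \<partial>lborel)
    = (\<integral>f. (\<Prod>k\<in>UNIV. h k ((\<Sum>b\<in>Basis. f b *\<^sub>R b :: real^'p) $ k)) \<partial>(\<Pi>\<^sub>M b\<in>Basis. lborel))"
    by (subst lborel_eq, subst integral_distr) auto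
  also have "\<dots> = (\<integral>f. (\<Prod>b\<in>Basis. H b (f b)) \<partial>(\<Pi>\<^sub>M b\<in>Basis. lborel))"
    unfolding vec_nth_basis_sum prod_Basis_axis H ..
  also have "\<dots> = (\<Prod>b\<in>Basis. \<integral>t. H b t \<partial>lborel)"
    by (rule product_integral_prod) (auto simp: H_def h)
  also have "\<dots> = (\<Prod>k\<in>UNIV. \<integral>t. h k t \<partial>lborel)"
    unfolding prod_Basis_axis H ..
  finally show ?thesis .
qed

abbreviation "std_normal_vec_density z \<equiv> (\<Prod>k\<in>UNIV. std_normal_density ((z :: real^'p) $ k))"

lemma std_normal_vec_density_eq:
  "std_normal_vec_density (z :: real^'p) = (1 / sqrt (2 * pi)) ^ CARD('p) * exp (- (norm z)\<^sup>2 / 2)"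
proof -
  have "std_normal_vec_density z = (\<Prod>k\<in>(UNIV::'p set). 1 / sqrt (2 * pi)) * (\<Prod>k\<in>UNIV. exp (- (z $ k)\<^sup>2 / 2))"
    unfolding std_normal_density_def by (rule prod.distrib)
  also have "(\<Prod>k\<in>UNIV. exp (- (z $ k)\<^sup>2 / 2)) = exp (\<Sum>k\<in>UNIV. - (z $ k)\<^sup>2 / 2)"
    by (simp add: exp_sum)
  also have "(\<Sum>k\<in>UNIV. - (z $ k)\<^sup>2 / 2) = - (norm z)\<^sup>2 / 2"
    unfolding power2_norm_eq_inner inner_vec_def by (simp add: sum_negf sum_divide_distrib power2_eq_square)
  finally show ?thesis by simp
qed

lemma sets_std_normal_vec [simp, measurable_cong]: "sets std_normal_vec = sets borel"
  by (simp add: std_normal_vec_def)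

lemma space_std_normal_vec [simp]: "space std_normal_vec = UNIV"
  by (simp add: std_normal_vec_def)

lemma prob_space_std_normal_vec: "prob_space (std_normal_vec :: (real^'p) measure)"
proof
  have "(\<integral>\<^sup>+z. ennreal (std_normal_vec_density (z :: real^'p)) \<partial>lborel) = (\<integral>\<^sup>+z. (\<Prod>b\<in>Basis. ennreal (std_normal_density ((z :: real^'p) \<bullet> b))) \<partial>lborel)"
    unfolding prod_Basis_axis by (simp add: inner_axis prod_ennreal)
  also have "\<dots> = (\<Prod>b\<in>(Basis :: (real^'p) set). \<integral>\<^sup>+t. ennreal (std_normal_density t) \<partial>lborel)"
    by (rule nn_integral_lborel_prod) auto
  also have "(\<integral>\<^sup>+t. ennreal (std_normal_density t) \<partial>lborel) = 1"
    using prob_space.emeasure_space_1[OF prob_space_normal_density[of 1 0]] by (simp add: emeasure_density)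
  finally show "emeasure (std_normal_vec :: (real^'p) measure) (space std_normal_vec) = 1"
    by (simp add: std_normal_vec_def emeasure_density)
qed

lemma integral_std_normal_vec:
  fixes f :: "real^'p \<Rightarrow> 'b::{banach, second_countable_topology}"
  assumes [measurable]: "f \<in> borel_measurable borel"
  shows "(\<integral>z. f z \<partial>std_normal_vec) = (\<integral>z. std_normal_vec_density z *\<^sub>R f z \<partial>lborel)"
  unfolding std_normal_vec_def by (subst integral_density) (auto intro!: prod_nonneg)

lemma char_std_normal_vec:
  "(\<integral>z. iexp (u \<bullet> z) \<partial>std_normal_vec) = of_real (exp (- (norm (u :: real^'p))\<^sup>2 / 2))"
proof -
  define h where "h k t = complex_of_real (std_normal_density t) * iexp (u $ k * t)" for k t
  have h: "integrable lborel (h k)" for k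
    unfolding h_def
  proof (rule Bochner_Integration.integrable_bound[OF integrable_std_normal_moment[of 0]])
    show "AE t in lborel. cmod (complex_of_real (std_normal_density t) * iexp (u $ k * t)) \<le> norm (std_normal_density t * t ^ 0)"
      by (simp add: norm_mult)
  qed simp
  have hk: "(\<integral>t. h k t \<partial>lborel) = of_real (exp (- (u $ k)\<^sup>2 / 2))" for k
  proof -
    have "char std_normal_distribution (u $ k) = (\<integral>t. h k t \<partial>lborel)"
      unfolding char_def h_def by (subst integral_density) (auto simp: scaleR_conv_of_real)
    then show ?thesis by (simp add: char_std_normal_distribution)
  qed
  have "(\<integral>z. iexp (u \<bullet> z) \<partial>std_normal_vec) = (\<integral>z. std_normal_vec_density z *\<^sub>R iexp (u \<bullet> z) \<partial>lborel)"
    by (rule integral_std_normal_vec) simp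
  also have "\<dots> = (\<integral>z. (\<Prod>k\<in>UNIV. h k (z $ k)) \<partial>lborel)"
  proof (rule arg_cong[where f = "integral\<^sup>L lborel"], rule ext)
    fix z
    have "iexp (u \<bullet> z) = (\<Prod>k\<in>UNIV. iexp (u $ k * z $ k))"
      unfolding inner_vec_def by (simp add: sum_distrib_left exp_sum)
    then show "std_normal_vec_density z *\<^sub>R iexp (u \<bullet> z) = (\<Prod>k\<in>UNIV. h k (z $ k))"
      by (simp add: h_def prod.distrib scaleR_conv_of_real)
  qed
  also have "\<dots> = (\<Prod>k\<in>UNIV. of_real (exp (- (u $ k)\<^sup>2 / 2)))"
    unfolding integral_lborel_vec_prod[OF h] hk ..
  also have "\<dots> = of_real (exp (\<Sum>k\<in>UNIV. - (u $ k)\<^sup>2 / 2))" by (simp add: exp_sum)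
  also have "(\<Sum>k\<in>UNIV. - (u $ k)\<^sup>2 / 2) = - (norm u)\<^sup>2 / 2"
    unfolding power2_norm_eq_inner inner_vec_def by (simp add: sum_negf sum_divide_distrib power2_eq_square)
  finally show ?thesis .
qed

text \<open>The Gaussian kernel is the characteristic function of the standard normal law at
  \<open>s *\<^sub>R (y - T w)\<close>. By Fubini, the mean of the kernel is an integral of the
  characteristic function of \<open>T\<close>.\<close>

lemma (in prob_space) gauss_kernel_char:
  fixes T :: "'a \<Rightarrow> real^'p"
  assumes [measurable]: "T \<in> borel_measurable M"
  shows "complex_of_real (expectation (\<lambda>w. exp (- (norm (s *\<^sub>R (y - T w)))\<^sup>2 / 2)))
    = (\<integral>u. iexp (s * (u \<bullet> y)) * expectation (\<lambda>w. iexp ((- s *\<^sub>R u) \<bullet> T w)) \<partial>std_normal_vec)"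
proof -
  interpret G: prob_space "std_normal_vec :: (real^'p) measure" by (rule prob_space_std_normal_vec)
  interpret P: pair_prob_space "std_normal_vec :: (real^'p) measure" M ..
  let ?g = "\<lambda>u w. iexp (s * (u \<bullet> y)) * iexp ((- s *\<^sub>R u) \<bullet> T w)"
  have int: "integrable (std_normal_vec \<Otimes>\<^sub>M M) (\<lambda>(u, w). ?g u w)"
    by (rule P.integrable_const_bound[where B = 1]) (auto simp: norm_mult)
  have "complex_of_real (expectation (\<lambda>w. exp (- (norm (s *\<^sub>R (y - T w)))\<^sup>2 / 2)))
    = expectation (\<lambda>w. complex_of_real (exp (- (norm (s *\<^sub>R (y - T w)))\<^sup>2 / 2)))" by simp
  also have "\<dots> = expectation (\<lambda>w. \<integral>u. ?g u w \<partial>std_normal_vec)"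
  proof (rule Bochner_Integration.integral_cong)
    fix w
    have "?g u w = iexp ((s *\<^sub>R (y - T w)) \<bullet> u)" for u
      by (simp add: inner_diff_left inner_diff_right inner_commute algebra_simps flip: exp_add)
    then show "complex_of_real (exp (- (norm (s *\<^sub>R (y - T w)))\<^sup>2 / 2)) = (\<integral>u. ?g u w \<partial>std_normal_vec)"
      by (simp only: char_std_normal_vec)
  qed simp
  also have "\<dots> = (\<integral>u. expectation (\<lambda>w. ?g u w) \<partial>std_normal_vec)"
    by (rule P.Fubini_integral[OF int])
  finally show ?thesis by simp
qed

text \<open>Characteristic functions are bounded by 1 and the normal weight is finite, so pointwise
  convergence passes through the integral.\<close>

lemma gauss_kernel_convergence:
  fixes T :: "nat \<Rightarrow> 'a \<Rightarrow> real^'p"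
  assumes M: "\<And>n. prob_space (M n)" and T: "\<And>n. T n \<in> borel_measurable (M n)"
    and conv: "\<And>u. (\<lambda>n. \<integral>w. iexp (u \<bullet> T n w) \<partial>M n) \<longlonglongrightarrow> of_real (exp (- (norm u)\<^sup>2 / 2))"
  shows "(\<lambda>n. \<integral>w. exp (- (norm (s *\<^sub>R (y - T n w)))\<^sup>2 / 2) \<partial>M n) \<longlonglongrightarrow>
    (\<integral>z. exp (- (norm (s *\<^sub>R (y - z)))\<^sup>2 / 2) \<partial>std_normal_vec)"
proof -
  interpret G: prob_space "std_normal_vec :: (real^'p) measure" by (rule prob_space_std_normal_vec)
  have "(\<lambda>n. \<integral>u. iexp (s * (u \<bullet> y)) * (\<integral>w. iexp ((- s *\<^sub>R u) \<bullet> T n w) \<partial>M n) \<partial>std_normal_vec) \<longlonglongrightarrow>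
     (\<integral>u. iexp (s * (u \<bullet> y)) * (\<integral>z. iexp ((- s *\<^sub>R u) \<bullet> z) \<partial>std_normal_vec) \<partial>std_normal_vec)"
  proof (rule integral_dominated_convergence[where w = "\<lambda>_. 1"])
    show "AE u in std_normal_vec. (\<lambda>n. iexp (s * (u \<bullet> y)) * (\<integral>w. iexp ((- s *\<^sub>R u) \<bullet> T n w) \<partial>M n)) \<longlonglongrightarrow>
       iexp (s * (u \<bullet> y)) * (\<integral>z. iexp ((- s *\<^sub>R u) \<bullet> z) \<partial>std_normal_vec)"
      unfolding char_std_normal_vec by (intro AE_I2 tendsto_mult tendsto_const conv)
    fix n
    interpret prob_space "M n" by (rule M)
    note T[measurable]
    have m1: "(\<lambda>(u, w). iexp ((- s *\<^sub>R u) \<bullet> T n w)) \<in> borel_measurable (std_normal_vec \<Otimes>\<^sub>M M n)" by measurable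
    show "(\<lambda>u. iexp (s * (u \<bullet> y)) * (\<integral>w. iexp ((- s *\<^sub>R u) \<bullet> T n w) \<partial>M n)) \<in> borel_measurable std_normal_vec"
      by (intro borel_measurable_times borel_measurable_lebesgue_integral m1) measurable
    have "cmod (\<integral>w. iexp ((- s *\<^sub>R u) \<bullet> T n w) \<partial>M n) \<le> 1" for u
      by (rule order_trans[OF integral_norm_bound]) (simp add: prob_space)
    then show "AE u in std_normal_vec. cmod (iexp (s * (u \<bullet> y)) * (\<integral>w. iexp ((- s *\<^sub>R u) \<bullet> T n w) \<partial>M n)) \<le> 1"
      by (simp add: norm_mult)
  next
    have m1: "(\<lambda>(u, z). iexp ((- s *\<^sub>R u) \<bullet> z)) \<in> borel_measurable (std_normal_vec \<Otimes>\<^sub>M std_normal_vec)" by measurable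
    show "(\<lambda>u. iexp (s * (u \<bullet> y)) * (\<integral>z. iexp ((- s *\<^sub>R u) \<bullet> z) \<partial>std_normal_vec)) \<in> borel_measurable std_normal_vec"
      by (intro borel_measurable_times G.borel_measurable_lebesgue_integral m1) measurable
  qed simp
  then have "(\<lambda>n. complex_of_real (\<integral>w. exp (- (norm (s *\<^sub>R (y - T n w)))\<^sup>2 / 2) \<partial>M n)) \<longlonglongrightarrow>
     complex_of_real (\<integral>z. exp (- (norm (s *\<^sub>R (y - z)))\<^sup>2 / 2) \<partial>std_normal_vec)"
    using prob_space.gauss_kernel_char[OF M T] G.gauss_kernel_char[of "\<lambda>z. z" s y] by simp
  then show ?thesis by (simp only: tendsto_of_real_iff)
qed

lemma integral_lborel_shift_scale:
  fixes F :: "real^'p \<Rightarrow> real"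
  assumes "s > 0" and [measurable]: "F \<in> borel_measurable borel"
  shows "(\<integral>y. F y \<partial>lborel) = s ^ CARD('p) * (\<integral>z. F (x + s *\<^sub>R z) \<partial>lborel)"
proof -
  have "(\<integral>y. F y \<partial>lborel) = (\<integral>y. F y \<partial>density (distr lborel borel (\<lambda>z. x + s *\<^sub>R z)) (\<lambda>_. \<bar>s\<bar> ^ DIM(real^'p)))"
    using assms(1) by (subst lborel_affine[of s x]) auto
  also have "\<dots> = (\<integral>y. s ^ CARD('p) *\<^sub>R F y \<partial>distr lborel borel (\<lambda>z. x + s *\<^sub>R z))"
    using assms(1) by (subst integral_density) auto
  also have "\<dots> = (\<integral>z. s ^ CARD('p) *\<^sub>R F (x + s *\<^sub>R z) \<partial>lborel)"
    by (subst integral_distr) auto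
  finally show ?thesis by simp
qed

lemma gauss_smoothing_eq:
  fixes f :: "real^'p \<Rightarrow> real"
  assumes s: "s > 0" and [measurable]: "f \<in> borel_measurable borel"
  shows "(\<integral>z. f (x + s *\<^sub>R z) \<partial>std_normal_vec)
    = (\<integral>y. f y * ((1 / sqrt (2 * pi) / s) ^ CARD('p) * exp (- (norm ((1 / s) *\<^sub>R (y - x)))\<^sup>2 / 2)) \<partial>lborel)"
proof -
  have "(\<integral>z. f (x + s *\<^sub>R z) \<partial>std_normal_vec) = (\<integral>z. std_normal_vec_density z *\<^sub>R f (x + s *\<^sub>R z) \<partial>lborel)"
    by (rule integral_std_normal_vec) simp
  also have "\<dots> = (\<integral>z. s ^ CARD('p) * (f (x + s *\<^sub>R z) * ((1 / sqrt (2 * pi) / s) ^ CARD('p) * exp (- (norm ((1 / s) *\<^sub>R (x + s *\<^sub>R z - x)))\<^sup>2 / 2))) \<partial>lborel)"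
    unfolding std_normal_vec_density_eq using s
    by (intro Bochner_Integration.integral_cong refl) (simp add: power_divide power_mult_distrib)
  also have "\<dots> = (\<integral>y. f y * ((1 / sqrt (2 * pi) / s) ^ CARD('p) * exp (- (norm ((1 / s) *\<^sub>R (y - x)))\<^sup>2 / 2)) \<partial>lborel)"
    by (subst integral_lborel_shift_scale[OF s, where x = x]) auto
  finally show ?thesis .
qed

text \<open>After the substitution \<open>y = T w + s *\<^sub>R z\<close> the law of
  \<open>T\<close> enters only through the mean of the kernel at each fixed \<open>y\<close>, where
  \<open>gauss_kernel_convergence\<close> applies.\<close>

lemma (in prob_space) smoothing_fubini:
  fixes f :: "real^'p \<Rightarrow> real" and T :: "'a \<Rightarrow> real^'p"
  assumes [measurable]: "T \<in> borel_measurable M" and s: "s > 0" and f: "integrable lborel f"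
  shows "expectation (\<lambda>w. \<integral>z. f (T w + s *\<^sub>R z) \<partial>std_normal_vec)
    = (\<integral>y. f y * (1 / sqrt (2 * pi) / s) ^ CARD('p) * expectation (\<lambda>w. exp (- (norm ((1 / s) *\<^sub>R (y - T w)))\<^sup>2 / 2)) \<partial>lborel)"
proof -
  have [measurable]: "f \<in> borel_measurable borel" using f by (simp add: borel_measurable_integrable)
  interpret P: pair_sigma_finite M "lborel :: (real^'p) measure" ..
  let ?c = "(1 / sqrt (2 * pi) / s) ^ CARD('p)"
  let ?g = "\<lambda>w y. f y * (?c * exp (- (norm ((1 / s) *\<^sub>R (y - T w)))\<^sup>2 / 2))"
  have c: "?c \<ge> 0" using s by simp
  have bd: "norm (?g w y) \<le> norm (?c * f y)" for w y
  proof -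
    have "\<bar>?c * exp (- (norm ((1 / s) *\<^sub>R (y - T w)))\<^sup>2 / 2)\<bar> \<le> ?c * 1"
      unfolding abs_mult using c by (intro mult_mono) auto
    then show ?thesis unfolding real_norm_def abs_mult[of "f y"] abs_mult[of ?c "f y"]
      using c by (simp only: mult.commute[of "\<bar>f y\<bar>"] abs_of_nonneg mult_1_right) (rule mult_right_mono, auto)
  qed
  have gi: "integrable lborel (?g w)" for w
    by (rule Bochner_Integration.integrable_bound[OF integrable_mult_right[OF f, of ?c]]) (use bd in auto)
  have gn: "(\<integral>y. norm (?g w y) \<partial>lborel) \<le> (\<integral>y. norm (?c * f y) \<partial>lborel)" for w
    by (intro integral_mono integrable_norm gi integrable_mult_right f bd)
  have int: "integrable (M \<Otimes>\<^sub>M lborel) (\<lambda>(w, y). ?g w y)"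
  proof (rule P.Fubini_integrable)
    show "integrable M (\<lambda>w. \<integral>y. norm ((\<lambda>(w, y). ?g w y) (w, y)) \<partial>lborel)"
    proof (rule integrable_const_bound[where B = "\<integral>y. norm (?c * f y) \<partial>lborel"])
      have "norm (\<integral>y. norm (?g w y) \<partial>lborel) = (\<integral>y. norm (?g w y) \<partial>lborel)" for w
        by (simp only: real_norm_def) (rule abs_of_nonneg, rule Bochner_Integration.integral_nonneg, simp)
      then show "AE w in M. norm (\<integral>y. norm ((\<lambda>(w, y). ?g w y) (w, y)) \<partial>lborel) \<le> (\<integral>y. norm (?c * f y) \<partial>lborel)"
        using gn by (intro AE_I2) (simp only: prod.case)
    qed measurable
  qed (use gi in auto)
  have "expectation (\<lambda>w. \<integral>z. f (T w + s *\<^sub>R z) \<partial>std_normal_vec) = expectation (\<lambda>w. \<integral>y. ?g w y \<partial>lborel)"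
    by (simp only: gauss_smoothing_eq[OF s \<open>f \<in> borel_measurable borel\<close>])
  also have "\<dots> = (\<integral>y. expectation (\<lambda>w. ?g w y) \<partial>lborel)"
    using P.Fubini_integral[OF int] by simp
  finally show ?thesis by (simp add: mult.assoc)
qed

lemma smoothed_convergence:
  fixes T :: "nat \<Rightarrow> 'a \<Rightarrow> real^'p" and f :: "real^'p \<Rightarrow> real"
  assumes M: "\<And>n. prob_space (M n)" and T: "\<And>n. T n \<in> borel_measurable (M n)"
    and conv: "\<And>u. (\<lambda>n. \<integral>w. iexp (u \<bullet> T n w) \<partial>M n) \<longlonglongrightarrow> of_real (exp (- (norm u)\<^sup>2 / 2))"
    and s: "s > 0" and f: "integrable lborel f"
  shows "(\<lambda>n. \<integral>w. (\<integral>z. f (T n w + s *\<^sub>R z) \<partial>std_normal_vec) \<partial>M n) \<longlonglongrightarrow>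
    (\<integral>x. (\<integral>z. f (x + s *\<^sub>R z) \<partial>std_normal_vec) \<partial>std_normal_vec)"
proof -
  interpret G: prob_space "std_normal_vec :: (real^'p) measure" by (rule prob_space_std_normal_vec)
  have [measurable]: "f \<in> borel_measurable borel" using f by (simp add: borel_measurable_integrable)
  let ?c = "(1 / sqrt (2 * pi) / s) ^ CARD('p)"
  have c: "?c \<ge> 0" using s by simp
  have "(\<lambda>n. \<integral>y. f y * ?c * (\<integral>w. exp (- (norm ((1 / s) *\<^sub>R (y - T n w)))\<^sup>2 / 2) \<partial>M n) \<partial>lborel) \<longlonglongrightarrow>
     (\<integral>y. f y * ?c * (\<integral>z. exp (- (norm ((1 / s) *\<^sub>R (y - z)))\<^sup>2 / 2) \<partial>std_normal_vec) \<partial>lborel)"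
  proof (rule integral_dominated_convergence[where w = "\<lambda>y. \<bar>f y\<bar> * ?c"])
    show "AE y in lborel. (\<lambda>n. f y * ?c * (\<integral>w. exp (- (norm ((1 / s) *\<^sub>R (y - T n w)))\<^sup>2 / 2) \<partial>M n)) \<longlonglongrightarrow>
       f y * ?c * (\<integral>z. exp (- (norm ((1 / s) *\<^sub>R (y - z)))\<^sup>2 / 2) \<partial>std_normal_vec)"
      by (intro AE_I2 tendsto_mult tendsto_const gauss_kernel_convergence M T conv)
    show "integrable lborel (\<lambda>y. \<bar>f y\<bar> * ?c)" using f by simp
    have m1: "(\<lambda>(y, z). exp (- (norm ((1 / s) *\<^sub>R (y - z)))\<^sup>2 / 2)) \<in> borel_measurable (lborel \<Otimes>\<^sub>M (std_normal_vec :: (real^'p) measure))" by measurable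
    show "(\<lambda>y. f y * ?c * (\<integral>z. exp (- (norm ((1 / s) *\<^sub>R (y - z)))\<^sup>2 / 2) \<partial>std_normal_vec)) \<in> borel_measurable lborel"
      by (intro borel_measurable_times G.borel_measurable_lebesgue_integral m1) measurable
    fix n
    interpret prob_space "M n" by (rule M)
    note T[measurable]
    have m2: "(\<lambda>(y, w). exp (- (norm ((1 / s) *\<^sub>R (y - T n w)))\<^sup>2 / 2)) \<in> borel_measurable (lborel \<Otimes>\<^sub>M M n)" by measurable
    show "(\<lambda>y. f y * ?c * (\<integral>w. exp (- (norm ((1 / s) *\<^sub>R (y - T n w)))\<^sup>2 / 2) \<partial>M n)) \<in> borel_measurable lborel"
      by (intro borel_measurable_times borel_measurable_lebesgue_integral m2) measurable
    have e1: "norm (exp (- (norm ((1 / s) *\<^sub>R (y - T n w)))\<^sup>2 / 2)) \<le> 1" for y w by simp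
    have "norm (\<integral>w. exp (- (norm ((1 / s) *\<^sub>R (y - T n w)))\<^sup>2 / 2) \<partial>M n) \<le> (\<integral>w. 1 \<partial>M n)" for y
      by (rule order_trans[OF integral_norm_bound], rule integral_mono)
        (auto intro!: integrable_const_bound[where B = 1])
    then have "norm (f y * ?c * (\<integral>w. exp (- (norm ((1 / s) *\<^sub>R (y - T n w)))\<^sup>2 / 2) \<partial>M n)) \<le> \<bar>f y\<bar> * ?c * 1" for y
      unfolding norm_mult using c by (intro mult_mono) (auto simp: prob_space)
    then show "AE y in lborel. norm (f y * ?c * (\<integral>w. exp (- (norm ((1 / s) *\<^sub>R (y - T n w)))\<^sup>2 / 2) \<partial>M n)) \<le> \<bar>f y\<bar> * ?c"
      by simp
  qed
  then show ?thesis
    using prob_space.smoothing_fubini[OF M T s f] G.smoothing_fubini[of "\<lambda>z. z", OF _ s f] by simp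
qed

lemma compact_support_uniform:
  fixes f :: "real^'p \<Rightarrow> real"
  assumes f: "continuous_on UNIV f" and R: "\<And>x. norm x \<ge> R \<Longrightarrow> f x = 0" and \<eta>: "\<eta> > 0"
  obtains \<delta> where "\<delta> > 0" "\<And>x h. norm h < \<delta> \<Longrightarrow> \<bar>f (x + h) - f x\<bar> < \<eta>"
proof -
  have "uniformly_continuous_on (cball 0 (R + 1)) f"
    by (intro compact_uniformly_continuous continuous_on_subset[OF f]) auto
  then obtain d where d: "d > 0" "\<And>x y. x \<in> cball 0 (R + 1) \<Longrightarrow> y \<in> cball 0 (R + 1) \<Longrightarrow> dist y x < d \<Longrightarrow> dist (f y) (f x) < \<eta>"
    unfolding uniformly_continuous_on_def using \<eta> by metis
  show thesis
  proof (rule that[of "min d 1"])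
    fix x h :: "real^'p" assume h: "norm h < min d 1"
    show "\<bar>f (x + h) - f x\<bar> < \<eta>"
    proof (cases "norm x \<le> R + 1 \<and> norm (x + h) \<le> R + 1")
      case True
      then have "x \<in> cball 0 (R + 1)" "x + h \<in> cball 0 (R + 1)" by (simp_all only: mem_cball_0)
      moreover have "dist (x + h) x < d" using h by (simp add: dist_norm)
      ultimately have "dist (f (x + h)) (f x) < \<eta>" by (rule d(2))
      then show ?thesis by (simp only: dist_real_def)
    next
      \<comment> \<open>One of the points has norm above \<open>R + 1\<close> and the shift is
        shorter than 1, so both have norm at least \<open>R\<close> and \<open>f\<close> vanishes at
        both.\<close>
      case False
      have "norm (x + h) \<le> norm x + norm h" "norm x \<le> norm (x + h) + norm h"
        using norm_triangle_ineq[of x h] norm_triangle_ineq4[of "x + h" h] by auto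
      then have "norm x \<ge> R" "norm (x + h) \<ge> R" using False h by auto
      then show ?thesis using R \<eta> by simp
    qed
  qed (use d in auto)
qed

text \<open>Off a set \<open>A k\<close> of small normal measure the shift is shorter than the
  modulus of uniform continuity; on that set the error is at most \<open>2 * B\<close>. One
  \<open>s\<close> works for all \<open>x\<close>.\<close>

lemma smoothing_error:
  fixes f :: "real^'p \<Rightarrow> real"
  assumes f: "continuous_on UNIV f" and R: "\<And>x. norm x \<ge> R \<Longrightarrow> f x = 0" and B: "\<And>x. \<bar>f x\<bar> \<le> B" and \<eta>: "\<eta> > 0"
  shows "\<exists>s>0. \<forall>x. \<bar>(\<integral>z. f (x + s *\<^sub>R z) \<partial>std_normal_vec) - f x\<bar> \<le> \<eta>"
proof -
  interpret G: prob_space "std_normal_vec :: (real^'p) measure" by (rule prob_space_std_normal_vec)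
  have [measurable]: "f \<in> borel_measurable borel" using f by (rule borel_measurable_continuous_onI)
  obtain \<delta> where \<delta>: "\<delta> > 0" "\<And>x h. norm h < \<delta> \<Longrightarrow> \<bar>f (x + h) - f x\<bar> < \<eta> / 2"
    by (rule compact_support_uniform[OF f R half_gt_zero[OF \<eta>]]) blast+
  define A where "A k = {z :: real^'p. \<delta> * real (Suc k) \<le> norm z}" for k
  have [measurable]: "A k \<in> sets borel" for k unfolding A_def by measurable
  have "(\<lambda>k. \<integral>z. indicator (A k) z \<partial>std_normal_vec) \<longlonglongrightarrow> (\<integral>z. (0::real) \<partial>(std_normal_vec :: (real^'p) measure))"
  proof (rule integral_dominated_convergence[where w = "\<lambda>_. 1"])
    show "AE z in std_normal_vec. (\<lambda>k. indicator (A k) z :: real) \<longlonglongrightarrow> 0"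
    proof (rule AE_I2, rule tendsto_eventually)
      fix z :: "real^'p"
      obtain K :: nat where K: "norm z / \<delta> < real K" using reals_Archimedean2 by blast
      show "\<forall>\<^sub>F k in sequentially. indicator (A k) z = (0::real)"
        using eventually_ge_at_top[of K]
      proof eventually_elim
        case (elim k)
        have "norm z < \<delta> * real K" using K \<delta> by (simp add: field_simps)
        also have "\<dots> \<le> \<delta> * real (Suc k)" using elim \<delta> by (intro mult_left_mono) auto
        finally show ?case by (simp add: A_def)
      qed
    qed
  qed (auto simp: indicator_def)
  then have lim: "(\<lambda>k. \<integral>z. indicator (A k) z \<partial>std_normal_vec :: real) \<longlonglongrightarrow> 0" by simp
  have B0: "B \<ge> 0" using B[of 0] by linarith
  have "\<eta> / (4 * (B + 1)) > 0" using \<eta> B0 by simp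
  from order_tendstoD(2)[OF lim this] obtain k where k: "(\<integral>z. indicator (A k) z \<partial>std_normal_vec) < \<eta> / (4 * (B + 1))"
    by (auto simp: eventually_sequentially)
  \<comment> \<open>Outside \<open>A k\<close> this makes
    \<open>norm (s *\<^sub>R z) < \<delta>\<close>.\<close>
  define s where "s = 1 / real (Suc k)"
  have s: "s > 0" by (simp add: s_def)
  have "\<bar>(\<integral>z. f (x + s *\<^sub>R z) \<partial>std_normal_vec) - f x\<bar> \<le> \<eta>" for x
  proof -
    have i1: "integrable std_normal_vec (\<lambda>z. f (x + s *\<^sub>R z))"
      by (rule G.integrable_const_bound[where B = B]) (use B in auto)
    have i2: "integrable std_normal_vec (indicator (A k) :: real^'p \<Rightarrow> real)"
      by (rule G.integrable_const_bound[where B = 1]) (auto simp: indicator_def)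
    have pt: "\<bar>f (x + s *\<^sub>R z) - f x\<bar> \<le> \<eta> / 2 + 2 * B * indicator (A k) z" for z
    proof (cases "z \<in> A k")
      case True
      have "\<bar>f (x + s *\<^sub>R z) - f x\<bar> \<le> 2 * B" using B[of "x + s *\<^sub>R z"] B[of x] by linarith
      then show ?thesis using True \<eta> by simp
    next
      case False
      then have "norm (s *\<^sub>R z) < \<delta>" by (simp add: A_def s_def field_simps)
      then show ?thesis using \<delta>(2)[of "s *\<^sub>R z" x] False by simp
    qed
    have "(\<integral>z. f (x + s *\<^sub>R z) \<partial>std_normal_vec) - f x = (\<integral>z. f (x + s *\<^sub>R z) - f x \<partial>std_normal_vec)"
      using i1 G.prob_space by simp
    also have "\<bar>\<dots>\<bar> \<le> (\<integral>z. \<bar>f (x + s *\<^sub>R z) - f x\<bar> \<partial>std_normal_vec)" by (rule integral_abs_bound)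
    also have "\<dots> \<le> (\<integral>z. \<eta> / 2 + 2 * B * indicator (A k) z \<partial>std_normal_vec)"
      using i1 i2 by (intro integral_mono pt) auto
    also have "\<dots> = \<eta> / 2 + 2 * B * (\<integral>z. indicator (A k) z \<partial>std_normal_vec)"
      using i2 G.prob_space by simp
    also have "\<dots> \<le> \<eta> / 2 + 2 * B * (\<eta> / (4 * (B + 1)))" using k B0 by (intro add_left_mono mult_left_mono) auto
    also have "\<dots> \<le> \<eta>" using B0 \<eta> by (simp add: field_simps)
    finally show ?thesis .
  qed
  then show ?thesis using s by blast
qed

lemma convergence_compact_support:
  fixes T :: "nat \<Rightarrow> 'a \<Rightarrow> real^'p" and f :: "real^'p \<Rightarrow> real"
  assumes M: "\<And>n. prob_space (M n)" and T: "\<And>n. T n \<in> borel_measurable (M n)"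
    and conv: "\<And>u. (\<lambda>n. \<integral>w. iexp (u \<bullet> T n w) \<partial>M n) \<longlonglongrightarrow> of_real (exp (- (norm u)\<^sup>2 / 2))"
    and f: "continuous_on UNIV f" and R: "\<And>x. norm x \<ge> R \<Longrightarrow> f x = 0" and B: "\<And>x. \<bar>f x\<bar> \<le> B"
  shows "(\<lambda>n. \<integral>w. f (T n w) \<partial>M n) \<longlonglongrightarrow> (\<integral>z. f z \<partial>std_normal_vec)"
proof (rule LIMSEQ_I)
  fix \<eta> :: real assume \<eta>: "\<eta> > 0"
  interpret G: prob_space "std_normal_vec :: (real^'p) measure" by (rule prob_space_std_normal_vec)
  have fm[measurable]: "f \<in> borel_measurable borel" using f by (rule borel_measurable_continuous_onI)
  have fi: "integrable lborel f"
  proof (rule Bochner_Integration.integrable_bound)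
    show "integrable lborel (\<lambda>x. B * indicator (cball 0 R) x :: real)"
      by (intro integrable_mult_right integrable_real_indicator emeasure_bounded_finite bounded_cball) simp
    have "norm (f x) \<le> norm (B * indicator (cball 0 R) x :: real)" for x
      using B[of x] R[of x] by (cases "norm x \<le> R") auto
    then show "AE x in lborel. norm (f x) \<le> norm (B * indicator (cball 0 R) x :: real)" by simp
  qed simp
  obtain s where s: "s > 0" "\<And>x. \<bar>(\<integral>z. f (x + s *\<^sub>R z) \<partial>std_normal_vec) - f x\<bar> \<le> \<eta> / 4"
  proof -
    have "\<eta> / 4 > 0" using \<eta> by simp
    from smoothing_error[OF f R B this] show thesis using that by blast
  qed
  define g where "g x = (\<integral>z. f (x + s *\<^sub>R z) \<partial>std_normal_vec)" for x
  have gm[measurable]: "g \<in> borel_measurable borel"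
    unfolding g_def by (intro G.borel_measurable_lebesgue_integral) measurable
  have gB: "\<bar>g x\<bar> \<le> B + \<eta>" for x using s(2)[of x] B[of x] \<eta> unfolding g_def by linarith
  have err: "\<bar>(\<integral>w. g (Z w) \<partial>N) - (\<integral>w. f (Z w) \<partial>N)\<bar> \<le> \<eta> / 4"
    if "prob_space N" and Z: "Z \<in> borel_measurable N" for N :: "'c measure" and Z
  proof -
    interpret prob_space N by fact
    note Z[measurable]
    have i1: "integrable N (\<lambda>w. g (Z w))" using gB by (auto intro!: integrable_const_bound[where B = "B + \<eta>"])
    have i2: "integrable N (\<lambda>w. f (Z w))" using B by (auto intro!: integrable_const_bound[where B = B])
    note i = i1 i2
    have "(\<integral>w. g (Z w) \<partial>N) - (\<integral>w. f (Z w) \<partial>N) = (\<integral>w. g (Z w) - f (Z w) \<partial>N)" using i by simp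
    also have "\<bar>\<dots>\<bar> \<le> (\<integral>w. \<bar>g (Z w) - f (Z w)\<bar> \<partial>N)" by (rule integral_abs_bound)
    also have "\<dots> \<le> (\<integral>w. \<eta> / 4 \<partial>N)" using i s(2) unfolding g_def by (intro integral_mono) auto
    finally show ?thesis by (simp add: prob_space)
  qed
  have "(\<lambda>n. \<integral>w. g (T n w) \<partial>M n) \<longlonglongrightarrow> (\<integral>z. g z \<partial>std_normal_vec)"
    unfolding g_def by (rule smoothed_convergence[OF M T conv s(1) fi])
  from LIMSEQ_D[OF this, of "\<eta> / 4"] \<eta> obtain N where N: "\<And>n. n \<ge> N \<Longrightarrow> \<bar>(\<integral>w. g (T n w) \<partial>M n) - (\<integral>z. g z \<partial>std_normal_vec)\<bar> < \<eta> / 4"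
    by auto
  have "norm ((\<integral>w. f (T n w) \<partial>M n) - (\<integral>z. f z \<partial>std_normal_vec)) < \<eta>" if "n \<ge> N" for n
    using N[OF that] err[OF M T, of n] err[of std_normal_vec "\<lambda>z. z", OF prob_space_std_normal_vec] \<eta>
    by (simp add: abs_if split: if_splits)
  then show "\<exists>N. \<forall>n\<ge>N. norm ((\<integral>w. f (T n w) \<partial>M n) - (\<integral>z. f z \<partial>std_normal_vec)) < \<eta>" by blast
qed

text \<open>Tightness comes for free: the cutoff is itself compactly supported and continuous, so
  its means converge, and the mass that \<open>T n\<close> places where the cutoff is below 1 is
  eventually controlled by that of the normal law.\<close>

theorem levy_continuity_std_normal_vec:
  fixes T :: "nat \<Rightarrow> 'a \<Rightarrow> real^'p" and f :: "real^'p \<Rightarrow> real"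
  assumes M: "\<And>n. prob_space (M n)" and T: "\<And>n. T n \<in> borel_measurable (M n)"
    and conv: "\<And>u. (\<lambda>n. \<integral>w. iexp (u \<bullet> T n w) \<partial>M n) \<longlonglongrightarrow> of_real (exp (- (norm u)\<^sup>2 / 2))"
    and f: "continuous_on UNIV f" and bf: "bounded (range f)"
  shows "(\<lambda>n. \<integral>w. f (T n w) \<partial>M n) \<longlonglongrightarrow> (\<integral>z. f z \<partial>std_normal_vec)"
proof (rule LIMSEQ_I)
  fix \<eta> :: real assume \<eta>: "\<eta> > 0"
  interpret G: prob_space "std_normal_vec :: (real^'p) measure" by (rule prob_space_std_normal_vec)
  obtain B where B: "B > 0" "\<And>x. \<bar>f x\<bar> \<le> B" using bf unfolding bounded_pos by auto
  have fm[measurable]: "f \<in> borel_measurable borel" using f by (rule borel_measurable_continuous_onI)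
  define cut where "cut R x = max 0 (min 1 (R + 1 - norm x))" for R and x :: "real^'p"
  have cut01: "0 \<le> cut R x" "cut R x \<le> 1" for R x by (auto simp: cut_def)
  have cutc: "continuous_on UNIV (cut R)" for R unfolding cut_def by (intro continuous_intros)
  have cutm[measurable]: "cut R \<in> borel_measurable borel" for R using cutc by (rule borel_measurable_continuous_onI)
  have cut0: "cut R x = 0" if "norm x \<ge> R + 1" for R x using that by (simp add: cut_def)
  have "(\<lambda>k. \<integral>z. cut (real k) z \<partial>std_normal_vec) \<longlonglongrightarrow> (\<integral>z. 1 \<partial>(std_normal_vec :: (real^'p) measure))"
  proof (rule integral_dominated_convergence[where w = "\<lambda>_. 1"])
    show "AE z in std_normal_vec. (\<lambda>k. cut (real k) z) \<longlonglongrightarrow> 1"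
    proof (rule AE_I2, rule tendsto_eventually)
      fix z :: "real^'p"
      obtain K :: nat where K: "norm z < real K" using reals_Archimedean2 by blast
      show "\<forall>\<^sub>F k in sequentially. cut (real k) z = 1"
        using eventually_ge_at_top[of K] by eventually_elim (use K in \<open>auto simp: cut_def\<close>)
    qed
  qed (use cut01 in auto)
  then have lim1: "(\<lambda>k. \<integral>z. cut (real k) z \<partial>std_normal_vec) \<longlonglongrightarrow> 1" using G.prob_space by simp
  define \<epsilon> where "\<epsilon> = \<eta> / (8 * B)"
  have \<epsilon>: "\<epsilon> > 0" using \<eta> B by (simp add: \<epsilon>_def)
  have "1 - \<epsilon> < 1" using \<epsilon> by simp
  from order_tendstoD(1)[OF lim1 this] obtain k where k: "(\<integral>z. cut (real k) z \<partial>std_normal_vec) > 1 - \<epsilon>"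
    by (auto simp: eventually_sequentially)
  let ?cut = "cut (real k)"
  have bd: "\<bar>f x * ?cut x\<bar> \<le> B" for x
    using mult_mono[OF B(2)[of x] cut01(2)[of k x]] B cut01[of k x] by (simp add: abs_mult)
  have err: "\<bar>(\<integral>w. f (Z w) \<partial>N) - (\<integral>w. f (Z w) * ?cut (Z w) \<partial>N)\<bar> \<le> B * (1 - (\<integral>w. ?cut (Z w) \<partial>N))"
    if "prob_space N" and Z: "Z \<in> borel_measurable N" for N :: "'c measure" and Z
  proof -
    interpret prob_space N by fact
    note Z[measurable]
    have i1: "integrable N (\<lambda>w. f (Z w))" using B(2) by (auto intro!: integrable_const_bound[where B = B])
    have i2: "integrable N (\<lambda>w. f (Z w) * ?cut (Z w))" using bd by (auto intro!: integrable_const_bound[where B = B])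
    have i3: "integrable N (\<lambda>w. ?cut (Z w))" using cut01 by (auto intro!: integrable_const_bound[where B = 1])
    have "(\<integral>w. f (Z w) \<partial>N) - (\<integral>w. f (Z w) * ?cut (Z w) \<partial>N) = (\<integral>w. f (Z w) * (1 - ?cut (Z w)) \<partial>N)"
      using i1 i2 by (simp add: right_diff_distrib)
    also have "\<bar>\<dots>\<bar> \<le> (\<integral>w. \<bar>f (Z w) * (1 - ?cut (Z w))\<bar> \<partial>N)" by (rule integral_abs_bound)
    also have "\<dots> \<le> (\<integral>w. B * (1 - ?cut (Z w)) \<partial>N)"
    proof (rule integral_mono)
      show "integrable N (\<lambda>w. \<bar>f (Z w) * (1 - ?cut (Z w))\<bar>)" using i1 i2 by (simp add: right_diff_distrib)
      show "integrable N (\<lambda>w. B * (1 - ?cut (Z w)))" using i3 by simp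
      show "\<bar>f (Z w) * (1 - ?cut (Z w))\<bar> \<le> B * (1 - ?cut (Z w))" for w
        unfolding abs_mult using B cut01[of k "Z w"] by (intro mult_mono) auto
    qed
    finally show ?thesis using i3 by (simp add: prob_space)
  qed
  have l1: "(\<lambda>n. \<integral>w. f (T n w) * ?cut (T n w) \<partial>M n) \<longlonglongrightarrow> (\<integral>z. f z * ?cut z \<partial>std_normal_vec)"
    by (rule convergence_compact_support[OF M T conv, where R = "real k + 1" and B = B])
       (use bd cut0 in \<open>auto intro!: continuous_intros f cutc\<close>)
  have l2: "(\<lambda>n. \<integral>w. ?cut (T n w) \<partial>M n) \<longlonglongrightarrow> (\<integral>z. ?cut z \<partial>std_normal_vec)"
    by (rule convergence_compact_support[OF M T conv, where R = "real k + 1" and B = 1])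
       (use cut01 cut0 in \<open>auto intro!: cutc\<close>)
  from LIMSEQ_D[OF l1, of "\<eta> / 4"] \<eta> obtain N1 where N1: "\<And>n. n \<ge> N1 \<Longrightarrow>
      \<bar>(\<integral>w. f (T n w) * ?cut (T n w) \<partial>M n) - (\<integral>z. f z * ?cut z \<partial>std_normal_vec)\<bar> < \<eta> / 4" by auto
  from order_tendstoD(1)[OF l2 k] obtain N2 where N2: "\<And>n. n \<ge> N2 \<Longrightarrow> (\<integral>w. ?cut (T n w) \<partial>M n) > 1 - \<epsilon>"
    by (auto simp: eventually_sequentially)
  have "norm ((\<integral>w. f (T n w) \<partial>M n) - (\<integral>z. f z \<partial>std_normal_vec)) < \<eta>" if n: "n \<ge> max N1 N2" for n
  proof -
    have "B * (1 - (\<integral>w. ?cut (T n w) \<partial>M n)) \<le> B * \<epsilon>" using N2[of n] n B by (intro mult_left_mono) auto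
    then have e1: "\<bar>(\<integral>w. f (T n w) \<partial>M n) - (\<integral>w. f (T n w) * ?cut (T n w) \<partial>M n)\<bar> \<le> \<eta> / 8"
      using err[OF M T, of n] B by (simp add: \<epsilon>_def)
    have "B * (1 - (\<integral>z. ?cut z \<partial>std_normal_vec)) \<le> B * \<epsilon>" using k B by (intro mult_left_mono) auto
    then have e2: "\<bar>(\<integral>z. f z \<partial>std_normal_vec) - (\<integral>z. f z * ?cut z \<partial>std_normal_vec)\<bar> \<le> \<eta> / 8"
      using err[of std_normal_vec "\<lambda>z. z", OF prob_space_std_normal_vec] B by (simp add: \<epsilon>_def)
    show ?thesis using e1 e2 N1[of n] n \<eta> unfolding real_norm_def by linarith
  qed
  then show "\<exists>N. \<forall>n\<ge>N. norm ((\<integral>w. f (T n w) \<partial>M n) - (\<integral>z. f z \<partial>std_normal_vec)) < \<eta>" by blast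
qed

section \<open>Studentization\<close>

text \<open>All dependence on \<open>n\<close> and \<open>m\<close>: far covariances, neighbourhood
  counts, truncation bias and random thinning, in this order.\<close>

definition rate_error :: "nat \<Rightarrow> real \<Rightarrow> real \<Rightarrow> real \<Rightarrow> real \<Rightarrow> real" where
  "rate_error n \<rho> c1 r m = n * \<rho> powr m + exp (c1 * m) / sqrt n + (\<rho> / r) powr m + 1 / sqrt n"

definition dev_const :: "real \<Rightarrow> real \<Rightarrow> real \<Rightarrow> real" where
  "dev_const cb cc k = 2 * sqrt cb * (cc + sqrt k)"

text \<open>Obtained by bounding each summand of \<open>weighted_clt_bound\<close> by a multiple of
  \<open>rate_error\<close>. It has no argument \<open>n\<close>, so it stays fixed when the sample
  size grows.\<close>

definition clt_const :: "real \<Rightarrow> real \<Rightarrow> real \<Rightarrow> real \<Rightarrow> real \<Rightarrow> real \<Rightarrow> real \<Rightarrow> real" where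
  "clt_const a cb ch cc k k' t = exp (t\<^sup>2 * a\<^sup>2 / 2) *
     (2 * ch * t * (1 + t) + t\<^sup>2 * dev_const cb cc k + t\<^sup>2 * cb * k' + t^3 / 2 * a^3 * cc
       + t\<^sup>2 * cb * sqrt k + 2 * t^3 * a^3 + t\<^sup>2 / 2 * dev_const cb cc k)"

context network_errors begin

abbreviation "err r m \<equiv> rate_error n \<rho> c1 r m"

lemma rate_error_ge:
  assumes "r > 0"
  shows "n * \<rho> powr m \<le> err r m" "exp (c1 * m) / sqrt n \<le> err r m" "(\<rho> / r) powr m \<le> err r m" "1 / sqrt n \<le> err r m"
  unfolding rate_error_def by (simp_all add: add_nonneg_nonneg)

lemma vbound_le:
  assumes "m \<ge> 0"
  shows "vbound m \<le> dev_const cb cc (KR \<rho>) * (exp (c1 * m) / sqrt n)"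
proof -
  have e: "exp (2 * c1 * m) = (exp (c1 * m))\<^sup>2" by (simp add: power2_eq_square flip: exp_add)
  have e1: "1 \<le> exp (c1 * m)" using assms c1_pos by simp
  have k: "KR \<rho> \<ge> 0" by (rule KR_nonneg[OF rate])
  have "vbound m = 2 * sqrt cb * (sqrt ((cc * exp (c1 * m))\<^sup>2 + KR \<rho>) / sqrt n)"
    unfolding vbound_def e power_mult_distrib[symmetric] by (simp add: real_sqrt_mult real_sqrt_divide)
  also have "\<dots> \<le> 2 * sqrt cb * ((cc * exp (c1 * m) + sqrt (KR \<rho>) * exp (c1 * m)) / sqrt n)"
  proof (intro mult_left_mono divide_right_mono)
    have "sqrt ((cc * exp (c1 * m))\<^sup>2 + KR \<rho>) \<le> cc * exp (c1 * m) + sqrt (KR \<rho>)"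
      using sqrt_add_le_add_sqrt[of "(cc * exp (c1 * m))\<^sup>2" "KR \<rho>"] k cc_pos by simp
    also have "sqrt (KR \<rho>) \<le> sqrt (KR \<rho>) * exp (c1 * m)" using e1 k mult_left_mono[OF e1, of "sqrt (KR \<rho>)"] by simp
    finally show "sqrt ((cc * exp (c1 * m))\<^sup>2 + KR \<rho>) \<le> cc * exp (c1 * m) + sqrt (KR \<rho>) * exp (c1 * m)" by simp
  qed (use cb_pos in auto)
  also have "\<dots> = dev_const cb cc (KR \<rho>) * (exp (c1 * m) / sqrt n)"
    by (simp add: dev_const_def algebra_simps add_divide_distrib)
  finally show ?thesis .
qed

lemma dev_const_nonneg: "dev_const cb cc (KR \<rho>) \<ge> 0"
  unfolding dev_const_def using cb_pos cc_pos KR_nonneg[OF rate] by simp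

lemma vbound_le_rate:
  assumes "m \<ge> 0" "r > 0"
  shows "vbound m \<le> dev_const cb cc (KR \<rho>) * err r m" "vbound 0 \<le> dev_const cb cc (KR \<rho>) * err r m"
proof -
  show "vbound m \<le> dev_const cb cc (KR \<rho>) * err r m"
    using vbound_le[OF assms(1)] mult_left_mono[OF rate_error_ge(2)[OF assms(2)] dev_const_nonneg] by (rule order_trans)
  show "vbound 0 \<le> dev_const cb cc (KR \<rho>) * err r m"
    using vbound_le[OF order_refl] mult_left_mono[OF rate_error_ge(4)[OF assms(2)] dev_const_nonneg] by (simp add: order_trans)
qed

lemma weighted_clt_bound_le:
  assumes m: "m \<ge> 0" and t: "t \<ge> 0" and r: "\<rho> < r" "r * exp (2 * c1) < 1"
  shows "weighted_clt_bound r m t \<le> clt_const a cb ch cc (KR \<rho>) (KR r) t * err r m"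
proof -
  have r0: "r > 0" using rho r by simp
  note ge = rate_error_ge[OF r0, of m]
  have k: "KR \<rho> \<ge> 0" "KR r \<ge> 0" using KR_nonneg rate r by auto
  have n1: "sqrt n \<le> n" using n_pos by (simp add: real_sqrt_le_iff sqrt_le_D real_le_lsqrt power2_eq_square)
  have t1: "t * (sqrt n * (2 * ch * (1 + t * sqrt n) * \<rho> powr m)) \<le> 2 * ch * t * (1 + t) * err r m"
  proof -
    have "t * (sqrt n * (2 * ch * (1 + t * sqrt n) * \<rho> powr m)) = 2 * ch * t * ((sqrt n + t * n) * \<rho> powr m)"
      by (simp add: algebra_simps)
    also have "\<dots> \<le> 2 * ch * t * ((n + t * n) * \<rho> powr m)"
      using n1 t ch_pos by (intro mult_left_mono mult_right_mono add_mono) auto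
    also have "\<dots> = 2 * ch * t * (1 + t) * (n * \<rho> powr m)" by (simp add: algebra_simps)
    also have "\<dots> \<le> 2 * ch * t * (1 + t) * err r m" using t ch_pos by (intro mult_left_mono ge) auto
    finally show ?thesis .
  qed
  have t2: "t * (t * vbound m) \<le> t\<^sup>2 * dev_const cb cc (KR \<rho>) * err r m"
    using mult_left_mono[OF vbound_le_rate(1)[OF m r0], of "t * t"] t by (simp add: power2_eq_square mult_ac)
  have t3: "t * (t * (cb * KR r * (\<rho> / r) powr m)) \<le> t\<^sup>2 * cb * KR r * err r m"
    using mult_left_mono[OF ge(3), of "t * t * cb * KR r"] t cb_pos k by (simp add: power2_eq_square mult_ac)
  have t4: "t * (t\<^sup>2 / 2 * (a^3 * (cc * exp (c1 * m)) / sqrt n)) \<le> t^3 / 2 * a^3 * cc * err r m"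
    using mult_left_mono[OF ge(2), of "t^3 / 2 * a^3 * cc"] t a_pos cc_pos by (simp add: power2_eq_square power3_eq_cube mult_ac)
  have t5: "t\<^sup>2 / 2 * sqrt (4 * cb\<^sup>2 * KR \<rho> / n) \<le> t\<^sup>2 * cb * sqrt (KR \<rho>) * err r m"
  proof -
    have "t\<^sup>2 / 2 * sqrt (4 * cb\<^sup>2 * KR \<rho> / n) = t\<^sup>2 * cb * sqrt (KR \<rho>) * (1 / sqrt n)"
      using cb_pos by (simp add: real_sqrt_mult real_sqrt_divide)
    then show ?thesis using mult_left_mono[OF ge(4), of "t\<^sup>2 * cb * sqrt (KR \<rho>)"] cb_pos k by simp
  qed
  have t6: "2 * t^3 * a^3 / sqrt n \<le> 2 * t^3 * a^3 * err r m"
    using mult_left_mono[OF ge(4), of "2 * t^3 * a^3"] t a_pos by simp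
  have t7: "t\<^sup>2 / 2 * vbound 0 \<le> t\<^sup>2 / 2 * dev_const cb cc (KR \<rho>) * err r m"
    using mult_left_mono[OF vbound_le_rate(2)[OF m r0], of "t\<^sup>2 / 2"] by (simp add: mult.assoc)
  have "t * clt_bound r m t + t\<^sup>2 / 2 * sqrt (4 * cb\<^sup>2 * KR \<rho> / n) + 2 * t^3 * a^3 / sqrt n + t\<^sup>2 / 2 * vbound 0
    \<le> (2 * ch * t * (1 + t) * err r m + (t\<^sup>2 * dev_const cb cc (KR \<rho>) * err r m + t\<^sup>2 * cb * KR r * err r m) + t^3 / 2 * a^3 * cc * err r m)
       + t\<^sup>2 * cb * sqrt (KR \<rho>) * err r m + 2 * t^3 * a^3 * err r m + t\<^sup>2 / 2 * dev_const cb cc (KR \<rho>) * err r m"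
    unfolding clt_bound_def distrib_left[of t] by (intro add_mono t1 t2 t3 t4 t5 t6 t7)
  also have "\<dots> = (2 * ch * t * (1 + t) + t\<^sup>2 * dev_const cb cc (KR \<rho>) + t\<^sup>2 * cb * KR r + t^3 / 2 * a^3 * cc
       + t\<^sup>2 * cb * sqrt (KR \<rho>) + 2 * t^3 * a^3 + t\<^sup>2 / 2 * dev_const cb cc (KR \<rho>)) * err r m"
    by (simp only: distrib_right add.assoc)
  finally show ?thesis unfolding weighted_clt_bound_def clt_const_def mult.assoc[of "exp _"] by (intro mult_left_mono) auto
qed

end

section \<open>The regression model and the covariance estimator\<close>

lemma norm_le_card_bound:
  fixes x :: "real^'p" and c :: real
  assumes "\<And>j. \<bar>x $ j\<bar> \<le> c" shows "norm x \<le> CARD('p) * c"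
  using order_trans[OF norm_le_l1_cart sum_bounded_above[of UNIV "\<lambda>j. \<bar>x $ j\<bar>" c]] assms by simp

lemma norm_matrix_vector_le: "norm ((A :: real^'p^'p) *v v) \<le> norm A * norm v"
proof (rule power2_le_imp_le)
  have "(norm (A *v v))\<^sup>2 = (\<Sum>k\<in>UNIV. (A $ k \<bullet> v)\<^sup>2)"
    unfolding power2_norm_eq_inner inner_vec_def[of "A *v v"] by (simp add: matrix_vector_mul_component power2_eq_square)
  also have "\<dots> \<le> (\<Sum>k\<in>UNIV. (norm (A $ k))\<^sup>2 * (norm v)\<^sup>2)"
    using Cauchy_Schwarz_ineq by (intro sum_mono) (simp add: power2_norm_eq_inner)
  also have "\<dots> = (norm A * norm v)\<^sup>2" by (simp add: norm_matrix_rows power_mult_distrib sum_distrib_right)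
  finally show "(norm (A *v v))\<^sup>2 \<le> (norm A * norm v)\<^sup>2" .
qed simp

lemma norm_matrix_le_sum_abs: "norm (A :: real^'p^'p) \<le> (\<Sum>i\<in>UNIV. \<Sum>j\<in>UNIV. \<bar>A $ i $ j\<bar>)"
proof -
  have "norm A \<le> (\<Sum>i\<in>UNIV. norm (A $ i))" unfolding norm_vec_def by (rule L2_set_le_sum) simp
  also have "\<dots> \<le> (\<Sum>i\<in>UNIV. \<Sum>j\<in>UNIV. \<bar>A $ i $ j\<bar>)" by (intro sum_mono norm_le_l1_cart)
  finally show ?thesis .
qed

lemma matrix_vector_measurable [measurable (raw)]:
  fixes F :: "'w \<Rightarrow> real^'p^'p" and f :: "'w \<Rightarrow> real^'p"
  assumes F: "F \<in> borel_measurable M" and f: "f \<in> borel_measurable M"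
  shows "(\<lambda>w. F w *v f w) \<in> borel_measurable M"
proof -
  have [measurable]: "(\<lambda>w. F w $ i $ j) \<in> borel_measurable M" for i j
    by (rule measurable_compose[OF F]) (intro borel_measurable_continuous_onI continuous_intros)
  have [measurable]: "(\<lambda>w. f w $ j) \<in> borel_measurable M" for j
    by (rule measurable_compose[OF f]) (intro borel_measurable_continuous_onI continuous_intros)
  show ?thesis
    by (subst borel_measurable_euclidean_space) (auto simp: Basis_vec_def inner_axis matrix_vector_mult_def)
qed

lemma XtX_mult: "XtX n x *v v = (\<Sum>i<n. (x i \<bullet> v) *\<^sub>R x i)"
  unfolding vec_eq_iff XtX_def matrix_vector_mult_def inner_vec_def
  by (auto simp: sum_distrib_right sum_distrib_left mult_ac intro: sum.swap)

lemma XtSigmaX_form: "u \<bullet> (XtSigmaX n x M e *v v) = (\<Sum>i<n. \<Sum>j<n. (x i \<bullet> u) * (x j \<bullet> v) * Defs.Sigma M e i j)"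
proof -
  have "u \<bullet> (XtSigmaX n x M e *v v) = (\<Sum>r\<in>UNIV. \<Sum>s\<in>UNIV. \<Sum>i<n. \<Sum>j<n. (x i $ r * u $ r) * (x j $ s * v $ s) * Defs.Sigma M e i j)"
    unfolding XtSigmaX_def matrix_vector_mult_def inner_vec_def
    by (simp add: sum_distrib_right sum_distrib_left mult_ac)
  also have "\<dots> = (\<Sum>i<n. \<Sum>j<n. \<Sum>r\<in>UNIV. \<Sum>s\<in>UNIV. (x i $ r * u $ r) * (x j $ s * v $ s) * Defs.Sigma M e i j)"
    unfolding sum.swap[of _ "{..<n}" "UNIV :: 'a set"] ..
  also have "\<dots> = (\<Sum>i<n. \<Sum>j<n. (x i \<bullet> u) * (x j \<bullet> v) * Defs.Sigma M e i j)"
    unfolding inner_vec_def sum_product inner_real_def unfolding sum_distrib_right ..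
  finally show ?thesis .
qed


text \<open>Lower bound for the quadratic form of \<open>XtX n x\<close> divided by
  \<open>n\<close>. Assumption 1 bounds only the form with the error covariance, so this constant is
  derived, in \<open>XtX_coercive\<close>.\<close>

definition gram_const :: "real \<Rightarrow> real \<Rightarrow> real \<Rightarrow> real \<Rightarrow> real" where
  "gram_const a cb P k = 1 / (a\<^sup>2 * cb\<^sup>2 * (P * a)\<^sup>2 * k)"

text \<open>The summands belong to the fluctuation of near pairs, the truncation bias, the cross
  terms and the term quadratic in the estimation error; \<open>P\<^sup>2\<close> counts matrix
  entries.\<close>

definition shat_const :: "real \<Rightarrow> real \<Rightarrow> real \<Rightarrow> real \<Rightarrow> real \<Rightarrow> real \<Rightarrow> real" where
  "shat_const a cb cc P k k' = P\<^sup>2 * (a\<^sup>2 * dev_const cb cc k) + P\<^sup>2 * (a\<^sup>2 * cb * k'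
     + a\<^sup>2 * (P * a) * (P * a / (gram_const a cb P k)\<^sup>2 * cc + a\<^sup>2 * cc)
     + a\<^sup>2 * (P * a)\<^sup>2 * (P * a / (gram_const a cb P k)\<^sup>2 * cc))"

text \<open>The parameter \<open>P\<close> names the dimension as a term, so that the constants of the locale carry no type argument.\<close>
locale network_regression = network_errors M n e d a cb \<rho> ch c1 cc
  for M :: "'w measure" and n e d a cb \<rho> ch c1 cc +
  fixes x :: "nat \<Rightarrow> real^'p" and beta :: "real^'p" and P :: real
  assumes P_eq: "P = CARD('p)" and x_bound: "\<And>i j. i < n \<Longrightarrow> \<bar>x i $ j\<bar> \<le> a"
    and variance_bounds: "\<And>v. (1 / a) * (v \<bullet> v) \<le> v \<bullet> ((XtSigmaX n x M e /\<^sub>R n) *v v)"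
      "\<And>v. v \<bullet> ((XtSigmaX n x M e /\<^sub>R n) *v v) \<le> a * (v \<bullet> v)"
begin

abbreviation "A \<equiv> XtSigmaX n x M e"
abbreviation "X0 \<equiv> P * a"

definition Z :: "'w \<Rightarrow> real^'p" where "Z w = (\<Sum>i<n. e w i *\<^sub>R x i)"

lemma x_norm: "i < n \<Longrightarrow> norm (x i) \<le> X0"
  using norm_le_card_bound[of "x i" a] x_bound P_eq by simp

lemma P_pos: "P > 0" using P_eq by simp

lemma X0_nonneg: "X0 \<ge> 0" using a_pos P_pos by simp

lemma Z_measurable [measurable]: "Z \<in> borel_measurable M"
  unfolding Z_def by simp

lemma A_spectrum: "spectrum_between (n / a) (n * a) A"
proof -
  have eq: "v \<bullet> ((A /\<^sub>R n) *v v) = (v \<bullet> (A *v v)) / n" for v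
    by (simp add: scaleR_matrix_vector_assoc[symmetric] divide_inverse)
  have "(n / a) * (v \<bullet> v) \<le> v \<bullet> (A *v v) \<and> v \<bullet> (A *v v) \<le> (n * a) * (v \<bullet> v)" for v
    using variance_bounds[of v] n_pos a_pos unfolding eq by (simp add: field_simps)
  moreover have "transpose A = A"
    unfolding transpose_def XtSigmaX_def vec_eq_iff
    by (auto simp: S_sym mult_ac intro: sum.swap[THEN trans] sum.cong)
  ultimately show ?thesis unfolding spectrum_between_def by blast
qed

lemma A_pos_def: "pos_def A"
  by (rule spectrum_between_pos_def[OF _ A_spectrum]) (use n_pos a_pos in simp)

abbreviation "G \<equiv> gram_const a cb P (KR \<rho>)"

lemma KR_pos: "KR \<rho> > 0"
  using rate cc_pos by (simp add: decay_const_def)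

lemma G_pos: "G > 0"
  unfolding gram_const_def using a_pos cb_pos KR_pos P_pos by simp

text \<open>With \<open>u i = x i \<bullet> v\<close>, the form of \<open>A\<close> is at most
  \<open>cb\<close> times the sum of \<open>(u i)\<^sup>2 * R \<rho> i\<close>. The single
  \<open>R \<rho> i\<close> may be large and only their mean square is controlled, so Cauchy-Schwarz
  is used. The fourth powers of \<open>u i\<close> cost one factor
  \<open>X0\<^sup>2 * (v \<bullet> v)\<close> and return the sum of \<open>(u i)\<^sup>2\<close>,
  which can be solved for.\<close>

lemma XtX_coercive: "G * n * (v \<bullet> v) \<le> v \<bullet> (XtX n x *v v)"
proof (cases "v = 0")
  case False
  define u where "u i = x i \<bullet> v" for i
  have form: "v \<bullet> (XtX n x *v v) = (\<Sum>i<n. (u i)\<^sup>2)"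
    unfolding XtX_mult by (simp add: u_def inner_sum_right inner_commute power2_eq_square)
  have ub: "\<bar>u i\<bar> \<le> X0 * norm v" if "i < n" for i
    unfolding u_def by (rule order_trans[OF Cauchy_Schwarz_ineq2]) (intro mult_right_mono x_norm that norm_ge_zero)
  have "(n / a) * (v \<bullet> v) \<le> v \<bullet> (A *v v)" using A_spectrum by (simp add: spectrum_between_def)
  also have "\<dots> = (\<Sum>i<n. \<Sum>j<n. u i * u j * S i j)" unfolding XtSigmaX_form u_def ..
  also have "\<dots> \<le> (\<Sum>i<n. \<Sum>j<n. ((u i)\<^sup>2 + (u j)\<^sup>2) / 2 * (cb * \<rho> powr d i j))"
  proof (intro sum_mono)
    fix i j assume ij: "i \<in> {..<n}" "j \<in> {..<n}"
    have "\<bar>u i * u j\<bar> \<le> ((u i)\<^sup>2 + (u j)\<^sup>2) / 2"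
      using sum_squares_bound[of "\<bar>u i\<bar>" "\<bar>u j\<bar>"] by (simp add: abs_mult)
    then have "\<bar>u i * u j\<bar> * \<bar>S i j\<bar> \<le> ((u i)\<^sup>2 + (u j)\<^sup>2) / 2 * (cb * \<rho> powr d i j)"
      using S_bound[of i j] ij by (intro mult_mono) auto
    then show "u i * u j * S i j \<le> ((u i)\<^sup>2 + (u j)\<^sup>2) / 2 * (cb * \<rho> powr d i j)"
      unfolding abs_mult[symmetric] by linarith
  qed
  also have "\<dots> = cb * (\<Sum>i<n. (u i)\<^sup>2 * R \<rho> i)"
  proof -
    have "(\<Sum>i<n. \<Sum>j<n. ((u i)\<^sup>2 + (u j)\<^sup>2) / 2 * (cb * \<rho> powr d i j))
      = cb / 2 * (\<Sum>i<n. \<Sum>j<n. (u i)\<^sup>2 * \<rho> powr d i j) + cb / 2 * (\<Sum>i<n. \<Sum>j<n. (u j)\<^sup>2 * \<rho> powr d i j)"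
      unfolding sum_distrib_left sum.distrib[symmetric] by (intro sum.cong refl) (simp add: algebra_simps add_divide_distrib)
    also have "(\<Sum>i<n. \<Sum>j<n. (u j)\<^sup>2 * \<rho> powr d i j) = (\<Sum>i<n. \<Sum>j<n. (u i)\<^sup>2 * \<rho> powr d i j)"
      by (subst sum.swap) (auto intro!: sum.cong simp: d_sym)
    finally show ?thesis by (simp add: decay_sum_def sum_distrib_left)
  qed
  finally have 1: "(n / a) * (v \<bullet> v) \<le> cb * (\<Sum>i<n. (u i)\<^sup>2 * R \<rho> i)" .
  have "((n / a) * (v \<bullet> v))\<^sup>2 \<le> (cb * (\<Sum>i<n. (u i)\<^sup>2 * R \<rho> i))\<^sup>2"
    using 1 a_pos by (intro power_mono) auto
  also have "\<dots> \<le> cb\<^sup>2 * ((\<Sum>i<n. ((u i)\<^sup>2)\<^sup>2) * (\<Sum>i<n. (R \<rho> i)\<^sup>2))"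
    unfolding power_mult_distrib by (intro mult_left_mono Cauchy_Schwarz_ineq_sum) auto
  also have "\<dots> \<le> cb\<^sup>2 * ((X0\<^sup>2 * (v \<bullet> v) * (\<Sum>i<n. (u i)\<^sup>2)) * (n * KR \<rho>))"
  proof (intro mult_left_mono mult_mono)
    show "(\<Sum>i<n. ((u i)\<^sup>2)\<^sup>2) \<le> X0\<^sup>2 * (v \<bullet> v) * (\<Sum>i<n. (u i)\<^sup>2)"
      unfolding sum_distrib_left
    proof (intro sum_mono)
      fix i assume "i \<in> {..<n}"
      then have "(u i)\<^sup>2 \<le> (X0 * norm v)\<^sup>2" using power_mono[OF ub abs_ge_zero, of i 2] by simp
      then show "((u i)\<^sup>2)\<^sup>2 \<le> X0\<^sup>2 * (v \<bullet> v) * (u i)\<^sup>2"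
        unfolding power2_eq_square[of "(u i)\<^sup>2"] by (intro mult_right_mono) (auto simp: power_mult_distrib dot_square_norm)
    qed
    show "(\<Sum>i<n. (R \<rho> i)\<^sup>2) \<le> n * KR \<rho>" using rho rate by (intro decay_sum_power) auto
  qed (auto intro!: sum_nonneg mult_nonneg_nonneg)
  finally have "(n * (v \<bullet> v)) * (n * (v \<bullet> v)) \<le> (n * (v \<bullet> v)) * (a\<^sup>2 * cb\<^sup>2 * X0\<^sup>2 * KR \<rho> * (\<Sum>i<n. (u i)\<^sup>2))"
    using a_pos by (simp add: power_divide power_mult_distrib pos_divide_le_eq power2_eq_square mult_ac)
  moreover have "n * (v \<bullet> v) > 0" using n_pos False by simp
  ultimately have "n * (v \<bullet> v) \<le> a\<^sup>2 * cb\<^sup>2 * X0\<^sup>2 * KR \<rho> * (\<Sum>i<n. (u i)\<^sup>2)" by (simp only: mult_le_cancel_left_pos)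
  then show ?thesis unfolding form gram_const_def using a_pos cb_pos KR_pos P_pos by (simp add: pos_divide_le_eq mult_ac)
qed simp

lemma G_n_pos: "G * n > 0" using G_pos n_pos by simp

definition \<delta> :: "'w \<Rightarrow> real^'p" where "\<delta> w = betahat n x beta (e w) - beta"

lemma delta_eq: "\<delta> w = matrix_inv (XtX n x) *v Z w"
proof -
  note inv = coercive_invertible[OF G_n_pos XtX_coercive]
  have "(\<Sum>i<n. Yobs x beta (e w) i *\<^sub>R x i) = XtX n x *v beta + Z w"
    unfolding Yobs_def XtX_mult Z_def by (simp add: scaleR_add_left sum.distrib)
  then have "betahat n x beta (e w) = beta + matrix_inv (XtX n x) *v Z w"
    unfolding betahat_def by (simp add: matrix_vector_right_distrib matrix_vector_mul_assoc inv)
  then show ?thesis by (simp add: \<delta>_def)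
qed

lemma XtX_delta: "XtX n x *v \<delta> w = Z w"
  unfolding delta_eq using coercive_invertible(1)[OF G_n_pos XtX_coercive] by (simp add: matrix_vector_mul_assoc)

text \<open>The Gram matrix cancels against its inverse in the estimator, so only the inverse square
  root and \<open>Z\<close> remain.\<close>

lemma stat_eq: "stat n x d m beta (e w) = inv_sqrtm (Shat n x d m beta (e w)) *v Z w"
  unfolding stat_def \<delta>_def[symmetric] XtX_delta ..

lemma delta_norm: "norm (\<delta> w) \<le> norm (Z w) / (G * n)"
  unfolding delta_eq by (rule coercive_inverse_bound[OF G_n_pos XtX_coercive])

lemma resid_eq: "resid n x beta (e w) i = e w i - x i \<bullet> \<delta> w"
  by (simp add: resid_def Yobs_def \<delta>_def inner_diff_right)

text \<open>The second moment is the trace of \<open>A\<close>, and each diagonal entry is a value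
  of the quadratic form at a unit vector.\<close>

lemma Z_second_moment:
  "integrable M (\<lambda>w. (norm (Z w))\<^sup>2)" "expectation (\<lambda>w. (norm (Z w))\<^sup>2) \<le> n * (P * a)"
proof -
  have eq: "(norm (Z w))\<^sup>2 = (\<Sum>r\<in>UNIV. \<Sum>i<n. \<Sum>j<n. x i $ r * x j $ r * (e w i * e w j))" for w
    unfolding power2_norm_eq_inner inner_vec_def Z_def by (simp add: sum_product mult_ac)
  have i: "integrable M (\<lambda>w. \<Sum>i<n. \<Sum>j<n. x i $ r * x j $ r * (e w i * e w j))" for r
    by (rule integral_double_sum(1)) (auto intro: int2)
  show "integrable M (\<lambda>w. (norm (Z w))\<^sup>2)" unfolding eq by (intro Bochner_Integration.integrable_sum i)
  have "expectation (\<lambda>w. (norm (Z w))\<^sup>2) = (\<Sum>r\<in>UNIV. expectation (\<lambda>w. \<Sum>i<n. \<Sum>j<n. x i $ r * x j $ r * (e w i * e w j)))"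
    unfolding eq by (intro Bochner_Integration.integral_sum i)
  also have "\<dots> = (\<Sum>r\<in>UNIV. axis r 1 \<bullet> (A *v axis r 1))"
  proof (intro sum.cong refl)
    fix r
    show "expectation (\<lambda>w. \<Sum>i<n. \<Sum>j<n. x i $ r * x j $ r * (e w i * e w j)) = axis r 1 \<bullet> (A *v axis r 1)"
      unfolding XtSigmaX_form by (subst integral_double_sum(2)) (auto intro: int2 simp: inner_axis Defs.Sigma_def)
  qed
  also have "\<dots> \<le> (\<Sum>r\<in>(UNIV :: 'p set). n * a)"
  proof (intro sum_mono)
    fix r :: 'p
    have "axis r 1 \<bullet> (A *v axis r 1) \<le> (n * a) * (axis r 1 \<bullet> axis r (1::real))" using A_spectrum unfolding spectrum_between_def by blast
    then show "axis r 1 \<bullet> (A *v axis r 1) \<le> n * a" by (simp add: inner_axis_axis)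
  qed
  finally show "expectation (\<lambda>w. (norm (Z w))\<^sup>2) \<le> n * (P * a)" by (simp add: mult_ac P_eq)
qed


text \<open>Absolute errors weighted by ball sizes: the factor of \<open>norm (\<delta> w)\<close>
  in the cross terms between errors and fitted values.\<close>

definition Y :: "real \<Rightarrow> 'w \<Rightarrow> real" where "Y m w = (\<Sum>i<n. N m i * \<bar>e w i\<bar>) / n"

definition V :: "real \<Rightarrow> 'p \<Rightarrow> 'p \<Rightarrow> 'w \<Rightarrow> real" where
  "V m r s w = (\<Sum>i<n. \<Sum>j<n. (x i $ r * x j $ s * near m i j) * (e w i * e w j)) / n
     - (\<Sum>i<n. \<Sum>j<n. (x i $ r * x j $ s * near m i j) * S i j) / n"

abbreviation "L m \<equiv> cc * exp (c1 * m)"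

lemma mean_N_le: "m \<ge> 0 \<Longrightarrow> (\<Sum>i<n. N m i) / n \<le> L m"
proof -
  assume m: "m \<ge> 0"
  have "(\<Sum>i<n. N m i) \<le> (\<Sum>i<n. N m i ^ 2)"
  proof (intro sum_mono)
    fix i
    have "k \<le> k ^ 2" for k :: nat by (simp add: power2_eq_square)
    then show "N m i \<le> N m i ^ 2" by (metis of_nat_le_iff of_nat_power)
  qed
  also have "\<dots> \<le> n * L m" by (rule growth2[OF m])
  finally show ?thesis using n_pos by (simp add: pos_divide_le_eq mult.commute)
qed

lemma Y_second_moment:
  assumes m: "m \<ge> 0"
  shows "integrable M (\<lambda>w. (Y m w)\<^sup>2)" "expectation (\<lambda>w. (Y m w)\<^sup>2) \<le> a\<^sup>2 * (L m)\<^sup>2"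
proof -
  have eq: "(Y m w)\<^sup>2 = (\<Sum>i<n. \<Sum>j<n. N m i * N m j / n\<^sup>2 * \<bar>e w i * e w j\<bar>)" for w
    unfolding Y_def power_divide power2_eq_square sum_product sum_divide_distrib
    by (intro sum.cong refl) (simp add: abs_mult)
  have i: "integrable M (\<lambda>w. \<bar>e w i * e w j\<bar>)" if "i \<in> {..<n}" "j \<in> {..<n}" for i j
    using that by (intro integrable_abs int2) auto
  show "integrable M (\<lambda>w. (Y m w)\<^sup>2)" unfolding eq by (rule integral_double_sum(1)[OF i])
  have "expectation (\<lambda>w. (Y m w)\<^sup>2) = (\<Sum>i<n. \<Sum>j<n. N m i * N m j / n\<^sup>2 * expectation (\<lambda>w. \<bar>e w i * e w j\<bar>))"
    unfolding eq by (rule integral_double_sum(2)[OF i])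
  also have "\<dots> \<le> (\<Sum>i<n. \<Sum>j<n. N m i * N m j / n\<^sup>2 * a\<^sup>2)"
    by (intro sum_mono mult_left_mono mom2) auto
  also have "\<dots> = a\<^sup>2 * ((\<Sum>i<n. N m i) / n)\<^sup>2"
    unfolding power_divide power2_eq_square[of "sum _ _"] sum_product sum_divide_distrib
    by (simp add: sum_distrib_left power2_eq_square mult_ac)
  also have "\<dots> \<le> a\<^sup>2 * (L m)\<^sup>2"
    using mean_N_le[OF m] by (intro mult_left_mono power_mono) (auto intro!: divide_nonneg_nonneg sum_nonneg)
  finally show "expectation (\<lambda>w. (Y m w)\<^sup>2) \<le> a\<^sup>2 * (L m)\<^sup>2" .
qed

lemma Shat_entry: "Shat n x d m beta (e w) $ r $ s = (\<Sum>i<n. \<Sum>j<n. x i $ r * x j $ s * near m i j *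
    ((e w i - x i \<bullet> \<delta> w) * (e w j - x j \<bullet> \<delta> w)))"
proof -
  have "(\<Sum>j\<in>B m i. f j) = (\<Sum>j<n. near m i j * f j)" for i and f :: "nat \<Rightarrow> real"
  proof -
    have "B m i = {..<n} \<inter> {j. d i j \<le> m}" by auto
    then show ?thesis by simp
  qed
  then show ?thesis unfolding Shat_def resid_eq by (simp only: vec_lambda_beta) (intro sum.cong refl, simp)
qed

text \<open>Residuals are \<open>e w i - x i \<bullet> \<delta> w\<close>, so the product has four
  parts. The product of errors gives \<open>V\<close> and, after centering, the far-pair bias; the
  two mixed parts give the \<open>Y\<close> term; the last part is quadratic in
  \<open>\<delta>\<close> and multiplies the mean ball size, at most \<open>L m\<close>.\<close>

lemma Shat_entry_deviation:
  assumes m: "m \<ge> 0" and r: "\<rho> < r" "r < 1" "r * exp (2 * c1) < 1"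
  shows "\<bar>(Shat n x d m beta (e w) $ k $ l - A $ k $ l) / n\<bar> \<le> \<bar>V m k l w\<bar> + a\<^sup>2 * cb * KR r * (\<rho> / r) powr m
    + 2 * (a\<^sup>2 * X0 * (norm (\<delta> w) * Y m w)) + a\<^sup>2 * X0\<^sup>2 * L m * (norm (\<delta> w))\<^sup>2"
proof -
  define \<alpha> where "\<alpha> i j = x i $ k * x j $ l" for i j
  define h where "h i = x i \<bullet> \<delta> w" for i
  have \<alpha>: "\<bar>\<alpha> i j\<bar> \<le> a\<^sup>2" if "i < n" "j < n" for i j
    unfolding \<alpha>_def abs_mult power2_eq_square using that x_bound a_pos by (intro mult_mono) auto
  have h: "\<bar>h i\<bar> \<le> X0 * norm (\<delta> w)" if "i < n" for i
    unfolding h_def by (rule order_trans[OF Cauchy_Schwarz_ineq2]) (intro mult_right_mono x_norm that norm_ge_zero)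
  let ?E = "\<lambda>i j. \<alpha> i j * near m i j * (h i * h j - e w i * h j - h i * e w j)"
  have "Shat n x d m beta (e w) $ k $ l - A $ k $ l = (\<Sum>i<n. \<Sum>j<n. \<alpha> i j * near m i j * (e w i * e w j)) + (\<Sum>i<n. \<Sum>j<n. ?E i j)
    - (\<Sum>i<n. \<Sum>j<n. \<alpha> i j * near m i j * S i j) - (\<Sum>i<n. \<Sum>j<n. \<alpha> i j * (1 - near m i j) * S i j)"
  proof -
    have "Shat n x d m beta (e w) $ k $ l - A $ k $ l = (\<Sum>i<n. \<Sum>j<n. \<alpha> i j * near m i j * ((e w i - h i) * (e w j - h j)) - \<alpha> i j * S i j)"
      unfolding Shat_entry XtSigmaX_def \<alpha>_def h_def by (simp only: vec_lambda_beta sum_subtractf)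
    also have "\<dots> = (\<Sum>i<n. \<Sum>j<n. \<alpha> i j * near m i j * (e w i * e w j) + ?E i j
      - \<alpha> i j * near m i j * S i j - \<alpha> i j * (1 - near m i j) * S i j)"
      by (intro sum.cong refl) (simp only: algebra_simps)
    finally show ?thesis by (simp only: sum.distrib sum_subtractf)
  qed
  then have split: "(Shat n x d m beta (e w) $ k $ l - A $ k $ l) / n = V m k l w + (\<Sum>i<n. \<Sum>j<n. ?E i j) / n
    - (\<Sum>i<n. \<Sum>j<n. \<alpha> i j * (1 - near m i j) * S i j) / n"
    unfolding V_def \<alpha>_def by (simp add: diff_divide_distrib add_divide_distrib)
  have far: "\<bar>(\<Sum>i<n. \<Sum>j<n. \<alpha> i j * (1 - near m i j) * S i j) / n\<bar> \<le> a\<^sup>2 * cb * KR r * (\<rho> / r) powr m"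
    by (rule far_pairs_bound[OF m _ r \<alpha>]) auto
  let ?D = "norm (\<delta> w)"
  have "\<bar>\<Sum>i<n. \<Sum>j<n. ?E i j\<bar> \<le> (\<Sum>i<n. \<Sum>j<n. near m i j * (a\<^sup>2 * (X0 * ?D)\<^sup>2) + near m i j * (a\<^sup>2 * (X0 * ?D) * \<bar>e w i\<bar>)
      + near m i j * (a\<^sup>2 * (X0 * ?D) * \<bar>e w j\<bar>))"
  proof (intro order_trans[OF sum_abs] sum_mono)
    fix i j assume ij: "i \<in> {..<n}" "j \<in> {..<n}"
    have "\<bar>h i * h j - e w i * h j - h i * e w j\<bar> \<le> \<bar>h i\<bar> * \<bar>h j\<bar> + \<bar>e w i\<bar> * \<bar>h j\<bar> + \<bar>h i\<bar> * \<bar>e w j\<bar>"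
      unfolding abs_mult[symmetric] by linarith
    also have "\<dots> \<le> (X0 * ?D) * (X0 * ?D) + \<bar>e w i\<bar> * (X0 * ?D) + (X0 * ?D) * \<bar>e w j\<bar>"
      using h ij X0_nonneg by (intro add_mono mult_mono) auto
    finally have "\<bar>\<alpha> i j\<bar> * \<bar>h i * h j - e w i * h j - h i * e w j\<bar> \<le> a\<^sup>2 * ((X0 * ?D) * (X0 * ?D) + \<bar>e w i\<bar> * (X0 * ?D) + (X0 * ?D) * \<bar>e w j\<bar>)"
      using \<alpha> ij by (intro mult_mono) auto
    then have "near m i j * (\<bar>\<alpha> i j\<bar> * \<bar>h i * h j - e w i * h j - h i * e w j\<bar>) \<le> near m i j * (a\<^sup>2 * ((X0 * ?D) * (X0 * ?D) + \<bar>e w i\<bar> * (X0 * ?D) + (X0 * ?D) * \<bar>e w j\<bar>))"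
      by (rule mult_left_mono) simp
    moreover have "\<bar>?E i j\<bar> = near m i j * (\<bar>\<alpha> i j\<bar> * \<bar>h i * h j - e w i * h j - h i * e w j\<bar>)"
      by (simp add: abs_mult)
    moreover have "b * (a2 * (q * q + ei * q + q * ej)) = b * (a2 * q\<^sup>2) + b * (a2 * q * ei) + b * (a2 * q * ej)" for b a2 q ei ej :: real
      by (simp add: power2_eq_square algebra_simps)
    ultimately show "\<bar>?E i j\<bar> \<le> near m i j * (a\<^sup>2 * (X0 * ?D)\<^sup>2) + near m i j * (a\<^sup>2 * (X0 * ?D) * \<bar>e w i\<bar>)
      + near m i j * (a\<^sup>2 * (X0 * ?D) * \<bar>e w j\<bar>)"
      by (simp only:)
  qed
  also have "\<dots> = (\<Sum>i<n. N m i * (a\<^sup>2 * (X0 * ?D)\<^sup>2)) + (\<Sum>i<n. N m i * (a\<^sup>2 * (X0 * ?D) * \<bar>e w i\<bar>)) + (\<Sum>i<n. N m i * (a\<^sup>2 * (X0 * ?D) * \<bar>e w i\<bar>))"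
    unfolding sum.distrib near_sums(1)[where F = "\<lambda>i. a\<^sup>2 * (X0 * ?D)\<^sup>2"] near_sums(1)[where F = "\<lambda>i. a\<^sup>2 * (X0 * ?D) * \<bar>e w i\<bar>"]
      near_sums(2)[where F = "\<lambda>i. a\<^sup>2 * (X0 * ?D) * \<bar>e w i\<bar>"] ..
  also have "\<dots> = (a\<^sup>2 * (X0 * ?D)\<^sup>2) * (\<Sum>i<n. N m i) + 2 * (a\<^sup>2 * (X0 * ?D) * (\<Sum>i<n. N m i * \<bar>e w i\<bar>))"
    by (simp add: sum_distrib_left sum_distrib_right mult_ac)
  finally have "\<bar>(\<Sum>i<n. \<Sum>j<n. ?E i j) / n\<bar> \<le> ((a\<^sup>2 * (X0 * ?D)\<^sup>2) * (\<Sum>i<n. N m i) + 2 * (a\<^sup>2 * (X0 * ?D) * (\<Sum>i<n. N m i * \<bar>e w i\<bar>))) / n"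
    unfolding abs_divide abs_of_nat by (rule divide_right_mono) simp
  also have "\<dots> = (a\<^sup>2 * X0\<^sup>2 * ?D\<^sup>2) * ((\<Sum>i<n. N m i) / n) + 2 * (a\<^sup>2 * X0 * (?D * Y m w))"
    by (simp add: Y_def add_divide_distrib power_mult_distrib mult_ac)
  also have "\<dots> \<le> (a\<^sup>2 * X0\<^sup>2 * ?D\<^sup>2) * L m + 2 * (a\<^sup>2 * X0 * (?D * Y m w))"
    by (intro add_right_mono mult_left_mono mean_N_le m) auto
  finally have cross: "\<bar>(\<Sum>i<n. \<Sum>j<n. ?E i j) / n\<bar> \<le> 2 * (a\<^sup>2 * X0 * (?D * Y m w)) + a\<^sup>2 * X0\<^sup>2 * L m * ?D\<^sup>2"
    by (simp only: mult_ac add_ac)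
  show ?thesis unfolding split using far cross by linarith
qed

text \<open>An integrable majorant that holds pointwise. The product of
  \<open>norm (\<delta> w)\<close> and \<open>Y m w\<close> is separated by AM-GM with weight
  \<open>sqrt n * L m\<close>; the squares have means of order \<open>1 / n\<close> and
  \<open>(L m)\<^sup>2\<close>, so this weight makes both halves of order
  \<open>L m / sqrt n\<close>.\<close>

definition shat_error :: "real \<Rightarrow> real \<Rightarrow> 'w \<Rightarrow> real" where
  "shat_error r m w = (\<Sum>k\<in>UNIV. \<Sum>l\<in>UNIV. \<bar>V m k l w\<bar>) + P\<^sup>2 * (a\<^sup>2 * cb * KR r * (\<rho> / r) powr m
    + a\<^sup>2 * X0 * (sqrt n * L m * ((norm (Z w))\<^sup>2 / (G * n)\<^sup>2) + (Y m w)\<^sup>2 / (sqrt n * L m))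
    + a\<^sup>2 * X0\<^sup>2 * L m * ((norm (Z w))\<^sup>2 / (G * n)\<^sup>2))"

lemma L_pos: "L m > 0" using cc_pos by simp

lemma Shat_deviation:
  assumes m: "m \<ge> 0" and r: "\<rho> < r" "r < 1" "r * exp (2 * c1) < 1"
  shows "norm (Shat n x d m beta (e w) - A) / n \<le> shat_error r m w"
proof -
  let ?W = "(norm (Z w))\<^sup>2 / (G * n)\<^sup>2"
  let ?T = "a\<^sup>2 * cb * KR r * (\<rho> / r) powr m
    + a\<^sup>2 * X0 * (sqrt n * L m * ?W + (Y m w)\<^sup>2 / (sqrt n * L m)) + a\<^sup>2 * X0\<^sup>2 * L m * ?W"
  have W: "(norm (\<delta> w))\<^sup>2 \<le> ?W"
    using power_mono[OF delta_norm norm_ge_zero, of w 2] by (simp only: power_divide)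
  have th: "sqrt n * L m > 0" using n_pos L_pos by simp
  have "2 * (norm (\<delta> w) * Y m w) \<le> sqrt n * L m * (norm (\<delta> w))\<^sup>2 + (Y m w)\<^sup>2 / (sqrt n * L m)"
  proof -
    let ?s = "sqrt (sqrt n * L m)"
    have s: "?s > 0" "?s\<^sup>2 = sqrt n * L m" using th by auto
    have "2 * (?s * norm (\<delta> w)) * (Y m w / ?s) \<le> (?s * norm (\<delta> w))\<^sup>2 + (Y m w / ?s)\<^sup>2" by (rule sum_squares_bound)
    then show ?thesis using s n_pos cc_pos by (simp only: power_mult_distrib power_divide) simp
  qed
  also have "\<dots> \<le> sqrt n * L m * ?W + (Y m w)\<^sup>2 / (sqrt n * L m)"
    using th W by (intro add_right_mono mult_left_mono) auto
  finally have am: "2 * (norm (\<delta> w) * Y m w) \<le> sqrt n * L m * ?W + (Y m w)\<^sup>2 / (sqrt n * L m)" .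
  have e1: "2 * (a\<^sup>2 * X0 * (norm (\<delta> w) * Y m w)) \<le> a\<^sup>2 * X0 * (sqrt n * L m * ?W + (Y m w)\<^sup>2 / (sqrt n * L m))"
    using mult_left_mono[OF am, of "a\<^sup>2 * X0"] X0_nonneg by (simp only: mult.left_commute[of _ 2]) simp
  have e2: "a\<^sup>2 * X0\<^sup>2 * L m * (norm (\<delta> w))\<^sup>2 \<le> a\<^sup>2 * X0\<^sup>2 * L m * ?W"
    using W L_pos[of m] by (intro mult_left_mono) auto
  have "norm (Shat n x d m beta (e w) - A) / n \<le> (\<Sum>k\<in>UNIV. \<Sum>l\<in>UNIV. \<bar>(Shat n x d m beta (e w) - A) $ k $ l\<bar>) / n"
    by (intro divide_right_mono norm_matrix_le_sum_abs) simp
  also have "\<dots> = (\<Sum>k\<in>UNIV. \<Sum>l\<in>UNIV. \<bar>(Shat n x d m beta (e w) $ k $ l - A $ k $ l) / n\<bar>)"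
    by (simp add: sum_divide_distrib)
  also have "\<dots> \<le> (\<Sum>k\<in>UNIV. \<Sum>l\<in>UNIV. \<bar>V m k l w\<bar> + ?T)"
    by (intro sum_mono order_trans[OF Shat_entry_deviation[OF m r]]) (use e1 e2 in linarith)
  also have "\<dots> = shat_error r m w"
  proof -
    have "(\<Sum>k\<in>(UNIV :: 'p set). \<Sum>l\<in>(UNIV :: 'p set). f k l + t) = (\<Sum>k\<in>UNIV. \<Sum>l\<in>UNIV. f k l) + P\<^sup>2 * t"
      for f :: "'p \<Rightarrow> 'p \<Rightarrow> real" and t
      by (simp add: sum.distrib P_eq power2_eq_square)
    then show ?thesis unfolding shat_error_def .
  qed
  finally show ?thesis .
qed


lemma V_deviation:
  assumes m: "m \<ge> 0"
  shows "integrable M (V m k l)" "expectation (\<lambda>w. \<bar>V m k l w\<bar>) \<le> a\<^sup>2 * vbound m"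
proof -
  have b: "\<bar>x i $ k * x j $ l * near m i j\<bar> \<le> a\<^sup>2 * near m i j" if "i < n" "j < n" for i j
    unfolding abs_mult power2_eq_square using that x_bound a_pos by (intro mult_mono) auto
  show "integrable M (V m k l)" "expectation (\<lambda>w. \<bar>V m k l w\<bar>) \<le> a\<^sup>2 * vbound m"
    using near_pairs_deviation[OF m zero_le_power2 b] unfolding V_def by simp_all
qed

lemma shat_error_expectation:
  assumes m: "m \<ge> 0" and r: "\<rho> < r" "r < 1" "r * exp (2 * c1) < 1"
  shows "integrable M (shat_error r m)" "expectation (shat_error r m) \<le> shat_const a cb cc P (KR \<rho>) (KR r) * err r m"
proof -
  have r0: "r > 0" using rho r by simp
  note ge = rate_error_ge[OF r0, of m]
  let ?E1 = "\<lambda>w. \<Sum>k\<in>UNIV. \<Sum>l\<in>UNIV. \<bar>V m k l w\<bar>"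
  have i1: "integrable M ?E1" by (intro Bochner_Integration.integrable_sum integrable_abs V_deviation m)
  have iZ: "integrable M (\<lambda>w. (norm (Z w))\<^sup>2 / (G * n)\<^sup>2)" by (intro Bochner_Integration.integrable_divide Z_second_moment)
  have iY: "integrable M (\<lambda>w. (Y m w)\<^sup>2 / (sqrt n * L m))" by (intro Bochner_Integration.integrable_divide Y_second_moment m)
  show "integrable M (shat_error r m)" unfolding shat_error_def[abs_def]
    by (intro Bochner_Integration.integrable_add integrable_mult_right i1 iZ iY integrable_const)
  have "expectation (shat_error r m) = expectation ?E1 + P\<^sup>2 * (a\<^sup>2 * cb * KR r * (\<rho> / r) powr m
    + a\<^sup>2 * X0 * (sqrt n * L m * expectation (\<lambda>w. (norm (Z w))\<^sup>2 / (G * n)\<^sup>2) + expectation (\<lambda>w. (Y m w)\<^sup>2 / (sqrt n * L m)))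
    + a\<^sup>2 * X0\<^sup>2 * L m * expectation (\<lambda>w. (norm (Z w))\<^sup>2 / (G * n)\<^sup>2))"
    unfolding shat_error_def[abs_def] using i1 iZ iY
    by (simp only: Bochner_Integration.integral_add Bochner_Integration.integrable_add integrable_mult_right integral_mult_right_zero integrable_const lebesgue_integral_const prob_space) simp
  also have "\<dots> \<le> P\<^sup>2 * (a\<^sup>2 * dev_const cb cc (KR \<rho>)) * err r m + P\<^sup>2 * (a\<^sup>2 * cb * KR r * err r m
    + a\<^sup>2 * X0 * (P * a / G\<^sup>2 * cc * err r m + a\<^sup>2 * cc * err r m)
    + a\<^sup>2 * X0\<^sup>2 * (P * a / G\<^sup>2 * cc * err r m))"
  proof -
    have "expectation ?E1 = (\<Sum>k\<in>UNIV. \<Sum>l\<in>UNIV. expectation (\<lambda>w. \<bar>V m k l w\<bar>))"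
      using V_deviation(1)[OF m] by simp
    also have "\<dots> \<le> (\<Sum>k\<in>(UNIV::'p set). \<Sum>l\<in>(UNIV::'p set). a\<^sup>2 * vbound m)" by (intro sum_mono V_deviation m)
    also have "\<dots> = P\<^sup>2 * (a\<^sup>2 * vbound m)" by (simp add: P_eq power2_eq_square)
    also have "\<dots> \<le> P\<^sup>2 * (a\<^sup>2 * (dev_const cb cc (KR \<rho>) * err r m))"
      by (intro mult_left_mono vbound_le_rate m r0) auto
    finally have e1: "expectation ?E1 \<le> P\<^sup>2 * (a\<^sup>2 * dev_const cb cc (KR \<rho>)) * err r m" by (simp only: mult.assoc)
    have e2: "a\<^sup>2 * cb * KR r * (\<rho> / r) powr m \<le> a\<^sup>2 * cb * KR r * err r m"
      using cb_pos KR_nonneg[OF r(3)] by (intro mult_left_mono ge) auto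
    have EZ: "expectation (\<lambda>w. (norm (Z w))\<^sup>2 / (G * n)\<^sup>2) \<le> P * a / G\<^sup>2 / n"
    proof -
      have "expectation (\<lambda>w. (norm (Z w))\<^sup>2 / (G * n)\<^sup>2) \<le> n * (P * a) / (G * n)\<^sup>2"
        unfolding integral_divide_zero by (intro divide_right_mono Z_second_moment) simp
      also have "\<dots> = P * a / G\<^sup>2 / n" using n_pos by (simp add: power_mult_distrib power2_eq_square)
      finally show ?thesis .
    qed
    have PG: "0 \<le> P * a / G\<^sup>2" using P_pos a_pos by simp
    have Ln: "L m / sqrt n \<le> cc * err r m" using mult_left_mono[OF ge(2), of cc] cc_pos by simp
    have e3: "sqrt n * L m * expectation (\<lambda>w. (norm (Z w))\<^sup>2 / (G * n)\<^sup>2) \<le> P * a / G\<^sup>2 * cc * err r m"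
    proof -
      have "sqrt n * L m * expectation (\<lambda>w. (norm (Z w))\<^sup>2 / (G * n)\<^sup>2) \<le> sqrt n * L m * (P * a / G\<^sup>2 / n)"
        using L_pos[of m] by (intro mult_left_mono EZ) auto
      also have "\<dots> = (P * a / G\<^sup>2) * (L m * (sqrt n / n))" by simp
      also have "sqrt n / n = 1 / sqrt n" by (subst frac_eq_eq) (use n_pos in auto)
      also have "(P * a / G\<^sup>2) * (L m * (1 / sqrt n)) = (P * a / G\<^sup>2) * (L m / sqrt n)" by simp
      also have "\<dots> \<le> (P * a / G\<^sup>2) * (cc * err r m)" by (intro mult_left_mono Ln PG)
      finally show ?thesis by (simp only: mult.assoc)
    qed
    have e4: "expectation (\<lambda>w. (Y m w)\<^sup>2 / (sqrt n * L m)) \<le> a\<^sup>2 * cc * err r m"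
    proof -
      have "expectation (\<lambda>w. (Y m w)\<^sup>2 / (sqrt n * L m)) \<le> a\<^sup>2 * (L m)\<^sup>2 / (sqrt n * L m)"
        unfolding integral_divide_zero using L_pos[of m] by (intro divide_right_mono Y_second_moment m) auto
      also have "\<dots> = a\<^sup>2 * (L m / sqrt n)" using L_pos[of m] by (simp add: power2_eq_square)
      also have "\<dots> \<le> a\<^sup>2 * (cc * err r m)" by (intro mult_left_mono Ln) simp
      finally show ?thesis by (simp only: mult.assoc)
    qed
    have e5: "a\<^sup>2 * X0\<^sup>2 * L m * expectation (\<lambda>w. (norm (Z w))\<^sup>2 / (G * n)\<^sup>2) \<le> a\<^sup>2 * X0\<^sup>2 * (P * a / G\<^sup>2 * cc * err r m)"
    proof -
      have "1 * L m \<le> sqrt n * L m" using n_pos L_pos[of m] by (intro mult_right_mono) auto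
      then have "L m * expectation (\<lambda>w. (norm (Z w))\<^sup>2 / (G * n)\<^sup>2) \<le> sqrt n * L m * expectation (\<lambda>w. (norm (Z w))\<^sup>2 / (G * n)\<^sup>2)"
        by (intro mult_right_mono) (auto intro!: Bochner_Integration.integral_nonneg)
      then show ?thesis unfolding mult.assoc[of "a\<^sup>2 * X0\<^sup>2" "L m"] by (intro mult_left_mono) (use e3 in auto)
    qed
    show ?thesis using X0_nonneg by (intro add_mono mult_left_mono e1 e2 e3 e4 e5) auto
  qed
  also have "\<dots> = shat_const a cb cc P (KR \<rho>) (KR r) * err r m"
    unfolding shat_const_def by (simp only: distrib_left distrib_right mult.assoc)
  finally show "expectation (shat_error r m) \<le> shat_const a cb cc P (KR \<rho>) (KR r) * err r m" .
qed

lemma Shat_symmetric: "transpose (Shat n x d m beta (e w)) = Shat n x d m beta (e w)"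
proof -
  have "Shat n x d m beta (e w) $ s $ r = Shat n x d m beta (e w) $ r $ s" for r s
    unfolding Shat_entry by (subst sum.swap) (intro sum.cong refl, auto simp: near_sym d_sym mult_ac)
  then show ?thesis by (simp add: vec_eq_iff transpose_def)
qed

lemma Shat_measurable [measurable]: "(\<lambda>w. Shat n x d m beta (e w)) \<in> borel_measurable M"
proof -
  have [measurable]: "\<delta> \<in> borel_measurable M"
  proof -
    have "(\<lambda>w. matrix_inv (XtX n x) *v Z w) \<in> borel_measurable M"
      by (rule measurable_compose[OF Z_measurable]) (intro borel_measurable_continuous_onI linear_continuous_on matrix_vector_mul_bounded_linear)
    then show ?thesis unfolding delta_eq .
  qed
  have "(\<lambda>w. Shat n x d m beta (e w) $ r $ s) \<in> borel_measurable M" for r s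
    unfolding Shat_entry by measurable
  then show ?thesis
    by (subst borel_measurable_euclidean_space) (auto simp: Basis_vec_def inner_axis)
qed

lemma stat_measurable: "(\<lambda>w. stat n x d m beta (e w)) \<in> borel_measurable M"
  unfolding stat_eq by measurable


section \<open>Replacing the estimated covariance by the true one\<close>

abbreviation "H \<equiv> inv_sqrtm A"

text \<open>Where the estimator is within \<open>\<eta> * n\<close> of \<open>A\<close>, the
  Lipschitz bound for the inverse square root gives an error of order
  \<open>\<eta> / sqrt n\<close>, against \<open>norm (Z w)\<close> of order \<open>sqrt n\<close>.
  Elsewhere the trivial bound 2 is at most \<open>2 / \<eta>\<close> times
  \<open>shat_error\<close>, which is Markov's inequality in pointwise form.\<close>

lemma studentization_error:
  assumes m: "m \<ge> 0" and r: "\<rho> < r" "r < 1" "r * exp (2 * c1) < 1"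
    and \<eta>: "0 < \<eta>" "\<eta> \<le> 1 / (2 * a)" "\<eta> \<le> a"
  shows "cmod (expectation (\<lambda>w. iexp (v \<bullet> stat n x d m beta (e w))) - expectation (\<lambda>w. iexp (v \<bullet> (H *v Z w))))
    \<le> 2 / \<eta> * (shat_const a cb cc P (KR \<rho>) (KR r) * err r m) + norm v * (\<eta> * (sqrt (2 * a) * (2 * a\<^sup>2))) * sqrt (P * a)"
proof -
  let ?c = "norm v * (\<eta> * (sqrt (2 * a) * (2 * a\<^sup>2)))"
  have pt: "cmod (iexp (v \<bullet> stat n x d m beta (e w)) - iexp (v \<bullet> (H *v Z w))) \<le> 2 / \<eta> * shat_error r m w + ?c * (norm (Z w) / sqrt n)" for w
  proof -
    let ?Sh = "Shat n x d m beta (e w)"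
    note dev = Shat_deviation[OF m r, of w]
    have B0: "shat_error r m w \<ge> 0" by (rule order_trans[OF _ dev]) simp
    have c0: "?c * (norm (Z w) / sqrt n) \<ge> 0" using \<eta> a_pos by simp
    show ?thesis
    proof (cases "shat_error r m w \<le> \<eta>")
      \<comment> \<open>The estimator may fail to be positive definite here; any value of the
        statistic, including the one from the zero convention, is covered.\<close>
      case False
      have "cmod (iexp (v \<bullet> stat n x d m beta (e w)) - iexp (v \<bullet> (H *v Z w))) \<le> 1 + 1"
        by (rule order_trans[OF norm_triangle_ineq4]) simp
      also have "\<dots> \<le> 2 / \<eta> * shat_error r m w" using False \<eta> by (simp add: field_simps)
      finally show ?thesis using c0 by linarith
    next
      case True
      then have nd: "norm (?Sh - A) \<le> \<eta> * n" using dev n_pos by (simp add: pos_divide_le_eq) (metis mult_right_mono of_nat_0_le_iff order_trans)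
      have q: "\<bar>u \<bullet> (?Sh *v u) - u \<bullet> (A *v u)\<bar> \<le> (\<eta> * n) * (u \<bullet> u)" for u
      proof -
        have "\<bar>u \<bullet> (?Sh *v u) - u \<bullet> (A *v u)\<bar> = \<bar>u \<bullet> ((?Sh - A) *v u)\<bar>"
          by (simp add: matrix_vector_mult_diff_rdistrib inner_diff_right)
        also have "\<dots> \<le> norm u * norm ((?Sh - A) *v u)" by (rule Cauchy_Schwarz_ineq2)
        also have "\<dots> \<le> norm u * (norm (?Sh - A) * norm u)" by (intro mult_left_mono norm_matrix_vector_le) simp
        also have "\<dots> \<le> norm u * ((\<eta> * n) * norm u)" by (intro mult_left_mono mult_right_mono nd) auto
        finally show ?thesis by (simp add: dot_square_norm power2_eq_square mult_ac)
      qed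
      have ena: "\<eta> * n \<le> n / (2 * a)" "\<eta> * n \<le> n * a"
        using mult_right_mono[OF \<eta>(2), of "real n"] mult_right_mono[OF \<eta>(3), of "real n"] by (simp_all add: mult.commute)
      have bA: "(n / a) * (u \<bullet> u) \<le> u \<bullet> (A *v u)" "u \<bullet> (A *v u) \<le> (n * a) * (u \<bullet> u)" for u
        using A_spectrum by (auto simp: spectrum_between_def)
      have ha: "n / a = n / (2 * a) + n / (2 * a)" using a_pos by (simp add: field_simps)
      \<comment> \<open>\<open>\<eta> \<le> 1 / (2 * a)\<close> keeps at least half of the lower
        bound, and \<open>\<eta> \<le> a\<close> at most doubles the upper one.\<close>
      have bS: "spectrum_between (n / (2 * a)) (2 * n * a) ?Sh" unfolding spectrum_between_def
      proof (intro conjI allI Shat_symmetric)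
        fix u :: "real^'p"
        have e1: "(\<eta> * n) * (u \<bullet> u) \<le> (n / (2 * a)) * (u \<bullet> u)" "(\<eta> * n) * (u \<bullet> u) \<le> (n * a) * (u \<bullet> u)"
          by (rule mult_right_mono[OF ena(1) inner_ge_zero], rule mult_right_mono[OF ena(2) inner_ge_zero])
        show "(n / (2 * a)) * (u \<bullet> u) \<le> u \<bullet> (?Sh *v u)"
          using q[of u] bA(1)[of u] e1(1) unfolding ha distrib_right by linarith
        show "u \<bullet> (?Sh *v u) \<le> (2 * n * a) * (u \<bullet> u)"
          using q[of u] bA(2)[of u] e1(2) by (simp only: mult.assoc)
      qed
      have bA': "spectrum_between (n / (2 * a)) (2 * n * a) A" unfolding spectrum_between_def
      proof (intro conjI allI)
        show "transpose A = A" using A_spectrum by (simp add: spectrum_between_def)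
        fix u :: "real^'p"
        have "0 \<le> n / (2 * a) * (u \<bullet> u)" "0 \<le> n * a * (u \<bullet> u)" using a_pos by auto
        then show "(n / (2 * a)) * (u \<bullet> u) \<le> u \<bullet> (A *v u)" "u \<bullet> (A *v u) \<le> (2 * n * a) * (u \<bullet> u)"
          using bA[of u] unfolding ha distrib_right by (simp_all only: mult.assoc)
      qed
      have "norm (inv_sqrtm ?Sh - H) \<le> sqrt (2 * n * a) / (2 * (n / (2 * a))\<^sup>2) * norm (?Sh - A)"
        using n_pos a_pos by (intro inv_sqrtm_lipschitz bS bA') auto
      also have "\<dots> \<le> sqrt (2 * n * a) / (2 * (n / (2 * a))\<^sup>2) * (\<eta> * n)"
        using a_pos by (intro mult_left_mono nd) auto
      also have "\<dots> = (\<eta> * (sqrt (2 * a) * (2 * a\<^sup>2))) / sqrt n"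
      proof -
        have s: "sqrt (2 * n * a) = sqrt (2 * a) * sqrt n" by (simp add: real_sqrt_mult mult_ac)
        have "sqrt n * sqrt n = n" by simp
        then show ?thesis unfolding s using n_pos a_pos
          by (simp add: power2_eq_square divide_simps)
      qed
      finally have lip: "norm (inv_sqrtm ?Sh - H) \<le> (\<eta> * (sqrt (2 * a) * (2 * a\<^sup>2))) / sqrt n" .
      have "iexp s - iexp t = iexp t * (iexp (s - t) - 1)" for s t :: real
        by (simp add: algebra_simps flip: exp_add)
      then have "cmod (iexp s - iexp t) \<le> \<bar>s - t\<bar>" for s t :: real
        using iexp_approx1[of "s - t" 0] by (simp add: norm_mult)
      then have "cmod (iexp (v \<bullet> stat n x d m beta (e w)) - iexp (v \<bullet> (H *v Z w))) \<le> \<bar>v \<bullet> stat n x d m beta (e w) - v \<bullet> (H *v Z w)\<bar>" .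
      also have "\<dots> = \<bar>v \<bullet> ((inv_sqrtm ?Sh - H) *v Z w)\<bar>"
        unfolding stat_eq by (simp add: matrix_vector_mult_diff_rdistrib inner_diff_right)
      also have "\<dots> \<le> norm v * norm ((inv_sqrtm ?Sh - H) *v Z w)" by (rule Cauchy_Schwarz_ineq2)
      also have "\<dots> \<le> norm v * (norm (inv_sqrtm ?Sh - H) * norm (Z w))" by (intro mult_left_mono norm_matrix_vector_le) simp
      also have "\<dots> \<le> norm v * ((\<eta> * (sqrt (2 * a) * (2 * a\<^sup>2))) / sqrt n * norm (Z w))"
        by (intro mult_left_mono mult_right_mono lip) auto
      finally have "cmod (iexp (v \<bullet> stat n x d m beta (e w)) - iexp (v \<bullet> (H *v Z w))) \<le> ?c * (norm (Z w) / sqrt n)" by simp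
      moreover have "2 / \<eta> * shat_error r m w \<ge> 0" using B0 \<eta> by simp
      ultimately show ?thesis by linarith
    qed
  qed
  note stat_measurable[measurable]
  have is0: "integrable M (\<lambda>w. iexp (v \<bullet> stat n x d m beta (e w)))" by (rule integrable_iexp_rv) simp
  have iH: "integrable M (\<lambda>w. iexp (v \<bullet> (H *v Z w)))" by (rule integrable_iexp_rv) simp
  have nm: "(\<lambda>w. norm (Z w)) \<in> borel_measurable M" by simp
  note zi = integral_abs_le_sqrt[OF nm Z_second_moment(1)]
  have "expectation (\<lambda>w. iexp (v \<bullet> stat n x d m beta (e w))) - expectation (\<lambda>w. iexp (v \<bullet> (H *v Z w)))
    = expectation (\<lambda>w. iexp (v \<bullet> stat n x d m beta (e w)) - iexp (v \<bullet> (H *v Z w)))" using is0 iH by simp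
  then have "cmod (expectation (\<lambda>w. iexp (v \<bullet> stat n x d m beta (e w))) - expectation (\<lambda>w. iexp (v \<bullet> (H *v Z w))))
    \<le> expectation (\<lambda>w. 2 / \<eta> * shat_error r m w + ?c * (norm (Z w) / sqrt n))"
    using shat_error_expectation(1)[OF m r] zi(1) is0 iH by (simp only:) (intro cmod_integral_le pt; simp)
  also have "\<dots> = 2 / \<eta> * expectation (shat_error r m) + ?c * (expectation (\<lambda>w. norm (Z w)) / sqrt n)"
    using shat_error_expectation(1)[OF m r] zi(1) by (simp only: Bochner_Integration.integral_add integrable_mult_right Bochner_Integration.integrable_divide integral_mult_right_zero integral_divide_zero)
  also have "\<dots> \<le> 2 / \<eta> * (shat_const a cb cc P (KR \<rho>) (KR r) * err r m) + ?c * sqrt (P * a)"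
  proof (intro add_mono mult_left_mono shat_error_expectation m r)
    have "expectation (\<lambda>w. norm (Z w)) \<le> sqrt (expectation (\<lambda>w. (norm (Z w))\<^sup>2))" using zi(2) by simp
    also have "\<dots> \<le> sqrt (n * (P * a))" by (intro real_sqrt_le_mono Z_second_moment)
    finally show "expectation (\<lambda>w. norm (Z w)) / sqrt n \<le> sqrt (P * a)"
      using n_pos by (simp add: real_sqrt_mult pos_divide_le_eq mult.commute)
  qed (use \<eta> a_pos in auto)
  finally show ?thesis .
qed

text \<open>Prepares \<open>signed_clt\<close>: a linear functional of the whitened vector is a
  normalized weighted error sum. The inverse root of \<open>A\<close> has order
  \<open>1 / sqrt n\<close>, so the weights are bounded uniformly in \<open>n\<close>, and whitening
  makes the variance exactly \<open>(norm v)\<^sup>2\<close>.\<close>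

lemma whitened_weights:
  defines "u \<equiv> \<lambda>v i. sqrt n * (x i \<bullet> (H *v v))"
  shows "v \<bullet> (H *v Z w) = (\<Sum>i<n. u v i * e w i) / sqrt n"
    and "i < n \<Longrightarrow> \<bar>u v i\<bar> \<le> X0 * sqrt a * norm v"
    and "(\<Sum>i<n. \<Sum>j<n. u v i * u v j * S i j) / n = (norm v)\<^sup>2"
proof -
  note hf = inv_sqrtm_facts[OF A_pos_def]
  have "v \<bullet> (H *v Z w) = (H *v v) \<bullet> Z w" by (simp add: hf(3))
  also have "\<dots> = (\<Sum>i<n. e w i * (x i \<bullet> (H *v v)))" by (simp add: Z_def inner_sum_right inner_commute)
  also have "\<dots> = (\<Sum>i<n. u v i * e w i) / sqrt n"
    unfolding u_def sum_divide_distrib using n_pos by (intro sum.cong refl) simp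
  finally show "v \<bullet> (H *v Z w) = (\<Sum>i<n. u v i * e w i) / sqrt n" .
  have na: "real n / a > 0" using n_pos a_pos by simp
  have "(norm (H *v v))\<^sup>2 = v \<bullet> (matrix_inv A *v v)"
    unfolding power2_norm_eq_inner hf(3) using inv_sqrtm_spec(2)[OF A_pos_def] by (simp add: matrix_vector_mul_assoc)
  also have "\<dots> \<le> norm v * norm (matrix_inv A *v v)" by (rule norm_cauchy_schwarz)
  also have "\<dots> \<le> norm v * (norm v / (n / a))"
    using A_spectrum by (intro mult_left_mono coercive_inverse_bound[OF na]) (auto simp: spectrum_between_def)
  also have "\<dots> = (sqrt a * norm v / sqrt n)\<^sup>2"
    using a_pos n_pos by (simp add: power_divide power_mult_distrib) (simp add: power2_eq_square)
  finally have Hv: "norm (H *v v) \<le> sqrt a * norm v / sqrt n"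
    by (rule power2_le_imp_le) (use a_pos in simp)
  show "\<bar>u v i\<bar> \<le> X0 * sqrt a * norm v" if "i < n"
  proof -
    have "\<bar>x i \<bullet> (H *v v)\<bar> \<le> norm (x i) * norm (H *v v)" by (rule Cauchy_Schwarz_ineq2)
    also have "\<dots> \<le> X0 * (sqrt a * norm v / sqrt n)" using X0_nonneg by (intro mult_mono x_norm that Hv) auto
    finally have "sqrt n * \<bar>x i \<bullet> (H *v v)\<bar> \<le> sqrt n * (X0 * (sqrt a * norm v / sqrt n))" by (rule mult_left_mono) simp
    then show ?thesis unfolding u_def abs_mult using n_pos by simp
  qed
  have "(\<Sum>i<n. \<Sum>j<n. u v i * u v j * S i j) / n = (\<Sum>i<n. \<Sum>j<n. (x i \<bullet> (H *v v)) * (x j \<bullet> (H *v v)) * S i j)"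
  proof -
    have eq: "u v i * u v j * S i j = n * ((x i \<bullet> (H *v v)) * (x j \<bullet> (H *v v)) * S i j)" for i j
    proof -
      have "u v i * u v j * S i j = (sqrt n * sqrt n) * ((x i \<bullet> (H *v v)) * (x j \<bullet> (H *v v)) * S i j)"
        unfolding u_def by (simp only: mult_ac)
      then show ?thesis by simp
    qed
    show ?thesis unfolding eq sum_distrib_left[symmetric] using n_pos by simp
  qed
  also have "\<dots> = (H *v v) \<bullet> (A *v (H *v v))" unfolding XtSigmaX_form ..
  also have "\<dots> = v \<bullet> v" by (simp add: hf)
  finally show "(\<Sum>i<n. \<Sum>j<n. u v i * u v j * S i j) / n = (norm v)\<^sup>2" by (simp add: power2_norm_eq_inner)
qed

end

section \<open>Asymptotic normality\<close>

text \<open>At \<open>m = C * ln n\<close> the terms are powers of \<open>n\<close> with exponents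
  \<open>1 - C * ln (1 / \<rho>)\<close>, \<open>c1 * C - 1 / 2\<close>,
  \<open>C * ln (\<rho> / r)\<close> and \<open>- 1 / 2\<close>, all negative.\<close>

lemma rate_error_tendsto:
  assumes \<rho>: "0 < \<rho>" "\<rho> < r" and C: "C * ln (1 / \<rho>) > 1" "2 * c1 * C < 1" "C > 0"
  shows "(\<lambda>n. rate_error n \<rho> c1 r (C * ln (real n))) \<longlonglongrightarrow> 0"
proof -
  have lim: "(\<lambda>n. real n powr (- s)) \<longlonglongrightarrow> 0" if "s > 0" for s
    using tendsto_neg_powr[of "- s" "\<lambda>n. real n" sequentially] that filterlim_real_sequentially by simp
  have e: "\<forall>\<^sub>F n in sequentially. (n::nat) > 0" by (rule eventually_gt_at_top)
  have 1: "(\<lambda>n. real n * \<rho> powr (C * ln (real n))) \<longlonglongrightarrow> 0"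
  proof (rule Lim_transform_eventually[OF lim[of "C * ln (1 / \<rho>) - 1"]])
    show "\<forall>\<^sub>F n in sequentially. real n powr (- (C * ln (1 / \<rho>) - 1)) = real n * \<rho> powr (C * ln (real n))"
      using e
    proof eventually_elim
      case (elim n)
      have "real n * \<rho> powr (C * ln (real n)) = exp (ln (real n)) * exp (C * ln (real n) * ln \<rho>)"
        using elim \<rho> by (simp add: powr_def)
      also have "\<dots> = exp ((1 + C * ln \<rho>) * ln (real n))" by (simp add: algebra_simps flip: exp_add)
      finally show ?case using elim \<rho> by (simp add: powr_def ln_div algebra_simps)
    qed
  qed (use C in simp)
  have 2: "(\<lambda>n. exp (c1 * (C * ln (real n))) / sqrt n) \<longlonglongrightarrow> 0"
  proof (rule Lim_transform_eventually[OF lim[of "1 / 2 - c1 * C"]])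
    show "\<forall>\<^sub>F n in sequentially. real n powr (- (1 / 2 - c1 * C)) = exp (c1 * (C * ln (real n))) / sqrt n"
      using e
    proof eventually_elim
      case (elim n)
      then have "sqrt n = exp (ln (real n) / 2)" by (simp add: powr_half_sqrt[symmetric] powr_def)
      then show ?case using elim by (simp add: powr_def algebra_simps flip: exp_diff)
    qed
  qed (use C in simp)
  have 3: "(\<lambda>n. (\<rho> / r) powr (C * ln (real n))) \<longlonglongrightarrow> 0"
  proof (rule Lim_transform_eventually[OF lim[of "- (C * ln (\<rho> / r))"]])
    show "\<forall>\<^sub>F n in sequentially. real n powr (- (- (C * ln (\<rho> / r)))) = (\<rho> / r) powr (C * ln (real n))"
      using e by eventually_elim (use \<rho> in \<open>simp add: powr_def mult_ac\<close>)
    have "ln (\<rho> / r) < 0" using \<rho> by simp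
    then show "- (C * ln (\<rho> / r)) > 0" using C by (simp add: mult_pos_neg)
  qed
  have 4: "(\<lambda>n. 1 / sqrt (real n)) \<longlonglongrightarrow> 0"
  proof (rule Lim_transform_eventually[OF lim[of "1 / 2"]])
    show "\<forall>\<^sub>F n in sequentially. real n powr (- (1 / 2)) = 1 / sqrt (real n)"
      by (intro always_eventually allI) (simp only: powr_minus powr_half_sqrt[OF of_nat_0_le_iff] inverse_eq_divide)
  qed simp
  show ?thesis unfolding rate_error_def using tendsto_add[OF tendsto_add[OF tendsto_add[OF 1 2] 3] 4] by simp
qed

text \<open>Split the weights into positive and negative parts. A combination of the two parts with
  coefficients \<open>s, t \<ge> 0\<close> has nonnegative bounded weights, which a rescaling brings
  into the unit interval; \<open>char_fun_negative_weight\<close> then turns the plus sign between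
  the parts into a minus.\<close>

lemma signed_clt:
  fixes M :: "nat \<Rightarrow> 'w measure"
  assumes net: "\<And>n. network_errors (M n) (N n) (e n) (d n) a cb \<rho> ch c1 cc"
    and m: "\<And>n. m n \<ge> 0" and r: "\<rho> < r" "r < 1" "r * exp (2 * c1) < 1"
    and err: "(\<lambda>n. rate_error (N n) \<rho> c1 r (m n)) \<longlonglongrightarrow> 0"
    and u: "\<And>n i. i < N n \<Longrightarrow> \<bar>u n i\<bar> \<le> L"
  shows "(\<lambda>n. (\<integral>w. iexp ((\<Sum>i<N n. u n i * e n w i) / sqrt (N n)) \<partial>M n)
    - of_real (exp (- ((\<Sum>i<N n. \<Sum>j<N n. u n i * u n j * Defs.Sigma (M n) (e n) i j) / N n) / 2))) \<longlonglongrightarrow> 0"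
proof -
  define p where "p n i = max (u n i) 0" for n i
  define q where "q n i = max (- u n i) 0" for n i
  define X where "X f n w = (\<Sum>i<N n. f n i * e n w i) / sqrt (N n)" for f n w
  define F where "F f g n = (\<Sum>i<N n. \<Sum>j<N n. f n i * g n j * Defs.Sigma (M n) (e n) i j) / N n" for f g n
  have L0: "max L 0 \<ge> 0" by simp
  have pq: "0 \<le> p n i" "p n i \<le> max L 0" "0 \<le> q n i" "q n i \<le> max L 0" "u n i = p n i - q n i" if "i < N n" for n i
    using u[OF that] by (auto simp: p_def q_def)
  have Fsym: "F f g n = F g f n" for f g n
  proof -
    interpret network_errors "M n" "N n" "e n" "d n" a cb \<rho> ch c1 cc by (rule net)
    show ?thesis unfolding F_def by (subst sum.swap) (simp add: S_sym mult_ac)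
  qed
  have quad: "F (\<lambda>n i. s * f n i + t * g n i) (\<lambda>n i. s * f n i + t * g n i) n = F f f n * s\<^sup>2 + 2 * F f g n * s * t + F g g n * t\<^sup>2" for f g s t n
  proof -
    have "F (\<lambda>n i. s * f n i + t * g n i) (\<lambda>n i. s * f n i + t * g n i) n = F f f n * s\<^sup>2 + F f g n * (s * t) + F g f n * (s * t) + F g g n * t\<^sup>2"
      unfolding F_def times_divide_eq_left sum_distrib_right add_divide_distrib[symmetric] sum.distrib[symmetric]
      by (intro arg_cong2[where f = "(/)"] sum.cong refl) (simp add: algebra_simps power2_eq_square)
    then show ?thesis using Fsym[of g f n] by simp
  qed
  have Xm: "X f n \<in> borel_measurable (M n)" for f n
  proof -
    interpret network_errors "M n" "N n" "e n" "d n" a cb \<rho> ch c1 cc by (rule net)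
    show ?thesis unfolding X_def by simp
  qed
  have Xlin: "X (\<lambda>n i. s * f n i + t * g n i) n w = s * X f n w + t * X g n w" for f g s t n w
    unfolding X_def by (simp add: sum.distrib sum_distrib_left distrib_right add_divide_distrib mult.assoc)
  have main: "(\<lambda>n. (\<integral>w. iexp (X p n w - X q n w) \<partial>M n) - of_real (exp (- (F p p n - 2 * F p q n + F q q n) / 2))) \<longlonglongrightarrow> 0"
  proof (rule char_fun_negative_weight[where K = "(max L 0)\<^sup>2 * (cb * decay_const c1 cc \<rho>)"])
    show "prob_space (M n)" for n
      using net[of n] by (simp add: network_errors_def)
    show "F p p n * s\<^sup>2 + 2 * F p q n * s * t + F q q n * t\<^sup>2 \<ge> 0" for n s t
    proof -
      interpret network_errors "M n" "N n" "e n" "d n" a cb \<rho> ch c1 cc by (rule net)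
      show ?thesis unfolding quad[symmetric] unfolding F_def by (rule quadratic_form_nonneg)
    qed
    show "F q q n \<le> (max L 0)\<^sup>2 * (cb * decay_const c1 cc \<rho>)" for n
    proof -
      interpret network_errors "M n" "N n" "e n" "d n" a cb \<rho> ch c1 cc by (rule net)
      have "(\<Sum>i<N n. \<Sum>j<N n. q n i * q n j * S i j) \<le> (\<Sum>i<N n. \<Sum>j<N n. (max L 0)\<^sup>2 * (cb * \<rho> powr d n i j))"
      proof (intro sum_mono)
        fix i j assume ij: "i \<in> {..<N n}" "j \<in> {..<N n}"
        have "\<bar>q n i * q n j * S i j\<bar> \<le> max L 0 * max L 0 * (cb * \<rho> powr d n i j)"
          unfolding abs_mult using ij pq[of i n] pq[of j n] L0 by (intro mult_mono S_bound) auto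
        then show "q n i * q n j * S i j \<le> (max L 0)\<^sup>2 * (cb * \<rho> powr d n i j)"
          unfolding power2_eq_square by linarith
      qed
      also have "\<dots> = (max L 0)\<^sup>2 * (cb * (\<Sum>i<N n. R \<rho> i ^ 1))"
        by (simp add: decay_sum_def sum_distrib_left)
      also have "\<dots> \<le> (max L 0)\<^sup>2 * (cb * (N n * KR \<rho>))"
        using rho rate cb_pos by (intro mult_left_mono decay_sum_power) auto
      finally show ?thesis unfolding F_def using n_pos by (simp add: pos_divide_le_eq mult_ac)
    qed
    show "(\<lambda>n. (\<integral>w. iexp (s * X p n w + t * X q n w) \<partial>M n) - of_real (exp (- (F p p n * s\<^sup>2 + 2 * F p q n * s * t + F q q n * t\<^sup>2) / 2))) \<longlonglongrightarrow> 0"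
      if st: "s \<ge> 0" "t \<ge> 0" for s t
    proof -
      \<comment> \<open>The added 1 keeps the scale positive when \<open>s\<close> and
        \<open>t\<close> vanish. \<open>T\<close> becomes the frequency in
        \<open>clt_unit_weights\<close>.\<close>
      define T where "T = max L 0 * (s + t) + 1"
      have T: "T > 0" using st by (simp add: T_def add_nonneg_pos)
      let ?f = "\<lambda>n i. s * p n i + t * q n i"
      have bd: "norm ((\<integral>w. iexp (s * X p n w + t * X q n w) \<partial>M n) - of_real (exp (- (F p p n * s\<^sup>2 + 2 * F p q n * s * t + F q q n * t\<^sup>2) / 2)))
        \<le> clt_const a cb ch cc (decay_const c1 cc \<rho>) (decay_const c1 cc r) T * rate_error (N n) \<rho> c1 r (m n)" for n
      proof -
        interpret network_errors "M n" "N n" "e n" "d n" a cb \<rho> ch c1 cc by (rule net)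
        have P: "0 \<le> ?f n j / T \<and> ?f n j / T \<le> 1" if "j < N n" for j
        proof -
          have "?f n j \<le> s * max L 0 + t * max L 0" using pq[OF that] st by (intro add_mono mult_left_mono) auto
          also have "\<dots> \<le> T" unfolding T_def by (simp add: algebra_simps)
          finally show ?thesis using pq[OF that] st T by simp
        qed
        have "T * ((\<Sum>j<N n. ?f n j / T * e n w j) / sqrt (N n)) = s * X p n w + t * X q n w" for w
          unfolding Xlin[symmetric] unfolding X_def using T by (simp add: sum_distrib_left sum_divide_distrib)
        moreover have "T\<^sup>2 * ((\<Sum>i<N n. \<Sum>j<N n. ?f n i / T * (?f n j / T) * S i j) / N n) = F p p n * s\<^sup>2 + 2 * F p q n * s * t + F q q n * t\<^sup>2"
          unfolding quad[symmetric] unfolding F_def times_divide_eq_right sum_distrib_left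
          using T by (intro arg_cong2[where f = "(/)"] sum.cong refl) (simp add: power2_eq_square)
        ultimately have "norm ((\<integral>w. iexp (s * X p n w + t * X q n w) \<partial>M n) - of_real (exp (- ((F p p n * s\<^sup>2 + 2 * F p q n * s * t + F q q n * t\<^sup>2) / 2))))
          \<le> weighted_clt_bound r (m n) T"
          using clt_unit_weights[of "\<lambda>j. ?f n j / T" "m n" T r, OF P m less_imp_le[OF T] r] by (simp only:)
        also have "\<dots> \<le> clt_const a cb ch cc (KR \<rho>) (KR r) T * err r (m n)"
          using T by (intro weighted_clt_bound_le m r) auto
        finally show ?thesis by (simp only: minus_divide_left)
      qed
      have "(\<lambda>n. clt_const a cb ch cc (decay_const c1 cc \<rho>) (decay_const c1 cc r) T * rate_error (N n) \<rho> c1 r (m n)) \<longlonglongrightarrow> 0"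
        by (rule tendsto_mult_right_zero[OF err])
      then show ?thesis by (rule Lim_null_comparison[OF always_eventually[OF allI[OF bd]]])
    qed
  qed (rule Xm)+
  have Xu: "X u n w = X p n w - X q n w" for n w
  proof -
    have "X u n w = X (\<lambda>n i. 1 * p n i + (-1) * q n i) n w"
      unfolding X_def by (intro arg_cong2[where f = "(/)"] sum.cong refl) (simp add: pq(5))
    then show ?thesis unfolding Xlin by simp
  qed
  have Fu: "F u u n = F p p n - 2 * F p q n + F q q n" for n
  proof -
    have "F u u n = F (\<lambda>n i. 1 * p n i + (-1) * q n i) (\<lambda>n i. 1 * p n i + (-1) * q n i) n"
      unfolding F_def by (intro arg_cong2[where f = "(/)"] sum.cong refl) (simp add: pq(5))
    then show ?thesis unfolding quad by simp
  qed
  show ?thesis using main unfolding Xu[symmetric] Fu[symmetric] unfolding X_def F_def .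
qed

theorem theorem1:
  fixes M :: "nat \<Rightarrow> 'w measure"
    and x :: "nat \<Rightarrow> nat \<Rightarrow> real^'p"
    and eps :: "nat \<Rightarrow> 'w \<Rightarrow> nat \<Rightarrow> real"
    and beta :: "real^'p"
    and d :: "nat \<Rightarrow> nat \<Rightarrow> nat \<Rightarrow> real"
    and N0 :: nat
    and ca cb cc \<rho> c1 :: real
  assumes dist: "\<forall>n\<ge>N0. is_distance n (d n)"
    and A1: "assumption1 N0 M x eps ca"
    and A2: "assumption2 N0 M eps d \<rho> cb"
    and A3: "assumption3 N0 d c1 cc"
    and rate: "2 * c1 < ln (1 / \<rho>)"
  shows "\<exists>C>0. conv_distr M
            (\<lambda>n w. stat n (x n) (d n) (C * ln (real n)) beta (eps n w))
            std_normal_vec"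
proof -
  have c: "ca > 0" "0 < \<rho>" "\<rho> < 1" "cb > 0" "c1 > 0" "cc > 0"
    using A1[unfolded assumption1_def, THEN conjunct1] A2[unfolded assumption2_def]
      A3[unfolded assumption3_def] by (simp_all only: simp_thms)
  note a2 = A2[unfolded assumption2_def, THEN conjunct2, THEN conjunct2, THEN conjunct2]
  note a2_pair = a2[THEN conjunct1] and a2_quad = a2[THEN conjunct2, THEN conjunct1]
  \<comment> \<open>Bounds 1 on \<open>h\<close> and \<open>h'\<close> cover cosine and sine, and
    the constant so obtained is uniform in \<open>n\<close>.\<close>
  obtain ch where ch: "ch > 0" and a2_fun: "\<forall>n\<ge>N0. \<forall>h h' t i U.
        (\<forall>y. \<bar>h y\<bar> \<le> 1) \<and> (\<forall>y. (h has_real_derivative h' y) (at y)) \<and> (\<forall>y. \<bar>h' y\<bar> \<le> 1) \<and>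
        i < n \<and> U \<subseteq> {..<n} \<and> U \<noteq> {} \<longrightarrow>
        \<bar>covar (M n) (\<lambda>w. eps n w i) (\<lambda>w. h (t * (\<Sum>j\<in>U. eps n w j)))\<bar>
          \<le> ch * (1 + \<bar>t\<bar> * real (card U)) * \<rho> powr (dset (d n) {i} U)"
    using a2[THEN conjunct2, THEN conjunct2, THEN spec[of _ 1], THEN spec[of _ 1]] by (elim exE conjE)
  have lnr: "ln (1 / \<rho>) = - ln \<rho>" using c by (simp add: ln_div)
  have er: "\<rho> < exp (- (2 * c1))"
  proof -
    have "ln \<rho> < - (2 * c1)" using rate lnr by linarith
    then have "exp (ln \<rho>) < exp (- (2 * c1))" by (simp only: exp_less_cancel_iff)
    then show ?thesis using c by simp
  qed
  have e1: "exp (- (2 * c1)) < 1" using c by simp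
  have cancel: "s * exp (2 * c1) < 1" if "s < exp (- (2 * c1))" for s
  proof -
    have "s * exp (2 * c1) < exp (- (2 * c1)) * exp (2 * c1)" using that by (rule mult_strict_right_mono) simp
    then show ?thesis by (simp flip: exp_add)
  qed
  \<comment> \<open>Midpoint between \<open>\<rho>\<close> and \<open>exp (- (2 * c1))\<close>:
    slower decay than \<open>\<rho>\<close>, yet still summable against the network growth.\<close>
  define r where "r = (\<rho> + exp (- (2 * c1))) / 2"
  have r12: "\<rho> < r" "r < exp (- (2 * c1))" using er by (auto simp: r_def)
  have r: "\<rho> < r" "r < 1" "r * exp (2 * c1) < 1"
    using r12 e1 cancel[OF r12(2)] by linarith+
  \<comment> \<open>Midpoint of the admissible interval, nonempty by the rate hypothesis.\<close>
  define C where "C = (1 / ln (1 / \<rho>) + 1 / (2 * c1)) / 2"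
  have lp: "ln (1 / \<rho>) > 0" using rate c by linarith
  have inv: "1 / ln (1 / \<rho>) < 1 / (2 * c1)" using rate c lp by (intro divide_strict_left_mono) auto
  have C1: "1 / ln (1 / \<rho>) < C" "C < 1 / (2 * c1)" using inv by (auto simp: C_def)
  have C: "C * ln (1 / \<rho>) > 1" "2 * c1 * C < 1" "C > 0"
  proof -
    show "C * ln (1 / \<rho>) > 1" using C1(1) lp by (simp only: pos_divide_less_eq)
    show "2 * c1 * C < 1" using C1(2) c by (simp add: pos_less_divide_eq mult_ac)
    show "C > 0" using C1(1) lp by (meson less_trans zero_less_divide_1_iff)
  qed
  \<comment> \<open>Shifting the sequence makes every sample size positive and covered by the
    assumptions, so hypotheses hold for all indices; the shift is undone in the final limit.\<close>
  define N1 where "N1 = max N0 1"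
  define N where "N n = n + N1" for n
  have reg: "network_regression (M (N n)) (N n) (eps (N n)) (d (N n)) ca cb \<rho> ch c1 cc (x (N n)) (real CARD('p))" for n
  proof -
    let ?n = "N n"
    have n: "?n \<ge> N0" "?n > 0" by (auto simp: N_def N1_def)
    note a1 = A1[unfolded assumption1_def, THEN conjunct2, rule_format, OF n(1)]
    note a3 = A3[unfolded assumption3_def, THEN conjunct2, THEN conjunct2, rule_format, OF n(1)]
    interpret prob_space "M ?n" using a1 by blast
    have g: "sqrt ((1 / real ?n) * (\<Sum>i<?n. real (nbhd_size ?n (d ?n) m i) ^ 3)) \<le> cc * exp (c1 * m)"
      "(1 / real ?n) * (\<Sum>i<?n. real (nbhd_size ?n (d ?n) m i) ^ 2) \<le> cc * exp (c1 * m)" if "m \<ge> 0" for m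
      using a3[OF that] by simp_all
    show ?thesis
    proof unfold_locales
      show "\<rho> * exp (2 * c1) < 1" by (rule cancel[OF er])
      show "is_distance ?n (d ?n)" using dist n by blast
      show "\<bar>\<integral>w. eps ?n w i * eps ?n w j \<partial>M ?n\<bar> \<le> cb * \<rho> powr d ?n i j" if "i < ?n" "j < ?n" for i j
        using a2_pair[rule_format, OF n(1) that, of 1] by simp
      show "\<bar>covar (M ?n) (\<lambda>w. eps ?n w i * eps ?n w j) (\<lambda>w. eps ?n w k * eps ?n w l)\<bar> \<le> cb * \<rho> powr dset (d ?n) {i, j} {k, l}"
        if "i < ?n" "j < ?n" "k < ?n" "l < ?n" for i j k l
        by (rule a2_quad[rule_format, OF n(1) that])
      show "\<bar>covar (M ?n) (\<lambda>w. eps ?n w i) (\<lambda>w. h (t * (\<Sum>j\<in>U. eps ?n w j)))\<bar>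
          \<le> ch * (1 + \<bar>t\<bar> * real (card U)) * \<rho> powr dset (d ?n) {i} U"
        if "\<And>y. \<bar>h y\<bar> \<le> 1" "\<And>y. (h has_real_derivative h' y) (at y)" "\<And>y. \<bar>h' y\<bar> \<le> 1" "i < ?n" "U \<subseteq> {..<?n}" "U \<noteq> {}"
        for h h' t i U
        using that by (intro a2_fun[rule_format, OF n(1)] conjI allI)
      show "(\<Sum>i<?n. real (nbhd_size ?n (d ?n) m i) ^ 2) \<le> real ?n * (cc * exp (c1 * m))" if "m \<ge> 0" for m
        using g(2)[OF that] n by (simp add: pos_divide_le_eq mult.commute)
      show "(\<Sum>i<?n. real (nbhd_size ?n (d ?n) m i) ^ 3) \<le> real ?n * (cc\<^sup>2 * exp (2 * c1 * m))" if "m \<ge> 0" for m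
      proof -
        have "(1 / real ?n) * (\<Sum>i<?n. real (nbhd_size ?n (d ?n) m i) ^ 3) \<le> (cc * exp (c1 * m))\<^sup>2"
          by (rule sqrt_le_D[OF g(1)[OF that]])
        also have "\<dots> = cc\<^sup>2 * exp (2 * c1 * m)" by (simp add: power2_eq_square flip: exp_add)
        finally show ?thesis using n by (simp add: pos_divide_le_eq mult.commute)
      qed
    qed (use a1 c ch n in auto)
  qed
  have net: "network_errors (M (N n)) (N n) (eps (N n)) (d (N n)) ca cb \<rho> ch c1 cc" for n
    using reg[of n] by (simp add: network_regression_def)
  define m where "m n = C * ln (real (N n))" for n
  have m0: "m n \<ge> 0" for n unfolding m_def N_def N1_def using C(3) by simp
  have err: "(\<lambda>n. rate_error (N n) \<rho> c1 r (m n)) \<longlonglongrightarrow> 0"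
    unfolding m_def N_def by (rule LIMSEQ_ignore_initial_segment[OF rate_error_tendsto[OF c(2) r(1) C]])
  define T where "T n w = stat (N n) (x (N n)) (d (N n)) (m n) beta (eps (N n) w)" for n w
  have Tm: "T n \<in> borel_measurable (M (N n))" for n
  proof -
    interpret network_regression "M (N n)" "N n" "eps (N n)" "d (N n)" ca cb \<rho> ch c1 cc "x (N n)" beta "real CARD('p)"
      by (rule reg)
    show ?thesis unfolding T_def by (rule stat_measurable)
  qed
  have Mp: "prob_space (M (N n))" for n using net[of n] by (simp add: network_errors_def)
  have char: "(\<lambda>n. \<integral>w. iexp (v \<bullet> T n w) \<partial>M (N n)) \<longlonglongrightarrow> of_real (exp (- (norm v)\<^sup>2 / 2))" for v :: "real^'p"
  proof -
    let ?P = "real CARD('p)"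
    define H where "H n = inv_sqrtm (XtSigmaX (N n) (x (N n)) (M (N n)) (eps (N n)))" for n
    define Z where "Z n w = (\<Sum>i<N n. eps (N n) w i *\<^sub>R x (N n) i)" for n w
    define u where "u n i = sqrt (N n) * (x (N n) i \<bullet> (H n *v v))" for n i
    have w1: "v \<bullet> (H n *v Z n w) = (\<Sum>i<N n. u n i * eps (N n) w i) / sqrt (N n)"
      and w2: "i < N n \<Longrightarrow> \<bar>u n i\<bar> \<le> ?P * ca * sqrt ca * norm v"
      and w3: "(\<Sum>i<N n. \<Sum>j<N n. u n i * u n j * Defs.Sigma (M (N n)) (eps (N n)) i j) / N n = (norm v)\<^sup>2" for n w i
    proof -
      interpret R: network_regression "M (N n)" "N n" "eps (N n)" "d (N n)" ca cb \<rho> ch c1 cc "x (N n)" beta "real CARD('p)"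
        by (rule reg)
      note ww = R.whitened_weights[where v = v, folded H_def u_def, unfolded R.Z_def, folded Z_def]
      show "v \<bullet> (H n *v Z n w) = (\<Sum>i<N n. u n i * eps (N n) w i) / sqrt (N n)" by (rule ww(1))
      show "i < N n \<Longrightarrow> \<bar>u n i\<bar> \<le> ?P * ca * sqrt ca * norm v" by (rule ww(2))
      show "(\<Sum>i<N n. \<Sum>j<N n. u n i * u n j * Defs.Sigma (M (N n)) (eps (N n)) i j) / N n = (norm v)\<^sup>2" by (rule ww(3))
    qed
    have "(\<lambda>n. (\<integral>w. iexp ((\<Sum>i<N n. u n i * eps (N n) w i) / sqrt (N n)) \<partial>M (N n))
      - of_real (exp (- ((\<Sum>i<N n. \<Sum>j<N n. u n i * u n j * Defs.Sigma (M (N n)) (eps (N n)) i j) / N n) / 2))) \<longlonglongrightarrow> 0"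
      by (rule signed_clt[where M = "\<lambda>n. M (N n)" and e = "\<lambda>n. eps (N n)" and d = "\<lambda>n. d (N n)" and N = N, OF net m0 r err w2])
    then have lim: "(\<lambda>n. (\<integral>w. iexp (v \<bullet> (H n *v Z n w)) \<partial>M (N n)) - of_real (exp (- (norm v)\<^sup>2 / 2))) \<longlonglongrightarrow> 0"
      unfolding w1[symmetric] w3 .
    define sc where "sc = shat_const ca cb cc ?P (decay_const c1 cc \<rho>) (decay_const c1 cc r)"
    define K where "K = norm v * (sqrt (2 * ca) * (2 * ca\<^sup>2)) * sqrt (?P * ca)"
    have K0: "K \<ge> 0" using c by (simp add: K_def)
    have stud: "cmod ((\<integral>w. iexp (v \<bullet> T n w) \<partial>M (N n)) - (\<integral>w. iexp (v \<bullet> (H n *v Z n w)) \<partial>M (N n)))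
      \<le> 2 / \<eta> * (sc * rate_error (N n) \<rho> c1 r (m n)) + K * \<eta>" if \<eta>: "0 < \<eta>" "\<eta> \<le> 1 / (2 * ca)" "\<eta> \<le> ca" for n \<eta>
    proof -
      interpret R: network_regression "M (N n)" "N n" "eps (N n)" "d (N n)" ca cb \<rho> ch c1 cc "x (N n)" beta "real CARD('p)"
        by (rule reg)
      note st = R.studentization_error[OF m0[of n] r \<eta>, where v = v, folded H_def T_def sc_def, unfolded R.Z_def, folded Z_def]
      have "norm v * (\<eta> * (sqrt (2 * ca) * (2 * ca\<^sup>2))) * sqrt (?P * ca) = K * \<eta>" unfolding K_def by (simp only: mult_ac)
      then show ?thesis using st by (simp only:)
    qed
    have diff: "(\<lambda>n. (\<integral>w. iexp (v \<bullet> T n w) \<partial>M (N n)) - (\<integral>w. iexp (v \<bullet> (H n *v Z n w)) \<partial>M (N n))) \<longlonglongrightarrow> 0"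
    proof (rule LIMSEQ_I)
      fix \<epsilon> :: real assume \<epsilon>: "\<epsilon> > 0"
      \<comment> \<open>First \<open>\<eta>\<close> makes the Lipschitz part at most
        \<open>\<epsilon> / 2\<close>, uniformly in \<open>n\<close>; then \<open>n\<close> makes
        the part with \<open>2 / \<eta>\<close> small. The \<open>1\<close> in \<open>K + 1\<close>
        guards against \<open>K = 0\<close>.\<close>
      define \<eta> where "\<eta> = min (\<epsilon> / (2 * (K + 1))) (min (1 / (2 * ca)) ca)"
      have \<eta>: "0 < \<eta>" "\<eta> \<le> 1 / (2 * ca)" "\<eta> \<le> ca" "\<eta> \<le> \<epsilon> / (2 * (K + 1))"
        using \<epsilon> K0 c by (auto simp: \<eta>_def)
      have "K * \<eta> \<le> K * (\<epsilon> / (2 * (K + 1)))" using \<eta>(4) K0 by (rule mult_left_mono)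
      also have "\<dots> \<le> \<epsilon> / 2" using K0 \<epsilon> by (simp add: field_simps)
      finally have K\<eta>: "K * \<eta> \<le> \<epsilon> / 2" .
      have "(\<lambda>n. 2 / \<eta> * (sc * rate_error (N n) \<rho> c1 r (m n))) \<longlonglongrightarrow> 0"
        by (intro tendsto_mult_right_zero err)
      from LIMSEQ_D[OF this, of "\<epsilon> / 2"] \<epsilon> obtain n0 where n0: "\<And>n. n \<ge> n0 \<Longrightarrow> \<bar>2 / \<eta> * (sc * rate_error (N n) \<rho> c1 r (m n))\<bar> < \<epsilon> / 2"
        by auto
      show "\<exists>n0. \<forall>n\<ge>n0. norm ((\<integral>w. iexp (v \<bullet> T n w) \<partial>M (N n)) - (\<integral>w. iexp (v \<bullet> (H n *v Z n w)) \<partial>M (N n)) - 0) < \<epsilon>"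
      proof (intro exI[of _ n0] allI impI)
        fix n assume "n \<ge> n0"
        from n0[OF this] stud[OF \<eta>(1-3), of n] K\<eta>
        show "norm ((\<integral>w. iexp (v \<bullet> T n w) \<partial>M (N n)) - (\<integral>w. iexp (v \<bullet> (H n *v Z n w)) \<partial>M (N n)) - 0) < \<epsilon>"
          unfolding diff_zero by linarith
      qed
    qed
    have "(\<lambda>n. (\<integral>w. iexp (v \<bullet> T n w) \<partial>M (N n)) - of_real (exp (- (norm v)\<^sup>2 / 2))) \<longlonglongrightarrow> 0"
      using tendsto_add[OF diff lim] by simp
    then show ?thesis by (simp only: LIM_zero_iff)
  qed
  have "conv_distr M (\<lambda>n w. stat n (x n) (d n) (C * ln (real n)) beta (eps n w)) std_normal_vec"
    unfolding conv_distr_def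
  proof (intro conjI allI impI)
    have "(\<lambda>w. stat n (x n) (d n) (C * ln (real n)) beta (eps n w)) \<in> borel_measurable (M n)" if "n \<ge> N1" for n
      using Tm[of "n - N1"] that unfolding T_def m_def N_def by simp
    then show "\<forall>\<^sub>F n in sequentially. (\<lambda>w. stat n (x n) (d n) (C * ln (real n)) beta (eps n w)) \<in> borel_measurable (M n)"
      unfolding eventually_sequentially by blast
    fix f :: "real^'p \<Rightarrow> real" assume f: "continuous_on UNIV f \<and> bounded (range f)"
    have "(\<lambda>n. \<integral>w. f (T n w) \<partial>M (N n)) \<longlonglongrightarrow> (\<integral>z. f z \<partial>std_normal_vec)"
      using f by (intro levy_continuity_std_normal_vec[OF Mp Tm char]) auto
    then show "(\<lambda>n. \<integral>w. f (stat n (x n) (d n) (C * ln (real n)) beta (eps n w)) \<partial>M n) \<longlonglongrightarrow> (\<integral>z. f z \<partial>std_normal_vec)"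
      unfolding T_def m_def N_def by (rule LIMSEQ_offset)
  qed
  then show ?thesis using C(3) by blast
qed

end
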